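(* Let $P(\xi)$ be a projective bundle, with fibre $\mathbb{R}P^{k-1}$, over a $2$-dimensional small cover $M^2$, where $\xi$ is a Whitney sum of $k$ line bundles. Then $P(\xi)$ can be constructed from projective bundles over $\mathbb{R}P^2$ and over $T^2$, with the same fibre $\mathbb{R}P^{k-1}$, by using the projective fibre sum $\sharp_{\Delta^{k-1}}$. Precisely, $P(\xi)$ is weak equivariantly homeomorphic to $$P(\kappa_1)\,\sharp_{\Delta^{k-1}}\cdots\sharp_{\Delta^{k-1}}\,P(\kappa_{l_1})\,\sharp_{\Delta^{k-1}}\,P(\zeta_1)\,\sharp_{\Delta^{k-1}}\cdots\sharp_{\Delta^{k-1}}\,P(\zeta_{l_2})$$ for some vector bundles $\kappa_1,\dots,\kappa_{l_1}$ over $\mathbb{R}P^2$ and $\zeta_1,\dots,\zeta_{l_2}$ over $T^2$, each of which is a Whitney sum of $k$ line bundles.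
   Context: $\mathbb{Z}_2=\{-1,1\}$, $\mathbb{Z}/2\mathbb{Z}=\{0,1\}$; for $v\in(\mathbb{Z}/2\mathbb{Z})^N$ put $(\mathbf{-1})^v=((-1)^{v_1},\dots,(-1)^{v_N})$. Small covers. A small cover of dimension $N$ is a closed smooth $N$-manifold with a locally standard $\mathbb{Z}_2^N$-action (locally the same as the coordinatewise sign action on $\mathbb{R}^N$) whose orbit space is a simple convex $N$-polytope $Q$. It is determined by $Q$ and a characteristic function $\lambda$, i.e. a function from the facets of $Q$ to $(\mathbb{Z}/2\mathbb{Z})^N$ such that the values on any $N$ facets with a common vertex span $(\mathbb{Z}/2\mathbb{Z})^N$: it is $M(Q,\lambda)=\mathbb{Z}_2^N\times Q/\!\sim_\lambda$, where $(t,x)\sim_\lambda(t',y)$ iff $x=y$ and $t^{-1}t'$ lies in the subgroup generated by the $(\mathbf{-1})^{\lambda(F)}$ for the facets $F\ni x$. Weak equivariance. Two $G$-manifolds are weak equivariantly homeomorphic if they are equivariantly homeomorphic up to an automorphism of $G$. Projective characteristic functions. $P(\xi)$ denotes the projectivization of a vector bundle $\xi$. Let $\xi$ be a Whitney sum of $k$ real line bundles over a 2-dimensional small cover $M^2$ with orbit polygon $P$. Then $P(\xi)$ is a small cover over $P\times\Delta^{k-1}$ (under $\mathbb{Z}_2^2\times\mathbb{Z}_2^{k-1}$). It is encoded by a $(k-1)$-dimensional projective characteristic function on $P$: a function $\lambda_P$ from the set of facets (edges) of $P$ to $(\mathbb{Z}/2\mathbb{Z})^2\times(\mathbb{Z}/2\mathbb{Z})^{k-1}$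 such that, with $p_a$ the projection to the first factor, $p_a(\lambda_P(F)),p_a(\lambda_P(F'))$ form a basis of $(\mathbb{Z}/2\mathbb{Z})^2$ whenever $F\ne F'$ meet (so $p_a\circ\lambda_P$ is the characteristic function of $M^2$). The corresponding characteristic function on $P\times\Delta^{k-1}$ sends $F\times\Delta^{k-1}$ to $\lambda_P(F)$ and the $k$ facets $P\times G$ ($G$ a facet of $\Delta^{k-1}$) to $0\times e_1,\dots,0\times e_{k-1},0\times\mathbf{1}$, where $\mathbf 1=(1,\dots,1)$. By an automorphism of the group one may normalize the values of $\lambda_P$ on the two facets at a chosen vertex to $e_1\times\mathbf{0}$, $e_2\times\mathbf{0}$; this normalization is not required when forming fibre sums. Every pair $(P,\lambda_P)$ corresponds in this way, up to weak equivariant homeomorphism, to the projectivization of a Whitney sum of $k$ line bundles over the small cover $M(P,p_a\circ\lambda_P)$. Projective fibre sum. Given $(P,\lambda_P)$ and $(P',\lambda_{P'})$ with the same target $(\mathbb{Z}/2\mathbb{Z})^2\times(\mathbb{Z}/2\mathbb{Z})^{k-1}$, and vertices $p=F_1\cap F_2$ of $P$ and $q=F_1'\cap F_2'$ of $P'$ with $\lambda_P(F_i)=\lambda_{P'}(F_i')$ for $i=1,2$, the projective fibre sum $\sharp_{\Delta^{k-1}}$ is the connected sum of polygons at $p$ and $q$ (cut off the two vertices and glue along the new edges, merging $F_i$ with $F_i'$), with the induced projective characteristic function. Geometrically it is the equivariant gluing (fibre sum) of the two bundles along the fibres $\mathbb{R}P^{k-1}$ over the fixed points corresponding to $p$ and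 $q$; it gives a projective bundle over the equivariant connected sum of the two base small covers. An expression $X_1\sharp_{\Delta^{k-1}}\cdots\sharp_{\Delta^{k-1}}X_r$ denotes a manifold obtained from $X_1,\dots,X_r$ by successively performing $r-1$ such fibre sums at suitable matching vertices. Here $\mathbb{R}P^2$ is the small cover over the triangle and $T^2=\mathbb{R}P^1\times\mathbb{R}P^1$ the small cover over the square with the product of the standard actions. *)

theory Defs
  imports
    "HOL-Analysis.Analysis"
    "HOL-Homology.Simplices"
    "HOL-Library.Z2"
    "HOL-Library.Function_Algebras"
begin

text \<open>
  The acting groups \<open>{-1,1}\<^sup>N\<close> are written additively: an element \<open>v\<close> of \<open>(Z/2)\<^sup>N\<close> stands
  for the sign vector with entries \<open>(-1)\<close> to the power \<open>v\<^sub>i\<close>.  The field \<open>Z/2\<close> is \<^typ>\<open>bit\<close>.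
\<close>


section \<open>Group actions and weak equivariance\<close>

definition group_action_on ::
  "'g::group_add set \<Rightarrow> 'a topology \<Rightarrow> ('g \<Rightarrow> 'a \<Rightarrow> 'a) \<Rightarrow> bool" where
  "group_action_on G X a \<longleftrightarrow>
     (\<forall>g\<in>G. continuous_map X X (a g)) \<and>
     (\<forall>x\<in>topspace X. a 0 x = x) \<and>
     (\<forall>g\<in>G. \<forall>h\<in>G. \<forall>x\<in>topspace X. a (g + h) x = a g (a h x))"

definition group_automorphism :: "'g::group_add set \<Rightarrow> ('g \<Rightarrow> 'g) \<Rightarrow> bool" where
  "group_automorphism G \<phi> \<longleftrightarrow>
     bij_betw \<phi> G G \<and> (\<forall>g\<in>G. \<forall>h\<in>G. \<phi> (g + h) = \<phi> g + \<phi> h)"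

definition weak_equivariant_map ::
  "'g::group_add set \<Rightarrow> ('g \<Rightarrow> 'g) \<Rightarrow> 'a topology \<Rightarrow> ('g \<Rightarrow> 'a \<Rightarrow> 'a)
     \<Rightarrow> 'b topology \<Rightarrow> ('g \<Rightarrow> 'b \<Rightarrow> 'b) \<Rightarrow> ('a \<Rightarrow> 'b) \<Rightarrow> bool" where
  "weak_equivariant_map G \<phi> X a Y b f \<longleftrightarrow>
     homeomorphic_map X Y f \<and> group_automorphism G \<phi> \<and>
     (\<forall>g\<in>G. \<forall>x\<in>topspace X. f (a g x) = b (\<phi> g) (f x))"

definition equivariantly_homeomorphic ::
  "'g::group_add set \<Rightarrow> 'a topology \<Rightarrow> ('g \<Rightarrow> 'a \<Rightarrow> 'a)
     \<Rightarrow> 'b topology \<Rightarrow> ('g \<Rightarrow> 'b \<Rightarrow> 'b) \<Rightarrow> bool" where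
  "equivariantly_homeomorphic G X a Y b \<longleftrightarrow> (\<exists>f. weak_equivariant_map G id X a Y b f)"

definition weak_equivariantly_homeomorphic ::
  "'g::group_add set \<Rightarrow> 'a topology \<Rightarrow> ('g \<Rightarrow> 'a \<Rightarrow> 'a)
     \<Rightarrow> 'b topology \<Rightarrow> ('g \<Rightarrow> 'b \<Rightarrow> 'b) \<Rightarrow> bool" where
  "weak_equivariantly_homeomorphic G X a Y b \<longleftrightarrow>
     (\<exists>\<phi> f. weak_equivariant_map G \<phi> X a Y b f)"


section \<open>Quotient spaces\<close>

definition quotient_top :: "'a topology \<Rightarrow> ('a \<Rightarrow> 'b) \<Rightarrow> 'b topology" where
  "quotient_top X q =
     topology (\<lambda>U. U \<subseteq> q ` topspace X \<and> openin X {x \<in> topspace X. q x \<in> U})"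

lemma openin_quotient_top:
  "openin (quotient_top X q) U \<longleftrightarrow>
     U \<subseteq> q ` topspace X \<and> openin X {x \<in> topspace X. q x \<in> U}"
proof -
  have "istopology (\<lambda>U. U \<subseteq> q ` topspace X \<and> openin X {x \<in> topspace X. q x \<in> U})"
    unfolding istopology_def
  proof (intro conjI allI impI)
      fix S T
    assume S: "S \<subseteq> q ` topspace X \<and> openin X {x \<in> topspace X. q x \<in> S}"
      and T: "T \<subseteq> q ` topspace X \<and> openin X {x \<in> topspace X. q x \<in> T}"
    then show "S \<inter> T \<subseteq> q ` topspace X" by blast
    have "openin X ({x \<in> topspace X. q x \<in> S} \<inter> {x \<in> topspace X. q x \<in> T})"
      using S T by (intro openin_Int) simp_all
    also have "{x \<in> topspace X. q x \<in> S} \<inter> {x \<in> topspace X. q x \<in> T} =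
        {x \<in> topspace X. q x \<in> S \<inter> T}"
      by blast
    finally show "openin X {x \<in> topspace X. q x \<in> S \<inter> T}" .
  next
    fix \<U>
    assume *: "\<forall>K\<in>\<U>. K \<subseteq> q ` topspace X \<and> openin X {x \<in> topspace X. q x \<in> K}"
    then show "\<Union>\<U> \<subseteq> q ` topspace X" by blast
    have "openin X (\<Union>((\<lambda>K. {x \<in> topspace X. q x \<in> K}) ` \<U>))"
      using * by (intro openin_Union) blast
    also have "\<Union>((\<lambda>K. {x \<in> topspace X. q x \<in> K}) ` \<U>) = {x \<in> topspace X. q x \<in> \<Union>\<U>}"
      by blast
    finally show "openin X {x \<in> topspace X. q x \<in> \<Union>\<U>}" .
  qed
  then show ?thesis
    by (simp add: quotient_top_def topology_inverse')
qed

lemma topspace_quotient_top [simp]: "topspace (quotient_top X q) = q ` topspace X"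
proof
  show "topspace (quotient_top X q) \<subseteq> q ` topspace X"
    using openin_topspace[of "quotient_top X q"] unfolding openin_quotient_top by (rule conjunct1)
  have "{x \<in> topspace X. q x \<in> q ` topspace X} = topspace X" by blast
  then have "openin (quotient_top X q) (q ` topspace X)"
    unfolding openin_quotient_top by (metis openin_topspace subset_refl)
  then show "q ` topspace X \<subseteq> topspace (quotient_top X q)"
    by (rule openin_subset)
qed

lemma quotient_map_quotient_top: "quotient_map X (quotient_top X q) q"
  unfolding quotient_map_def openin_quotient_top topspace_quotient_top by blast


section \<open>The spaces \<open>M(Q, \<lambda>)\<close>\<close>

definition generated_subgroup :: "'g::group_add set \<Rightarrow> 'g set" where
  "generated_subgroup S = (\<lambda>H. 0 \<in> H \<and> (\<forall>x\<in>H. \<forall>y\<in>H. x - y \<in> H)) hull S"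

text \<open>
  In the next three definitions \<open>C\<close> is the graph of a characteristic function, i.e. the set of
  all pairs of a facet and its value, and \<open>Q\<close> is the orbit space.
\<close>

definition isotropy_at :: "('x set \<times> 'g::group_add) set \<Rightarrow> 'x \<Rightarrow> 'g set" where
  "isotropy_at C x = generated_subgroup {v. \<exists>F. (F, v) \<in> C \<and> x \<in> F}"

definition glue_class ::
  "'g::group_add set \<Rightarrow> ('x set \<times> 'g) set \<Rightarrow> 'g \<times> 'x \<Rightarrow> ('g \<times> 'x) set" where
  "glue_class G C = (\<lambda>(t, x). {(t', x) | t'. t' \<in> G \<and> - t + t' \<in> isotropy_at C x})"

definition glued_space ::
  "'g::group_add set \<Rightarrow> ('x set \<times> 'g) set \<Rightarrow> 'x topology \<Rightarrow> ('g \<times> 'x) set topology" where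
  "glued_space G C Q = quotient_top (prod_topology (discrete_topology G) Q) (glue_class G C)"

definition glued_action :: "'g::group_add \<Rightarrow> ('g \<times> 'x) set \<Rightarrow> ('g \<times> 'x) set" where
  "glued_action g c = (\<lambda>(t, x). (g + t, x)) ` c"


section \<open>Two-dimensional small covers\<close>

type_synonym plane = "real^2"
type_synonym base_group = "bit^2"

definition polygon :: "plane set \<Rightarrow> bool" where
  "polygon P \<longleftrightarrow> polytope P \<and> aff_dim P = 2"

definition facets :: "plane set \<Rightarrow> plane set set" where
  "facets P = {F. F facet_of P}"

definition characteristic_function :: "plane set \<Rightarrow> (plane set \<Rightarrow> base_group) \<Rightarrow> bool" where
  "characteristic_function P \<mu> \<longleftrightarrow>
     (\<forall>F\<in>facets P. \<forall>F'\<in>facets P. F \<noteq> F' \<and> F \<inter> F' \<noteq> {} \<longrightarrow> vec.span {\<mu> F, \<mu> F'} = UNIV)"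

definition surface_cover ::
  "plane set \<Rightarrow> (plane set \<Rightarrow> base_group) \<Rightarrow> (base_group \<times> plane) set topology" where
  "surface_cover P \<mu> = glued_space UNIV {(F, \<mu> F) | F. F \<in> facets P} (top_of_set P)"

text \<open>
  Small covers enter through the Davis-Januszkiewicz construction: the closed smooth surfaces with
  a locally standard action whose orbit space is \<open>P\<close> are, up to equivariant homeomorphism,
  precisely the spaces \<open>M(P, \<mu>)\<close>.
\<close>

definition small_cover_over :: "plane set \<Rightarrow> 'm topology \<Rightarrow> (base_group \<Rightarrow> 'm \<Rightarrow> 'm) \<Rightarrow> bool" where
  "small_cover_over P M a \<longleftrightarrow>
     polygon P \<and> group_action_on UNIV M a \<and>
     (\<exists>\<mu>. characteristic_function P \<mu> \<and>
          equivariantly_homeomorphic UNIV M a (surface_cover P \<mu>) glued_action)"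

definition RP2 :: "(base_group \<times> plane) set topology" where
  "RP2 = surface_cover (convex hull {0, axis 1 1, axis 2 1})
     (\<lambda>F. if F \<subseteq> {x. x $ 1 = 0} then axis 1 1
          else if F \<subseteq> {x. x $ 2 = 0} then axis 2 1
          else axis 1 1 + axis 2 1)"

text \<open>
  The circle \<open>RP\<^sup>1\<close> with the standard action is the small cover over an interval.  The product of
  two copies is the small cover over the square whose characteristic function takes the value
  \<open>e\<^sub>i\<close> on the two edges on which the \<open>i\<close>-th coordinate is constant.
\<close>

definition T2 :: "(base_group \<times> plane) set topology" where
  "T2 = surface_cover {x. \<forall>i. 0 \<le> x $ i \<and> x $ i \<le> 1}
     (\<lambda>F. if F \<subseteq> {x. x $ 1 = 0} \<or> F \<subseteq> {x. x $ 1 = 1} then axis 1 1 else axis 2 1)"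


section \<open>Real vector bundles, Whitney sums and projectivizations\<close>

text \<open>The operations are only meaningful on vectors of the total space, in a common fibre.\<close>

record ('e, 'b) vbundle =
  vb_total :: "'e topology"
  vb_base :: "'b topology"
  vb_proj :: "'e \<Rightarrow> 'b"
  vb_add :: "'e \<Rightarrow> 'e \<Rightarrow> 'e"
  vb_scale :: "real \<Rightarrow> 'e \<Rightarrow> 'e"

definition fibrewise_linear ::
  "('e, 'b) vbundle \<Rightarrow> 'e set \<Rightarrow> ('f \<Rightarrow> 'f \<Rightarrow> 'f) \<Rightarrow> (real \<Rightarrow> 'f \<Rightarrow> 'f) \<Rightarrow> ('e \<Rightarrow> 'f) \<Rightarrow> bool" where
  "fibrewise_linear \<xi> S add' scale' T \<longleftrightarrow>
     (\<forall>v\<in>S. \<forall>w\<in>S. vb_proj \<xi> v = vb_proj \<xi> w \<longrightarrow> T (vb_add \<xi> v w) = add' (T v) (T w)) \<and>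
     (\<forall>c. \<forall>v\<in>S. T (vb_scale \<xi> c v) = scale' c (T v))"

text \<open>
  The vector space axioms in the fibres follow from local triviality, since the trivializations
  are injective.
\<close>

definition vector_bundle :: "nat \<Rightarrow> ('e, 'b) vbundle \<Rightarrow> bool" where
  "vector_bundle n \<xi> \<longleftrightarrow>
     continuous_map (vb_total \<xi>) (vb_base \<xi>) (vb_proj \<xi>) \<and>
     (\<forall>v\<in>topspace (vb_total \<xi>). \<forall>w\<in>topspace (vb_total \<xi>). vb_proj \<xi> v = vb_proj \<xi> w \<longrightarrow>
        vb_add \<xi> v w \<in> topspace (vb_total \<xi>) \<and> vb_proj \<xi> (vb_add \<xi> v w) = vb_proj \<xi> v) \<and>
     (\<forall>c. \<forall>v\<in>topspace (vb_total \<xi>).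
        vb_scale \<xi> c v \<in> topspace (vb_total \<xi>) \<and> vb_proj \<xi> (vb_scale \<xi> c v) = vb_proj \<xi> v) \<and>
     (\<forall>b\<in>topspace (vb_base \<xi>). \<exists>U T.
        let EU = {v \<in> topspace (vb_total \<xi>). vb_proj \<xi> v \<in> U} in
        openin (vb_base \<xi>) U \<and> b \<in> U \<and>
        homeomorphic_map (subtopology (vb_total \<xi>) EU)
          (prod_topology (subtopology (vb_base \<xi>) U) (Euclidean_space n)) T \<and>
        (\<forall>v\<in>EU. fst (T v) = vb_proj \<xi> v) \<and>
        fibrewise_linear \<xi> EU (\<lambda>x y i. x i + y i) (\<lambda>c x i. c * x i) (\<lambda>v. snd (T v)))"

definition line_bundle_over :: "'b topology \<Rightarrow> ('e, 'b) vbundle \<Rightarrow> bool" where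
  "line_bundle_over B \<xi> \<longleftrightarrow> vector_bundle 1 \<xi> \<and> vb_base \<xi> = B"

text \<open>The base point of a family \<open>v\<close> is read off from its entry \<open>v 0\<close>, so that \<open>k\<close> has to be positive.\<close>

definition whitney_sum ::
  "'b topology \<Rightarrow> nat \<Rightarrow> (nat \<Rightarrow> ('e, 'b) vbundle) \<Rightarrow> (nat \<Rightarrow> 'e, 'b) vbundle" where
  "whitney_sum B k L =
     \<lparr> vb_total = subtopology (product_topology (\<lambda>i. vb_total (L i)) {..<k})
                    {v. \<forall>i<k. \<forall>j<k. vb_proj (L i) (v i) = vb_proj (L j) (v j)},
       vb_base = B,
       vb_proj = (\<lambda>v. vb_proj (L 0) (v 0)),
       vb_add = (\<lambda>v w. \<lambda>i\<in>{..<k}. vb_add (L i) (v i) (w i)),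
       vb_scale = (\<lambda>c v. \<lambda>i\<in>{..<k}. vb_scale (L i) c (v i)) \<rparr>"

definition nonzero_vectors :: "('e, 'b) vbundle \<Rightarrow> 'e set" where
  "nonzero_vectors \<xi> = {v \<in> topspace (vb_total \<xi>). v \<noteq> vb_scale \<xi> 0 v}"

definition line_through :: "('e, 'b) vbundle \<Rightarrow> 'e \<Rightarrow> 'e set" where
  "line_through \<xi> v = range (\<lambda>c. vb_scale \<xi> c v)"

definition projectivization :: "('e, 'b) vbundle \<Rightarrow> 'e set topology" where
  "projectivization \<xi> =
     quotient_top (subtopology (vb_total \<xi>) (nonzero_vectors \<xi>)) (line_through \<xi>)"


section \<open>The action on the projectivization of a sum of line bundles\<close>

definition lifts_action ::
  "(base_group \<Rightarrow> 'b \<Rightarrow> 'b) \<Rightarrow> ('e, 'b) vbundle \<Rightarrow> (base_group \<Rightarrow> 'e \<Rightarrow> 'e) \<Rightarrow> bool" where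
  "lifts_action a \<xi> A \<longleftrightarrow>
     group_action_on UNIV (vb_total \<xi>) A \<and>
     (\<forall>g. \<forall>v\<in>topspace (vb_total \<xi>). vb_proj \<xi> (A g v) = a g (vb_proj \<xi> v)) \<and>
     (\<forall>g. fibrewise_linear \<xi> (topspace (vb_total \<xi>)) (vb_add \<xi>) (vb_scale \<xi>) (A g))"

text \<open>
  The group \<open>(Z/2)\<^sup>2 \<times> (Z/2)\<^sup>k\<^sup>-\<^sup>1\<close>; the coordinates of the second factor are numbered from \<open>0\<close>
  to \<open>k - 2\<close>.
\<close>

definition bundle_group :: "nat \<Rightarrow> (base_group \<times> (nat \<Rightarrow> bit)) set" where
  "bundle_group k = {(g, s). \<forall>i\<ge>k - 1. s i = 0}"

text \<open>
  The first factor acts through the lifts, and the second one by signs on the first \<open>k - 1\<close>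
  summands.
\<close>

definition projective_action ::
  "nat \<Rightarrow> (nat \<Rightarrow> ('e, 'b) vbundle) \<Rightarrow> (nat \<Rightarrow> base_group \<Rightarrow> 'e \<Rightarrow> 'e)
     \<Rightarrow> base_group \<times> (nat \<Rightarrow> bit) \<Rightarrow> (nat \<Rightarrow> 'e) set \<Rightarrow> (nat \<Rightarrow> 'e) set" where
  "projective_action k L A = (\<lambda>(g, s) l.
     (\<lambda>v. \<lambda>i\<in>{..<k}. vb_scale (L i) (if s i = 1 then - 1 else 1) (A i g (v i))) ` l)"


section \<open>Projective characteristic functions\<close>

type_synonym pchar = "plane set \<Rightarrow> base_group \<times> (nat \<Rightarrow> bit)"

definition projective_characteristic :: "nat \<Rightarrow> plane set \<Rightarrow> pchar \<Rightarrow> bool" where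
  "projective_characteristic k P \<nu> \<longleftrightarrow>
     polygon P \<and> (\<forall>F\<in>facets P. \<nu> F \<in> bundle_group k) \<and>
     characteristic_function P (\<lambda>F. fst (\<nu> F))"

text \<open>
  The values on the facets \<open>y\<^sub>i = 0\<close> of the simplex: the basis vectors for \<open>i < k - 1\<close>, and the
  all-one vector for the last facet \<open>i = k - 1\<close>.
\<close>

definition simplex_value :: "nat \<Rightarrow> nat \<Rightarrow> nat \<Rightarrow> bit" where
  "simplex_value k i = (\<lambda>j. if i < k - 1 then of_bool (j = i) else of_bool (j < k - 1))"

definition bundle_characteristic ::
  "nat \<Rightarrow> plane set \<Rightarrow> pchar \<Rightarrow> ((plane \<times> (nat \<Rightarrow> real)) set \<times> base_group \<times> (nat \<Rightarrow> bit)) set" where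
  "bundle_characteristic k P \<nu> =
     {(F \<times> standard_simplex (k - 1), \<nu> F) | F. F \<in> facets P} \<union>
     {(P \<times> {y \<in> standard_simplex (k - 1). y i = 0}, (0, simplex_value k i)) | i. i < k}"

definition bundle_cover ::
  "nat \<Rightarrow> plane set \<Rightarrow> pchar
     \<Rightarrow> ((base_group \<times> (nat \<Rightarrow> bit)) \<times> plane \<times> (nat \<Rightarrow> real)) set topology" where
  "bundle_cover k P \<nu> =
     glued_space (bundle_group k) (bundle_characteristic k P \<nu>)
       (prod_topology (top_of_set P)
          (subtopology (powertop_real UNIV) (standard_simplex (k - 1))))"

text \<open>
  The sum \<open>\<xi>\<close> of the line bundles \<open>L\<^sub>i\<close>, \<open>i < k\<close>, over \<open>B\<close> corresponds to the pair \<open>(P, \<nu>)\<close>: there is a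
  weakly equivariant homeomorphism of \<open>P(\<xi>)\<close> onto the small cover of \<open>(P, \<nu>)\<close> which covers one
  of \<open>B\<close> onto \<open>M(P, p\<^sub>a \<circ> \<nu>)\<close>.  The image under \<open>((g, s), (x, y)) \<mapsto> (g, x)\<close> is the bundle
  projection of the former small cover onto the latter.
\<close>

definition encoded_by ::
  "nat \<Rightarrow> 'b topology \<Rightarrow> (base_group \<Rightarrow> 'b \<Rightarrow> 'b) \<Rightarrow> (nat \<Rightarrow> ('e, 'b) vbundle)
     \<Rightarrow> (nat \<Rightarrow> base_group \<Rightarrow> 'e \<Rightarrow> 'e) \<Rightarrow> plane set \<times> pchar \<Rightarrow> bool" where
  "encoded_by k B a L A = (\<lambda>(P, \<nu>).
     projective_characteristic k P \<nu> \<and>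
     (\<exists>\<phi> f \<psi> h.
        weak_equivariant_map (bundle_group k) \<phi>
          (projectivization (whitney_sum B k L)) (projective_action k L A)
          (bundle_cover k P \<nu>) glued_action f \<and>
        weak_equivariant_map UNIV \<psi> B a (surface_cover P (\<lambda>F. fst (\<nu> F))) glued_action h \<and>
        (\<forall>g\<in>bundle_group k. fst (\<phi> g) = \<psi> (fst g)) \<and>
        (\<forall>v\<in>nonzero_vectors (whitney_sum B k L).
           (\<lambda>((g, s), (x, y)). (g, x)) ` f (line_through (whitney_sum B k L) v) =
           h (vb_proj (whitney_sum B k L) v))))"

text \<open>
  The carrier \<open>'e\<close> of the line bundles is a parameter only because one cannot quantify over types.
\<close>

definition projective_bundle_pair ::
  "'e itself \<Rightarrow> nat \<Rightarrow> 'b topology \<Rightarrow> (base_group \<Rightarrow> 'b \<Rightarrow> 'b) \<Rightarrow> plane set \<times> pchar \<Rightarrow> bool" where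
  "projective_bundle_pair _ k B a X \<longleftrightarrow>
     (\<exists>(\<kappa> :: nat \<Rightarrow> ('e, 'b) vbundle) A.
        (\<forall>i<k. line_bundle_over B (\<kappa> i) \<and> lifts_action a (\<kappa> i) (A i)) \<and>
        encoded_by k B a \<kappa> A X)"

text \<open>
  A type large enough to carry, up to isomorphism, every equivariant line bundle over a space
  \<open>M(P, \<mu>)\<close>, as a quotient of \<open>(Z/2)\<^sup>2 \<times> P \<times> \<real>\<close>.
\<close>

type_synonym line_carrier = "(base_group \<times> plane \<times> real) set"


section \<open>Projective fibre sums\<close>

text \<open>
  The polygon \<open>R\<close> is the connected sum of \<open>P\<close> and \<open>P'\<close> at the vertices \<open>F1 \<inter> F2\<close> and
  \<open>F1' \<inter> F2'\<close>; its combinatorial type is prescribed by the adjacency of its edges.  The maps \<open>j\<close>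
  and \<open>j'\<close> send an edge of \<open>P\<close> or \<open>P'\<close> to the edge of \<open>R\<close> which it becomes, so they
  identify precisely \<open>F1\<close> with \<open>F1'\<close> and \<open>F2\<close> with \<open>F2'\<close>, and the vertices of \<open>R\<close> are those
  of \<open>P\<close> and \<open>P'\<close> except for the two that were cut off.
\<close>

definition fibre_sum ::
  "plane set \<times> pchar \<Rightarrow> plane set \<times> pchar \<Rightarrow> plane set \<times> pchar \<Rightarrow> bool" where
  "fibre_sum = (\<lambda>(P, \<nu>) (P', \<nu>') (R, \<rho>).
     polygon R \<and>
     (\<exists>F1\<in>facets P. \<exists>F2\<in>facets P. \<exists>F1'\<in>facets P'. \<exists>F2'\<in>facets P'. \<exists>j j'.
        F1 \<noteq> F2 \<and> F1 \<inter> F2 \<noteq> {} \<and> F1' \<noteq> F2' \<and> F1' \<inter> F2' \<noteq> {} \<and>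
        \<nu> F1 = \<nu>' F1' \<and> \<nu> F2 = \<nu>' F2' \<and>
        inj_on j (facets P) \<and> inj_on j' (facets P') \<and>
        j ` facets P \<union> j' ` facets P' = facets R \<and>
        j ` facets P \<inter> j' ` facets P' = {j F1, j F2} \<and>
        j F1 = j' F1' \<and> j F2 = j' F2' \<and>
        (\<forall>F\<in>facets P. \<rho> (j F) = \<nu> F) \<and> (\<forall>F\<in>facets P'. \<rho> (j' F) = \<nu>' F) \<and>
        (\<forall>H\<in>facets R. \<forall>H'\<in>facets R. H \<noteq> H' \<longrightarrow>
           (H \<inter> H' \<noteq> {} \<longleftrightarrow>
              (\<exists>F\<in>facets P. \<exists>G\<in>facets P.
                 H = j F \<and> H' = j G \<and> F \<inter> G \<noteq> {} \<and> {F, G} \<noteq> {F1, F2}) \<or>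
              (\<exists>F\<in>facets P'. \<exists>G\<in>facets P'.
                 H = j' F \<and> H' = j' G \<and> F \<inter> G \<noteq> {} \<and> {F, G} \<noteq> {F1', F2'})))))"

primrec fibre_sum_chain ::
  "(plane set \<times> pchar) list \<Rightarrow> plane set \<times> pchar \<Rightarrow> plane set \<times> pchar \<Rightarrow> bool" where
  "fibre_sum_chain [] X Z \<longleftrightarrow> X = Z"
| "fibre_sum_chain (Y # Ys) X Z \<longleftrightarrow> (\<exists>W. fibre_sum X Y W \<and> fibre_sum_chain Ys W Z)"

text \<open>
  \<open>iterated_fibre_sum [X\<^sub>1, \<dots>, X\<^sub>r] Z\<close>: the pair \<open>Z\<close> is obtained from \<open>X\<^sub>1\<close> by successively
  adding \<open>X\<^sub>2, \<dots>, X\<^sub>r\<close>; there is at least one summand.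
\<close>

definition iterated_fibre_sum ::
  "(plane set \<times> pchar) list \<Rightarrow> plane set \<times> pchar \<Rightarrow> bool" where
  "iterated_fibre_sum Xs Z \<longleftrightarrow> Xs \<noteq> [] \<and> fibre_sum_chain (tl Xs) (hd Xs) Z"

end

theory Submission
  imports Defs
begin

text \<open>
  A small cover \<open>M\<close> is glued from four copies \<open>{g} \<times> P\<close> of a polygon, where the copies \<open>g\<close> and
  \<open>g + \<mu> F\<close> are identified along the edge \<open>F\<close>.  A line bundle over \<open>M\<close>, pulled back to a copy of \<open>P\<close>,
  has a nowhere zero section since \<open>P\<close> is convex.  The sections can be normalized with respect to
  a fibre metric, so that the ones over neighbouring copies differ along \<open>F\<close> by a sign.  The main
  point about lifts is that after normalizing the sections at a vertex this sign depends only
  on \<open>F\<close> and not on the copies: going around a vertex, the four signs multiply to \<open>1\<close>, so the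
  signs along one edge are all equal if they are along its neighbour (\<open>frame_exists\<close>).  Permuting the
  sections of such a framing is a lift of the action to the bundle (\<open>lift_of_frame\<close>).  Conversely a
  given lift has an invariant framing (\<open>frame_of_lift\<close>).

  Let \<open>\<xi>\<close> be a sum of \<open>k\<close> line bundles with invariant framings \<open>s\<^sub>i\<close> and signs \<open>\<epsilon>\<^sub>i(F)\<close>.  The
  homogeneous coordinates of a line in the fibre with respect to the \<open>s\<^sub>i\<close> are \<open>\<plusminus>y\<^sub>i\<close> for a point \<open>y\<close>
  of the simplex \<open>\<Delta>\<close>.  This presents \<open>P(\<xi>)\<close> as a quotient of copies of \<open>P \<times> \<Delta>\<close>, and the
  identifications are those of the small cover of \<open>(P, \<nu>)\<close>, where \<open>\<nu>(F)\<close> consists of \<open>\<mu>(F)\<close> and of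
  the signs of \<open>F\<close> up to a common factor (\<open>encoded\<close>).  Every \<open>\<nu>\<close> arises like this: a line bundle with
  prescribed signs is glued from the products \<open>{g} \<times> P \<times> \<real>\<close>
  (\<open>projective_bundle_pair_model\<close>).

  What is left concerns the colouring of the edges of \<open>P\<close> by the three nonzero vectors of
  \<open>(Z/2)\<^sup>2\<close>, in which neighbours have different colours.  If all three colours occur and \<open>P\<close> is
  not a triangle, then some three consecutive edges have different colours and the colour of the
  middle one occurs again elsewhere (\<open>removable_letter\<close>).  Cutting off the triangle on these three
  edges leaves a polygon with fewer edges and still three colours, so \<open>(P, \<nu>)\<close> is a fibre sum of
  triangles (\<open>triangles\<close>).  If only two colours occur, then they alternate, and \<open>(P, \<nu>)\<close> is a fibre
  sum of squares with equal colours on opposite edges (\<open>squares\<close>).  Up to an automorphism of the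
  group the small covers over these pieces are \<open>RP\<^sup>2\<close> and \<open>T\<^sup>2\<close>, because triangles and
  convex quadrilaterals are homeomorphic to the standard ones by maps that preserve the edges
  (\<open>triangle_pair\<close>, \<open>square_pair\<close>).  In particular one kind of summand always suffices.
\<close>

section \<open>Maps out of quotients and products with a discrete factor\<close>

text \<open>
  Two quotients of one space with the same fibres are homeomorphic.  In this way spaces glued from
  copies of a polygon are recognized as base spaces and projectivizations.
\<close>

lemma quotient_homeomorphism:
  assumes f: "quotient_map X Y f" and g: "quotient_map X Z g"
    and eq: "\<And>x y. x \<in> topspace X \<Longrightarrow> y \<in> topspace X \<Longrightarrow> f x = f y \<longleftrightarrow> g x = g y"
  obtains h where "homeomorphic_map Y Z h" "\<And>x. x \<in> topspace X \<Longrightarrow> h (f x) = g x"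
proof -
  obtain h where h: "continuous_map Y Z h" "\<And>x. x \<in> topspace X \<Longrightarrow> h (f x) = g x"
    using quotient_map_lift_exists[OF f quotient_imp_continuous_map[OF g]] eq by metis
  obtain h' where h': "continuous_map Z Y h'" "\<And>x. x \<in> topspace X \<Longrightarrow> h' (g x) = f x"
    using quotient_map_lift_exists[OF g quotient_imp_continuous_map[OF f]] eq by metis
  have "homeomorphic_maps Y Z h h'"
    unfolding homeomorphic_maps_def
    using h h' quotient_imp_surjective_map[OF f] quotient_imp_surjective_map[OF g]
    by (metis (no_types, lifting) imageE)
  then show ?thesis using that h homeomorphic_maps_map by blast
qed

lemma continuous_map_locally:
  assumes "\<And>x. x \<in> topspace X \<Longrightarrow>
    \<exists>T. openin X T \<and> x \<in> T \<and> continuous_map (subtopology X T) Y f"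
  shows "continuous_map X Y f"
  by (rule pasting_lemma[where I = "{T. openin X T \<and> continuous_map (subtopology X T) Y f}"
        and T = id and f = "\<lambda>_. f"]) (use assms in auto)

lemma continuous_map_from_discrete_prod:
  "continuous_map (prod_topology (discrete_topology G) X) Y f \<longleftrightarrow>
     (\<forall>g\<in>G. continuous_map X Y (\<lambda>x. f (g, x)))"
proof
  assume f: "continuous_map (prod_topology (discrete_topology G) X) Y f"
  show "\<forall>g\<in>G. continuous_map X Y (\<lambda>x. f (g, x))"
  proof
    fix g assume "g \<in> G"
    then have "continuous_map X (prod_topology (discrete_topology G) X) (\<lambda>x. (g, x))"
      by (simp add: continuous_map_pairedI)
    from continuous_map_compose[OF this f] show "continuous_map X Y (\<lambda>x. f (g, x))"
      by (simp add: o_def)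
  qed
next
  assume f: "\<forall>g\<in>G. continuous_map X Y (\<lambda>x. f (g, x))"
  show "continuous_map (prod_topology (discrete_topology G) X) Y f"
  proof (rule continuous_map_locally)
    fix z assume "z \<in> topspace (prod_topology (discrete_topology G) X)"
    then have z: "fst z \<in> G" "snd z \<in> topspace X" by auto
    let ?T = "{fst z} \<times> topspace X"
    have "openin (prod_topology (discrete_topology G) X) ?T"
      using z by (simp add: openin_prod_Times_iff)
    moreover have "continuous_map (subtopology (prod_topology (discrete_topology G) X) ?T) Y
        ((\<lambda>x. f (fst z, x)) \<circ> snd)"
      using f z by (intro continuous_map_compose[OF _ f[rule_format]])
        (auto intro!: continuous_map_from_subtopology[OF continuous_map_snd])
    then have "continuous_map (subtopology (prod_topology (discrete_topology G) X) ?T) Y f"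
      by (rule continuous_map_eq) auto
    ultimately show "\<exists>T. openin (prod_topology (discrete_topology G) X) T \<and> z \<in> T \<and>
        continuous_map (subtopology (prod_topology (discrete_topology G) X) T) Y f"
      using z by (metis SigmaI insertI1 prod.collapse)
  qed
qed

section \<open>Line bundles\<close>

text \<open>
  A local trivialization of a line bundle amounts to a coordinate function \<open>c\<close> together with the
  map \<open>w\<close> sending a point and a number to the vector that has this coordinate.
\<close>

definition chart :: "('e, 'b) vbundle \<Rightarrow> 'b set \<Rightarrow> ('e \<Rightarrow> real) \<Rightarrow> ('b \<times> real \<Rightarrow> 'e) \<Rightarrow> bool" where
  "chart \<xi> U c w \<longleftrightarrow>
     openin (vb_base \<xi>) U \<and>
     continuous_map (subtopology (vb_total \<xi>) {v \<in> topspace (vb_total \<xi>). vb_proj \<xi> v \<in> U})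
       euclideanreal c \<and>
     continuous_map (prod_topology (subtopology (vb_base \<xi>) U) euclideanreal) (vb_total \<xi>) w \<and>
     (\<forall>b\<in>U. \<forall>r. vb_proj \<xi> (w (b, r)) = b \<and> c (w (b, r)) = r) \<and>
     (\<forall>v\<in>topspace (vb_total \<xi>). vb_proj \<xi> v \<in> U \<longrightarrow>
        w (vb_proj \<xi> v, c v) = v \<and> (\<forall>t. c (vb_scale \<xi> t v) = t * c v)) \<and>
     (\<forall>v\<in>topspace (vb_total \<xi>). \<forall>v'\<in>topspace (vb_total \<xi>).
        vb_proj \<xi> v \<in> U \<longrightarrow> vb_proj \<xi> v' = vb_proj \<xi> v \<longrightarrow>
        c (vb_add \<xi> v v') = c v + c v')"

definition ratio :: "('e, 'b) vbundle \<Rightarrow> 'e \<Rightarrow> 'e \<Rightarrow> real" where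
  "ratio \<xi> v w = (THE t. v = vb_scale \<xi> t w)"

lemma homeomorphic_map_real_Euclidean_space_1:
  "homeomorphic_map euclideanreal (Euclidean_space 1) (\<lambda>r i. if i < 1 then r else 0)"
proof -
  have 1: "continuous_map euclideanreal (Euclidean_space 1) (\<lambda>r i. if i < 1 then r else 0)"
    by (subst continuous_map_componentwise_Euclidean_space[of _ 1 "\<lambda>r i. r"]) auto
  have 2: "continuous_map (Euclidean_space 1) euclideanreal (\<lambda>f. f 0)"
    unfolding Euclidean_space_def
    by (intro continuous_map_from_subtopology continuous_map_product_projection) auto
  have "homeomorphic_maps euclideanreal (Euclidean_space 1) (\<lambda>r i. if i < 1 then r else 0) (\<lambda>f. f 0)"
    unfolding homeomorphic_maps_def using 1 2 by (auto simp: topspace_Euclidean_space fun_eq_iff)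
  then show ?thesis using homeomorphic_maps_map by blast
qed

locale line_bundle =
  fixes \<xi> :: "('e, 'b) vbundle"
  assumes vector_bundle: "vector_bundle 1 \<xi>"
begin

abbreviation "E \<equiv> vb_total \<xi>"
abbreviation "\<pi> \<equiv> vb_proj \<xi>"
abbreviation "scl \<equiv> vb_scale \<xi>"

lemma continuous_proj: "continuous_map E (vb_base \<xi>) \<pi>"
  using vector_bundle unfolding vector_bundle_def by blast

lemma proj_in: "v \<in> topspace E \<Longrightarrow> \<pi> v \<in> topspace (vb_base \<xi>)"
  using continuous_map_image_subset_topspace[OF continuous_proj] by auto

lemma scale_in [simp]: "v \<in> topspace E \<Longrightarrow> scl t v \<in> topspace E"
  and proj_scale [simp]: "v \<in> topspace E \<Longrightarrow> \<pi> (scl t v) = \<pi> v"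
  using vector_bundle unfolding vector_bundle_def by blast+

lemma add_in: "v \<in> topspace E \<Longrightarrow> w \<in> topspace E \<Longrightarrow> \<pi> v = \<pi> w \<Longrightarrow> vb_add \<xi> v w \<in> topspace E"
  and proj_add: "v \<in> topspace E \<Longrightarrow> w \<in> topspace E \<Longrightarrow> \<pi> v = \<pi> w \<Longrightarrow> \<pi> (vb_add \<xi> v w) = \<pi> v"
  using vector_bundle unfolding vector_bundle_def by blast+

lemma chart_exists:
  assumes "b \<in> topspace (vb_base \<xi>)"
  obtains U c w where "b \<in> U" "chart \<xi> U c w"
proof -
  obtain U T where *: "let EU = {v \<in> topspace E. \<pi> v \<in> U} in
        openin (vb_base \<xi>) U \<and> b \<in> U \<and>
        homeomorphic_map (subtopology E EU)
          (prod_topology (subtopology (vb_base \<xi>) U) (Euclidean_space 1)) T \<and>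
        (\<forall>v\<in>EU. fst (T v) = \<pi> v) \<and>
        fibrewise_linear \<xi> EU (\<lambda>x y i. x i + y i) (\<lambda>c x i. c * x i) (\<lambda>v. snd (T v))"
    using vector_bundle assms unfolding vector_bundle_def by blast
  define EU where "EU = {v \<in> topspace E. \<pi> v \<in> U}"
  let ?P = "prod_topology (subtopology (vb_base \<xi>) U) (Euclidean_space 1)"
  have op: "openin (vb_base \<xi>) U" and bU: "b \<in> U"
    and T: "homeomorphic_map (subtopology E EU) ?P T"
    and fst: "\<And>v. v \<in> EU \<Longrightarrow> fst (T v) = \<pi> v"
    and lin: "fibrewise_linear \<xi> EU (\<lambda>x y i. x i + y i) (\<lambda>c x i. c * x i) (\<lambda>v. snd (T v))"
    using * unfolding Let_def EU_def by blast+
  obtain T' where T': "homeomorphic_maps (subtopology E EU) ?P T T'"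
    using T homeomorphic_map_maps by blast
  have top: "topspace (subtopology E EU) = EU" by (auto simp: EU_def)
  have Us: "U \<subseteq> topspace (vb_base \<xi>)" using op openin_subset by blast
  have cT: "continuous_map (subtopology E EU) ?P T" and cT': "continuous_map ?P (subtopology E EU) T'"
    and T'T: "\<And>v. v \<in> EU \<Longrightarrow> T' (T v) = v"
    and TT': "\<And>z. z \<in> topspace ?P \<Longrightarrow> T (T' z) = z"
    using T' top unfolding homeomorphic_maps_def by auto
  define c where "c = (\<lambda>v. snd (T v) 0)"
  define e :: "real \<Rightarrow> nat \<Rightarrow> real" where "e = (\<lambda>r i. if i < 1 then r else 0)"
  define w where "w = (\<lambda>(b, r). T' (b, e r))"
  have ein: "e r \<in> topspace (Euclidean_space 1)" for r
    by (auto simp: topspace_Euclidean_space e_def)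
  have Tin: "T v \<in> topspace ?P" if "v \<in> EU" for v
    using continuous_map_image_subset_topspace[OF cT] that top by auto
  have esnd: "e (c v) = snd (T v)" if "v \<in> EU" for v
    using Tin[OF that] by (auto simp: topspace_Euclidean_space e_def c_def fun_eq_iff)
  have proj0: "continuous_map (Euclidean_space 1) euclideanreal (\<lambda>f. f 0)"
    unfolding Euclidean_space_def
    by (intro continuous_map_from_subtopology continuous_map_product_projection) auto
  have 1: "continuous_map (subtopology E EU) euclideanreal c"
    unfolding c_def using continuous_map_compose[OF continuous_map_compose[OF cT continuous_map_snd] proj0]
    by (simp add: o_def)
  have "continuous_map (prod_topology (subtopology (vb_base \<xi>) U) euclideanreal) ?P (\<lambda>z. (fst z, e (snd z)))"
    using homeomorphic_imp_continuous_map[OF homeomorphic_map_real_Euclidean_space_1]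
    by (intro continuous_map_pairedI continuous_map_fst
        continuous_map_compose[of _ euclideanreal snd _ e, unfolded o_def] continuous_map_snd)
      (auto simp: e_def)
  from continuous_map_compose[OF this cT']
  have 2: "continuous_map (prod_topology (subtopology (vb_base \<xi>) U) euclideanreal) E w"
    unfolding w_def by (auto simp: o_def split_def continuous_map_in_subtopology)
  have win: "w (b, r) \<in> EU" and Tw: "T (w (b, r)) = (b, e r)" if "b \<in> U" for b r
    using continuous_map_image_subset_topspace[OF cT'] ein TT'[of "(b, e r)"] that Us top
    unfolding w_def by (auto simp: image_subset_iff)
  have 3: "\<pi> (w (b, r)) = b \<and> c (w (b, r)) = r" if "b \<in> U" for b r
    using fst[OF win[OF that]] Tw[OF that] by (auto simp: c_def e_def)
  have 4: "w (\<pi> v, c v) = v" if "v \<in> EU" for v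
    unfolding w_def split using fst[OF that] esnd[OF that] T'T[OF that] by (metis prod.collapse)
  have "chart \<xi> U c w"
    unfolding chart_def EU_def[symmetric]
    using op 1 2 3 4 lin unfolding fibrewise_linear_def by (auto simp: EU_def c_def)
  then show ?thesis using that bU by blast
qed

lemma chart_nonzero:
  assumes "chart \<xi> U c w" "v \<in> topspace E" "\<pi> v \<in> U"
  shows "v \<in> nonzero_vectors \<xi> \<longleftrightarrow> c v \<noteq> 0"
  using assms unfolding chart_def nonzero_vectors_def
  by (metis (mono_tags, lifting) mem_Collect_eq mult_zero_left proj_scale scale_in)

lemma chart_eqI:
  assumes "chart \<xi> U c w" "v \<in> topspace E" "v' \<in> topspace E" "\<pi> v \<in> U" "\<pi> v = \<pi> v'" "c v = c v'"
  shows "v = v'"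
  using assms unfolding chart_def by metis

lemma chart_scale:
  assumes "chart \<xi> U c w" "v \<in> topspace E" "\<pi> v \<in> U"
  shows "c (scl t v) = t * c v"
  using assms unfolding chart_def by blast

lemma scale_scale: "v \<in> topspace E \<Longrightarrow> scl s (scl t v) = scl (s * t) v"
proof -
  assume v: "v \<in> topspace E"
  obtain U c w where "\<pi> v \<in> U" "chart \<xi> U c w" using chart_exists[OF proj_in[OF v]] .
  then show ?thesis using v by (intro chart_eqI[of U c w]) (simp_all add: chart_scale)
qed

lemma scale_one: "v \<in> topspace E \<Longrightarrow> scl 1 v = v"
proof -
  assume v: "v \<in> topspace E"
  obtain U c w where "\<pi> v \<in> U" "chart \<xi> U c w" using chart_exists[OF proj_in[OF v]] .
  then show ?thesis using v by (intro chart_eqI[of U c w]) (simp_all add: chart_scale)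
qed

lemma add_scale: "v \<in> topspace E \<Longrightarrow> vb_add \<xi> (scl s v) (scl t v) = scl (s + t) v"
proof -
  assume v: "v \<in> topspace E"
  obtain U c w where U: "\<pi> v \<in> U" "chart \<xi> U c w" using chart_exists[OF proj_in[OF v]] .
  then have "c (vb_add \<xi> (scl s v) (scl t v)) = c (scl s v) + c (scl t v)"
    using v unfolding chart_def by simp
  then show ?thesis using v U
    by (intro chart_eqI[of U c w]) (simp_all add: chart_scale add_in proj_add algebra_simps)
qed

lemma nonzero_in: "v \<in> nonzero_vectors \<xi> \<Longrightarrow> v \<in> topspace E"
  by (simp add: nonzero_vectors_def)

lemma scale_cancel:
  assumes v: "v \<in> nonzero_vectors \<xi>"
  shows "scl s v = scl t v \<longleftrightarrow> s = t"
proof -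
  have "v \<in> topspace E" using v nonzero_in by blast
  moreover obtain U c w where "\<pi> v \<in> U" "chart \<xi> U c w" using chart_exists[OF proj_in[OF calculation]] .
  ultimately show ?thesis using chart_scale chart_nonzero v by (metis mult_right_cancel)
qed

lemma nonzero_scale:
  assumes v: "v \<in> nonzero_vectors \<xi>"
  shows "scl t v \<in> nonzero_vectors \<xi> \<longleftrightarrow> t \<noteq> 0"
proof -
  have *: "v \<in> topspace E" using v nonzero_in by blast
  moreover obtain U c w where "\<pi> v \<in> U" "chart \<xi> U c w" using chart_exists[OF proj_in[OF calculation]] .
  ultimately show ?thesis using chart_scale chart_nonzero v
    by (metis mult_eq_0_iff proj_scale scale_in)
qed

lemma ex_scale:
  assumes v: "v \<in> topspace E" and w: "w \<in> nonzero_vectors \<xi>" and "\<pi> v = \<pi> w"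
  shows "\<exists>t. v = scl t w"
proof -
  have w': "w \<in> topspace E" using w nonzero_in by blast
  obtain U c x where U: "\<pi> v \<in> U" "chart \<xi> U c x" using chart_exists[OF proj_in[OF v]] .
  then have "c w \<noteq> 0" using chart_nonzero assms w' by metis
  then have "v = scl (c v / c w) w"
    using U v w' assms(3) by (intro chart_eqI[of U c x]) (simp_all add: chart_scale)
  then show ?thesis by blast
qed

lemma ratio_scale [simp]: "w \<in> nonzero_vectors \<xi> \<Longrightarrow> ratio \<xi> (scl t w) w = t"
  unfolding ratio_def using scale_cancel by (intro the_equality) auto

lemma scale_ratio:
  assumes "v \<in> topspace E" "w \<in> nonzero_vectors \<xi>" "\<pi> v = \<pi> w"
  shows "scl (ratio \<xi> v w) w = v"
  using ex_scale[OF assms] ratio_scale assms by metis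

lemma chart_ratio:
  assumes "chart \<xi> U c x" "v \<in> topspace E" "w \<in> nonzero_vectors \<xi>" "\<pi> v = \<pi> w" "\<pi> v \<in> U"
  shows "ratio \<xi> v w = c v / c w"
  using assms scale_ratio[OF assms(2,3,4)] chart_scale chart_nonzero nonzero_in
  by (metis nonzero_mult_div_cancel_right)

lemma ratio_nonzero:
  assumes "v \<in> nonzero_vectors \<xi>" "w \<in> nonzero_vectors \<xi>" "\<pi> v = \<pi> w"
  shows "ratio \<xi> v w \<noteq> 0"
  using assms scale_ratio nonzero_scale nonzero_in by metis

text \<open>Both continuity statements are local, and in a chart they concern a product or a quotient of coordinates.\<close>

lemma chart_continuous:
  assumes "chart \<xi> U c x" and s: "continuous_map X E s" and "s ` topspace X \<subseteq> {v. \<pi> v \<in> U}"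
  shows "continuous_map X euclideanreal (\<lambda>z. c (s z))"
proof -
  have "continuous_map X (subtopology E {v \<in> topspace E. \<pi> v \<in> U}) s"
    using s assms(3) continuous_map_image_subset_topspace[OF s] by (auto simp: continuous_map_in_subtopology)
  then show ?thesis
    using assms(1) continuous_map_compose unfolding chart_def o_def by blast
qed

lemma open_preimage_chart:
  assumes "chart \<xi> U c w" and s: "continuous_map X E s"
  shows "openin X {z \<in> topspace X. \<pi> (s z) \<in> U}"
  using assms openin_continuous_map_preimage[OF continuous_map_compose[OF s continuous_proj]]
  unfolding chart_def by (auto simp: o_def)

lemma continuous_ratio:
  assumes s: "continuous_map X E s" and t: "continuous_map X E t"
    and eq: "\<And>z. z \<in> topspace X \<Longrightarrow> \<pi> (s z) = \<pi> (t z)"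
    and nz: "\<And>z. z \<in> topspace X \<Longrightarrow> t z \<in> nonzero_vectors \<xi>"
  shows "continuous_map X euclideanreal (\<lambda>z. ratio \<xi> (s z) (t z))"
proof (rule continuous_map_locally)
  fix z assume z: "z \<in> topspace X"
  have sin: "s z \<in> topspace E" if "z \<in> topspace X" for z
    using continuous_map_image_subset_topspace[OF s] that by auto
  obtain U c w where U: "\<pi> (s z) \<in> U" "chart \<xi> U c w"
    using chart_exists[OF proj_in[OF sin[OF z]]] .
  let ?T = "{z \<in> topspace X. \<pi> (s z) \<in> U}"
  have "continuous_map (subtopology X ?T) euclideanreal (\<lambda>z. c (s z) / c (t z))"
  proof (intro continuous_map_real_divide chart_continuous[OF U(2)] continuous_map_from_subtopology s t)
    fix z assume "z \<in> topspace (subtopology X ?T)"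
    then show "c (t z) \<noteq> 0"
      using chart_nonzero[OF U(2) nonzero_in[OF nz]] nz eq by auto
  qed (use eq in auto)
  then have "continuous_map (subtopology X ?T) euclideanreal (\<lambda>z. ratio \<xi> (s z) (t z))"
    by (rule continuous_map_eq) (use chart_ratio[OF U(2) sin nz eq] in auto)
  then show "\<exists>T. openin X T \<and> z \<in> T \<and> continuous_map (subtopology X T) euclideanreal (\<lambda>z. ratio \<xi> (s z) (t z))"
    using open_preimage_chart[OF U(2) s] z U(1) by blast
qed

lemma continuous_scale:
  assumes s: "continuous_map X E s" and r: "continuous_map X euclideanreal r"
  shows "continuous_map X E (\<lambda>z. scl (r z) (s z))"
proof (rule continuous_map_locally)
  fix z assume z: "z \<in> topspace X"
  have sin: "s z \<in> topspace E" if "z \<in> topspace X" for z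
    using continuous_map_image_subset_topspace[OF s] that by auto
  obtain U c w where U: "\<pi> (s z) \<in> U" "chart \<xi> U c w"
    using chart_exists[OF proj_in[OF sin[OF z]]] .
  let ?T = "{z \<in> topspace X. \<pi> (s z) \<in> U}"
  have "continuous_map (subtopology X ?T) (prod_topology (subtopology (vb_base \<xi>) U) euclideanreal)
      (\<lambda>z. (\<pi> (s z), r z * c (s z)))"
    using continuous_map_compose[OF s continuous_proj]
    by (intro continuous_map_pairedI continuous_map_real_mult chart_continuous[OF U(2)])
      (auto simp: continuous_map_in_subtopology o_def intro!: continuous_map_from_subtopology s r)
  moreover have "continuous_map (prod_topology (subtopology (vb_base \<xi>) U) euclideanreal) E w"
    using U(2) unfolding chart_def by blast
  ultimately have "continuous_map (subtopology X ?T) E (\<lambda>z. w (\<pi> (s z), r z * c (s z)))"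
    using continuous_map_compose unfolding o_def by blast
  then have "continuous_map (subtopology X ?T) E (\<lambda>z. scl (r z) (s z))"
  proof (rule continuous_map_eq)
    fix z assume "z \<in> topspace (subtopology X ?T)"
    then have z: "s z \<in> topspace E" "\<pi> (s z) \<in> U" using sin by auto
    then show "w (\<pi> (s z), r z * c (s z)) = scl (r z) (s z)"
      using U(2) scale_in[OF z(1), of "r z"] proj_scale[OF z(1), of "r z"] unfolding chart_def by metis
  qed
  then show "\<exists>T. openin X T \<and> z \<in> T \<and> continuous_map (subtopology X T) E (\<lambda>z. scl (r z) (s z))"
    using open_preimage_chart[OF U(2) s] z U(1) by blast
qed

end

section \<open>Sections along maps from convex sets\<close>

context line_bundle
begin

definition section_over :: "('z::topological_space \<Rightarrow> 'b) \<Rightarrow> 'z set \<Rightarrow> ('z \<Rightarrow> 'e) \<Rightarrow> bool" where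
  "section_over \<sigma> S s \<longleftrightarrow> continuous_map (top_of_set S) E s \<and>
     (\<forall>z\<in>S. s z \<in> nonzero_vectors \<xi> \<and> \<pi> (s z) = \<sigma> z)"

lemma section_over_subset: "section_over \<sigma> S s \<Longrightarrow> T \<subseteq> S \<Longrightarrow> section_over \<sigma> T s"
  unfolding section_over_def by (auto elim: continuous_map_from_subtopology_mono)

text \<open>
  On the overlap the two sections differ by a nowhere zero function, which the retraction \<open>r\<close>
  extends to all of \<open>T\<close>.
\<close>

lemma section_over_Un:
  assumes s: "section_over \<sigma> S s" and t: "section_over \<sigma> T t"
    and cl: "closed S" "closed T"
    and r: "continuous_on T r" "r ` T \<subseteq> S \<inter> T" "\<And>z. z \<in> S \<inter> T \<Longrightarrow> r z = z"
  shows "\<exists>u. section_over \<sigma> (S \<union> T) u"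
proof -
  define \<rho> where "\<rho> z = ratio \<xi> (s (r z)) (t (r z))" for z
  define u where "u z = (if z \<in> S then s z else scl (\<rho> z) (t z))" for z
  have cr: "continuous_map (top_of_set T) (top_of_set (S \<inter> T)) r"
    using r by (simp add: image_subset_iff)
  have cs: "continuous_map (top_of_set S) E s" and ct: "continuous_map (top_of_set T) E t"
    and sn: "\<And>z. z \<in> S \<Longrightarrow> s z \<in> nonzero_vectors \<xi>" "\<And>z. z \<in> S \<Longrightarrow> \<pi> (s z) = \<sigma> z"
    and tn: "\<And>z. z \<in> T \<Longrightarrow> t z \<in> nonzero_vectors \<xi>" "\<And>z. z \<in> T \<Longrightarrow> \<pi> (t z) = \<sigma> z"
    using s t unfolding section_over_def by auto
  have rT: "r z \<in> S" "r z \<in> T" if "z \<in> T" for z using r that by auto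
  have c\<rho>: "continuous_map (top_of_set T) euclideanreal \<rho>"
    unfolding \<rho>_def
    using continuous_map_compose[OF cr continuous_map_from_subtopology_mono[OF cs, of "S \<inter> T"]]
      continuous_map_compose[OF cr continuous_map_from_subtopology_mono[OF ct, of "S \<inter> T"]]
    by (intro continuous_ratio) (auto simp: o_def sn tn rT)
  have \<rho>0: "\<rho> z \<noteq> 0" if "z \<in> T" for z
    unfolding \<rho>_def using rT[OF that] sn tn by (intro ratio_nonzero) auto
  have ct': "continuous_map (top_of_set T) E (\<lambda>z. scl (\<rho> z) (t z))"
    by (rule continuous_scale[OF ct c\<rho>])
  have eq: "s z = scl (\<rho> z) (t z)" if "z \<in> S" "z \<in> T" for z
    using that r(3)[of z] sn tn by (simp add: \<rho>_def scale_ratio nonzero_in)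
  have "continuous_map (top_of_set (S \<union> T)) E u"
  proof (rule pasting_lemma_closed[where I = UNIV and T = "\<lambda>i. if i then S else T"
        and f = "\<lambda>i. if i then s else (\<lambda>z. scl (\<rho> z) (t z))"])
    show "closedin (top_of_set (S \<union> T)) (if i then S else T)" for i
      using cl by (simp add: closed_subset)
    show "continuous_map (subtopology (top_of_set (S \<union> T)) (if i then S else T)) E
         (if i then s else (\<lambda>z. scl (\<rho> z) (t z)))" for i
      using cs ct' by (simp add: subtopology_subtopology Int_absorb1)
  qed (auto simp: u_def eq split: if_splits)
  moreover have "u z \<in> nonzero_vectors \<xi> \<and> \<pi> (u z) = \<sigma> z" if "z \<in> S \<union> T" for z
    using that sn tn \<rho>0 by (auto simp: u_def nonzero_scale nonzero_in)
  ultimately show ?thesis unfolding section_over_def by blast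
qed

lemma section_over_near:
  assumes \<sigma>: "continuous_map euclidean (vb_base \<xi>) \<sigma>"
  obtains V s where "open V" "z \<in> V" "section_over \<sigma> V s"
proof -
  have \<sigma>in: "\<sigma> z \<in> topspace (vb_base \<xi>)" for z
    using continuous_map_image_subset_topspace[OF \<sigma>] by auto
  obtain U c w where U: "\<sigma> z \<in> U" "chart \<xi> U c w" using chart_exists[OF \<sigma>in] .
  define V where "V = {z. \<sigma> z \<in> U}"
  have "open V"
    using openin_continuous_map_preimage[OF \<sigma>, of U] U(2) unfolding chart_def V_def by simp
  have "continuous_map (top_of_set V) (subtopology (vb_base \<xi>) U) \<sigma>"
    using continuous_map_from_subtopology[OF \<sigma>] by (auto simp: continuous_map_in_subtopology V_def)
  then have "continuous_map (top_of_set V) (prod_topology (subtopology (vb_base \<xi>) U) euclideanreal)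
      (\<lambda>z. (\<sigma> z, 1))"
    by (intro continuous_map_pairedI) auto
  moreover have cw: "continuous_map (prod_topology (subtopology (vb_base \<xi>) U) euclideanreal) E w"
    using U(2) unfolding chart_def by blast
  ultimately have cs: "continuous_map (top_of_set V) E (\<lambda>z. w (\<sigma> z, 1))"
    using continuous_map_compose unfolding o_def by blast
  have "w (\<sigma> z, 1) \<in> nonzero_vectors \<xi> \<and> \<pi> (w (\<sigma> z, 1)) = \<sigma> z" if "z \<in> V" for z
  proof -
    have "w (\<sigma> z, 1) \<in> topspace E"
      using continuous_map_image_subset_topspace[OF cs] that by auto
    moreover have "\<pi> (w (\<sigma> z, 1)) = \<sigma> z" "c (w (\<sigma> z, 1)) = 1"
      using U(2) that unfolding chart_def V_def by auto
    ultimately show ?thesis using chart_nonzero[OF U(2)] that by (auto simp: V_def)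
  qed
  then have "section_over \<sigma> V (\<lambda>z. w (\<sigma> z, 1))" using cs unfolding section_over_def by blast
  then show ?thesis using that[of V] \<open>open V\<close> U(1) by (auto simp: V_def)
qed

text \<open>
  Sections exist locally, hence over narrow vertical strips and then over the whole box: two
  adjacent boxes meet in a side, onto which each of them retracts.
\<close>

lemma section_over_box:
  fixes \<sigma> :: "real \<times> real \<Rightarrow> 'b"
  assumes \<sigma>: "continuous_map euclidean (vb_base \<xi>) \<sigma>" and "a \<le> b" "c \<le> d"
  shows "\<exists>s. section_over \<sigma> ({a..b} \<times> {c..d}) s"
proof -
  have strip: "\<exists>\<delta>>0. \<exists>s. section_over \<sigma> ({x-\<delta>..x+\<delta>} \<times> {c..d}) s" for x
    using \<open>c \<le> d\<close>
  proof (induction rule: Bolzano)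
    case (trans c m d)
    then obtain \<delta> \<delta>' s t where \<delta>: "\<delta> > 0" "\<delta>' > 0"
      and s: "section_over \<sigma> ({x-\<delta>..x+\<delta>} \<times> {c..m}) s"
      and t: "section_over \<sigma> ({x-\<delta>'..x+\<delta>'} \<times> {m..d}) t" by blast
    let ?I = "{x - min \<delta> \<delta>'..x + min \<delta> \<delta>'}"
    have "\<exists>u. section_over \<sigma> (?I \<times> {c..m} \<union> ?I \<times> {m..d}) u"
    proof (rule section_over_Un[OF section_over_subset[OF s] section_over_subset[OF t],
          where r = "\<lambda>z. (fst z, m)"])
      show "continuous_on (?I \<times> {m..d}) (\<lambda>z. (fst z, m))" by (intro continuous_intros)
    qed (use trans in \<open>auto intro!: closed_Times\<close>)
    moreover have "?I \<times> {c..m} \<union> ?I \<times> {m..d} = ?I \<times> {c..d}" using trans by auto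
    ultimately show ?case using \<delta> by (metis min_less_iff_conj)
  next
    case (local y)
    obtain V s where V: "open V" "(x, y) \<in> V" "section_over \<sigma> V s"
      using section_over_near[OF \<sigma>] .
    obtain A B where "open A" "open B" "(x, y) \<in> A \<times> B" "A \<times> B \<subseteq> V"
      by (rule open_prod_elim[OF V(1,2)])
    then have AB: "open A" "open B" "x \<in> A" "y \<in> B" "A \<times> B \<subseteq> V" by auto
    obtain e where e: "e > 0" "cball x e \<subseteq> A" using AB open_contains_cball by blast
    obtain e' where e': "e' > 0" "cball y e' \<subseteq> B" using AB open_contains_cball by blast
    show ?case
    proof (rule exI[of _ e'], intro conjI e' allI impI)
      fix a b assume ab: "a \<le> y \<and> y \<le> b \<and> b - a < e'"
      have "{x - e..x + e} \<subseteq> A" using e by (simp add: cball_eq_atLeastAtMost)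
      moreover have "{a..b} \<subseteq> B" using e' ab by (force simp: cball_eq_atLeastAtMost)
      ultimately have "{x - e..x + e} \<times> {a..b} \<subseteq> V" using AB by blast
      then show "\<exists>\<delta>>0. \<exists>s. section_over \<sigma> ({x - \<delta>..x + \<delta>} \<times> {a..b}) s"
        using e section_over_subset[OF V(3)] by blast
    qed
  qed
  show ?thesis
    using \<open>a \<le> b\<close>
  proof (induction rule: Bolzano)
    case (trans a m b)
    then obtain s t where s: "section_over \<sigma> ({a..m} \<times> {c..d}) s"
      and t: "section_over \<sigma> ({m..b} \<times> {c..d}) t" by blast
    have "\<exists>u. section_over \<sigma> ({a..m} \<times> {c..d} \<union> {m..b} \<times> {c..d}) u"
    proof (rule section_over_Un[OF s t, where r = "\<lambda>z. (m, snd z)"])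
      show "continuous_on ({m..b} \<times> {c..d}) (\<lambda>z. (m, snd z))" by (intro continuous_intros)
    qed (use trans in \<open>auto intro!: closed_Times\<close>)
    moreover have "{a..m} \<times> {c..d} \<union> {m..b} \<times> {c..d} = {a..b} \<times> {c..d}" using trans by auto
    ultimately show ?case by simp
  next
    case (local x)
    obtain \<delta> s where \<delta>: "\<delta> > 0" and s: "section_over \<sigma> ({x-\<delta>..x+\<delta>} \<times> {c..d}) s"
      using strip by blast
    show ?case
    proof (intro exI[of _ \<delta>] conjI \<delta> allI impI)
      fix a b assume ab: "a \<le> x \<and> x \<le> b \<and> b - a < \<delta>"
      have "{a..b} \<times> {c..d} \<subseteq> {x-\<delta>..x+\<delta>} \<times> {c..d}" using ab by auto
      then show "\<exists>s. section_over \<sigma> ({a..b} \<times> {c..d}) s" using section_over_subset[OF s] by blast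
    qed
  qed
qed

lemma section_over_convex:
  fixes \<sigma> :: "plane \<Rightarrow> 'b"
  assumes P: "convex P" "compact P" and \<sigma>: "continuous_map (top_of_set P) (vb_base \<xi>) \<sigma>"
  shows "\<exists>s. section_over \<sigma> P s"
proof (cases "P = {}")
  case True
  then show ?thesis unfolding section_over_def by (auto simp: continuous_map_def)
next
  case False
  define j :: "real \<times> real \<Rightarrow> plane" where "j z = fst z *\<^sub>R axis 1 1 + snd z *\<^sub>R axis 2 1" for z
  have j: "j (x $ 1, x $ 2) = x" for x
    by (simp add: j_def vec_eq_iff forall_2 axis_def)
  have cj: "continuous_on UNIV j" unfolding j_def by (intro continuous_intros)
  have cp: "continuous_on UNIV (closest_point P)"
    by (rule continuous_on_closest_point[OF P(1) compact_imp_closed[OF P(2)] False])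
  have "continuous_on UNIV (\<lambda>z. closest_point P (j z))"
    by (rule continuous_on_compose2[OF cp cj]) auto
  then have "continuous_map euclidean (top_of_set P) (\<lambda>z. closest_point P (j z))"
    using closest_point_in_set[OF compact_imp_closed[OF P(2)] False] by (auto simp: continuous_map_in_subtopology)
  then have c: "continuous_map euclidean (vb_base \<xi>) (\<lambda>z. \<sigma> (closest_point P (j z)))"
    using continuous_map_compose[OF _ \<sigma>] unfolding o_def by blast
  obtain K where K: "K > 0" "\<And>x. x \<in> P \<Longrightarrow> norm x \<le> K"
    using compact_imp_bounded[OF P(2)] bounded_pos by blast
  obtain s where s: "section_over (\<lambda>z. \<sigma> (closest_point P (j z))) ({-K..K} \<times> {-K..K}) s"
    using section_over_box[OF c, of "-K" K "-K" K] K by auto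
  have box: "(x $ 1, x $ 2) \<in> {-K..K} \<times> {-K..K}" if "x \<in> P" for x
    using component_le_norm_cart[of x 1] component_le_norm_cart[of x 2] K(2)[OF that] by auto
  have "continuous_map (top_of_set P) (top_of_set ({-K..K} \<times> {-K..K})) (\<lambda>x. (x $ 1, x $ 2))"
    using box by (auto intro!: continuous_intros)
  then have "section_over \<sigma> P (\<lambda>x. s (x $ 1, x $ 2))"
    using s box continuous_map_compose[of "top_of_set P" "top_of_set ({-K..K} \<times> {-K..K})" _ E s]
    unfolding section_over_def by (auto simp: o_def j closest_point_self)
  then show ?thesis by blast
qed

end

section \<open>The boundary of a polygon is a cycle of edges\<close>

lemma polygon_compact: "polygon P \<Longrightarrow> compact P"
  and polygon_convex: "polygon P \<Longrightarrow> convex P"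
  and polygon_polyhedron: "polygon P \<Longrightarrow> polyhedron P"
  and finite_facets: "polygon P \<Longrightarrow> finite (facets P)"
  by (simp_all add: polygon_def facets_def polytope_imp_compact polytope_imp_convex
      polytope_imp_polyhedron finite_polytope_facets)

lemma facet_face: "F \<in> facets P \<Longrightarrow> F face_of P"
  and facet_subset: "F \<in> facets P \<Longrightarrow> F \<subseteq> P"
  and facet_nonempty: "F \<in> facets P \<Longrightarrow> F \<noteq> {}"
  by (auto simp: facets_def facet_of_def dest: face_of_imp_subset)

lemma facet_aff_dim: "polygon P \<Longrightarrow> F \<in> facets P \<Longrightarrow> aff_dim F = 1"
  by (simp add: facets_def facet_of_def polygon_def)

lemma facet_compact: "polygon P \<Longrightarrow> F \<in> facets P \<Longrightarrow> compact F"
  and facet_convex: "polygon P \<Longrightarrow> F \<in> facets P \<Longrightarrow> convex F"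
  using facet_face face_of_imp_compact face_of_imp_convex polygon_compact polygon_convex by blast+

lemma facet_closed: "polygon P \<Longrightarrow> F \<in> facets P \<Longrightarrow> closed F"
  using facet_compact compact_imp_closed by blast

lemma facet_segment:
  assumes "polygon P" "F \<in> facets P"
  obtains u v where "u \<noteq> v" "F = closed_segment u v"
proof -
  have "polytope F"
    using assms face_of_polytope_polytope facet_face unfolding polygon_def by blast
  then obtain n where n: "n simplex F"
    using polytope_lowdim_imp_simplex[of F] facet_aff_dim[OF assms] by auto
  then have "n = 1" using aff_dim_simplex facet_aff_dim[OF assms] by metis
  with n obtain C where C: "card C = 2" "F = convex hull C"
    by (auto simp: simplex)
  then obtain u v where "C = {u, v}" "u \<noteq> v" by (auto simp: card_2_iff)
  then show ?thesis using that C by (simp add: segment_convex_hull)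
qed

lemma facets_inclusion:
  assumes "polygon P" "F \<in> facets P" "G \<in> facets P" "F \<subseteq> G"
  shows "F = G"
proof (rule ccontr)
  assume "F \<noteq> G"
  moreover have "F face_of G"
    using facet_face[OF assms(2)] assms(4) facet_subset[OF assms(3)] by (rule face_of_subset)
  ultimately have "aff_dim F < aff_dim G"
    using face_of_aff_dim_lt facet_convex[OF assms(1,3)] by blast
  then show False using facet_aff_dim assms by simp
qed

lemma facets_meet_once:
  assumes P: "polygon P" and F: "F \<in> facets P" and G: "G \<in> facets P" and "F \<noteq> G"
    and x: "x \<in> F \<inter> G" and y: "y \<in> F \<inter> G"
  shows "x = y"
proof (rule ccontr)
  assume "x \<noteq> y"
  have "(F \<inter> G) face_of P" using F G facet_face face_of_Int by blast
  then have face: "(F \<inter> G) face_of F" using face_of_subset facet_subset[OF F] by blast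
  have "F \<inter> G \<noteq> F" using facets_inclusion[OF P F G] \<open>F \<noteq> G\<close> by blast
  then have "aff_dim (F \<inter> G) < 1"
    using face_of_aff_dim_lt[OF facet_convex[OF P F] face] facet_aff_dim[OF P F] by simp
  moreover have "aff_dim {x, y} \<le> aff_dim (F \<inter> G)" using x y by (intro aff_dim_subset) auto
  ultimately show False using \<open>x \<noteq> y\<close> by simp
qed

text \<open>
  Let \<open>a\<^sub>i\<close> be the outer normals of three edges through a point and \<open>w\<^sub>i\<close> the directions of the
  edges.  Then \<open>a\<^sub>i \<bullet> w\<^sub>i = 0\<close> and \<open>a\<^sub>i \<bullet> w\<^sub>j < 0\<close> otherwise, so the coefficients of a linear
  relation between the \<open>w\<^sub>i\<close> would have pairwise opposite signs.
\<close>

lemma at_most_two_facets: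
  assumes P: "polygon P" and F: "F1 \<in> facets P" "F2 \<in> facets P" "F3 \<in> facets P"
    and ne: "F1 \<noteq> F2" "F1 \<noteq> F3" "F2 \<noteq> F3" and x: "x \<in> F1" "x \<in> F2" "x \<in> F3"
  shows False
proof -
  have normal: "\<exists>a w. a \<bullet> w = 0 \<and> x + w \<in> F \<and> (\<forall>G\<in>facets P. \<forall>v. G \<noteq> F \<longrightarrow> x \<in> G \<longrightarrow> v \<noteq> 0 \<longrightarrow> x + v \<in> G \<longrightarrow> a \<bullet> v < 0) \<and> w \<noteq> 0"
    if F: "F \<in> facets P" and x: "x \<in> F" for F
  proof -
    obtain a b where ab: "P \<subseteq> {x. a \<bullet> x \<le> b}" "F = P \<inter> {x. a \<bullet> x = b}"
      using facet_of_polyhedron[OF polygon_polyhedron[OF P]] F unfolding facets_def by blast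
    obtain u v where uv: "u \<noteq> v" "F = closed_segment u v" using facet_segment[OF P F] .
    then obtain y where y: "y \<in> F" "y \<noteq> x" by (metis ends_in_segment)
    have "a \<bullet> v < 0" if G: "G \<in> facets P" "G \<noteq> F" "x \<in> G" "v \<noteq> 0" "x + v \<in> G" for G v
    proof -
      have "x + v \<notin> F" using facets_meet_once[OF P G(1) F G(2), of x "x + v"] G x by auto
      moreover have "x + v \<in> P" using G facet_subset by blast
      ultimately have "a \<bullet> (x + v) < b" using ab by force
      moreover have "a \<bullet> x = b" using ab x by blast
      ultimately show ?thesis by (simp add: inner_right_distrib)
    qed
    moreover have "a \<bullet> (y - x) = 0" using ab x y by (simp add: inner_diff_right)
    ultimately show ?thesis using y by (intro exI[of _ a] exI[of _ "y - x"]) auto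
  qed
  obtain a1 w1 where 1: "a1 \<bullet> w1 = 0" "x + w1 \<in> F1" "w1 \<noteq> 0"
    "\<And>G v. G \<in> facets P \<Longrightarrow> G \<noteq> F1 \<Longrightarrow> x \<in> G \<Longrightarrow> v \<noteq> 0 \<Longrightarrow> x + v \<in> G \<Longrightarrow> a1 \<bullet> v < 0"
    using normal[OF F(1) x(1)] by blast
  obtain a2 w2 where 2: "a2 \<bullet> w2 = 0" "x + w2 \<in> F2" "w2 \<noteq> 0"
    "\<And>G v. G \<in> facets P \<Longrightarrow> G \<noteq> F2 \<Longrightarrow> x \<in> G \<Longrightarrow> v \<noteq> 0 \<Longrightarrow> x + v \<in> G \<Longrightarrow> a2 \<bullet> v < 0"
    using normal[OF F(2) x(2)] by blast
  obtain a3 w3 where 3: "a3 \<bullet> w3 = 0" "x + w3 \<in> F3" "w3 \<noteq> 0"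
    "\<And>G v. G \<in> facets P \<Longrightarrow> G \<noteq> F3 \<Longrightarrow> x \<in> G \<Longrightarrow> v \<noteq> 0 \<Longrightarrow> x + v \<in> G \<Longrightarrow> a3 \<bullet> v < 0"
    using normal[OF F(3) x(3)] by blast
  have neg: "a1 \<bullet> w2 < 0" "a1 \<bullet> w3 < 0" "a2 \<bullet> w1 < 0" "a2 \<bullet> w3 < 0" "a3 \<bullet> w1 < 0" "a3 \<bullet> w2 < 0"
    using 1 2 3 F ne x by blast+
  have dist: "w1 \<noteq> w2" "w1 \<noteq> w3" "w2 \<noteq> w3" using 1 2 3 neg by force+
  have "dependent {w1, w2, w3}"
    by (rule dependent_biggerset) (use dist in auto)
  then obtain c where c: "\<exists>v\<in>{w1, w2, w3}. c v \<noteq> 0" "(\<Sum>v\<in>{w1, w2, w3}. c v *\<^sub>R v) = 0"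
    using dependent_finite[of "{w1, w2, w3}"] by auto
  have sum: "c w1 *\<^sub>R w1 + c w2 *\<^sub>R w2 + c w3 *\<^sub>R w3 = 0" using c(2) dist by (simp add: add.assoc)
  have rel: "c w1 * (a \<bullet> w1) + c w2 * (a \<bullet> w2) + c w3 * (a \<bullet> w3) = 0" for a
    using arg_cong[OF sum, of "\<lambda>v. a \<bullet> v"] by (simp add: inner_right_distrib)
  have opp: "(p > 0 \<longleftrightarrow> q < 0) \<and> (p < 0 \<longleftrightarrow> q > 0)" if "p * s + q * t = 0" "s < 0" "t < 0" for p q s t :: real
  proof -
    have "p * (- s) = q * t" using that by simp
    then show ?thesis using that(2,3)
      by (metis mult_less_0_iff neg_0_less_iff_less not_less_iff_gr_or_eq zero_less_mult_iff)
  qed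
  have "(c w2 > 0 \<longleftrightarrow> c w3 < 0) \<and> (c w2 < 0 \<longleftrightarrow> c w3 > 0)"
    using opp[of "c w2" "a1 \<bullet> w2" "c w3" "a1 \<bullet> w3"] rel[of a1] neg 1 by simp
  moreover have "(c w1 > 0 \<longleftrightarrow> c w3 < 0) \<and> (c w1 < 0 \<longleftrightarrow> c w3 > 0)"
    using opp[of "c w1" "a2 \<bullet> w1" "c w3" "a2 \<bullet> w3"] rel[of a2] neg 2 by simp
  moreover have "(c w1 > 0 \<longleftrightarrow> c w2 < 0) \<and> (c w1 < 0 \<longleftrightarrow> c w2 > 0)"
    using opp[of "c w1" "a3 \<bullet> w1" "c w2" "a3 \<bullet> w2"] rel[of a3] neg 3 by simp
  ultimately have "c w1 = 0 \<and> c w2 = 0 \<and> c w3 = 0" by linarith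
  then show False using c(1) by blast
qed

lemma extreme_point_two_facets:
  assumes P: "polygon P" and v: "v extreme_point_of P" and F: "F \<in> facets P" "v \<in> F"
  obtains G where "G \<in> facets P" "G \<noteq> F" "v \<in> G"
proof -
  have "{v} face_of P" "{v} \<noteq> P"
    using v P face_of_singleton by (auto simp: polygon_def)
  then have "{v} = \<Inter>{F. F facet_of P \<and> {v} \<subseteq> F}"
    using face_of_polyhedron[OF polygon_polyhedron[OF P]] by blast
  moreover have "F \<noteq> {v}" using facet_aff_dim[OF P F(1)] by auto
  ultimately have "{F. F facet_of P \<and> {v} \<subseteq> F} \<noteq> {F}" by (metis Inter_insert Inter_empty inf_top_right)
  then show ?thesis using that F unfolding facets_def by blast
qed

lemma facet_extreme_points:
  assumes P: "polygon P" and F: "F \<in> facets P" and "F = closed_segment u v"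
  shows "x extreme_point_of P \<and> x \<in> F \<longleftrightarrow> x = u \<or> x = v"
  using extreme_point_of_face[OF facet_face[OF F]] assms(3) extreme_point_of_segment by metis

text \<open>
  Each end point of an edge lies on exactly one further edge, and two edges share at most one point.
\<close>

lemma facet_two_neighbours:
  assumes P: "polygon P" and F: "F \<in> facets P"
  obtains G H where "G \<noteq> H" "{K \<in> facets P. K \<noteq> F \<and> F \<inter> K \<noteq> {}} = {G, H}"
proof -
  obtain u v where uv: "u \<noteq> v" "F = closed_segment u v" using facet_segment[OF P F] .
  note ext = facet_extreme_points[OF P F uv(2)]
  obtain G where G: "G \<in> facets P" "G \<noteq> F" "u \<in> G"
    using extreme_point_two_facets[OF P _ F, of u] ext by blast
  obtain H where H: "H \<in> facets P" "H \<noteq> F" "v \<in> H"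
    using extreme_point_two_facets[OF P _ F, of v] ext by blast
  have uvF: "u \<in> F" "v \<in> F" using uv by auto
  have GH: "G \<noteq> H" using facets_meet_once[OF P F G(1), of u v] G H uv(1) uvF by auto
  have only: "K = G \<or> K = H" if K: "K \<in> facets P" "K \<noteq> F" "F \<inter> K \<noteq> {}" for K
  proof -
    have face: "(F \<inter> K) face_of P" using F K facet_face face_of_Int by blast
    have "compact (F \<inter> K)" "convex (F \<inter> K)"
      using facet_compact[OF P F] facet_closed[OF P K(1)] facet_convex[OF P] F K by (auto intro: convex_Int)
    then obtain x where "x extreme_point_of (F \<inter> K)"
      using extreme_point_exists_convex K(3) by blast
    then have "x extreme_point_of P" "x \<in> F" "x \<in> K"
      using extreme_point_of_face[OF face] by auto
    then have "u \<in> K \<or> v \<in> K" using ext[of x] by auto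
    then show ?thesis
      using at_most_two_facets[OF P F G(1) K(1) _ _ _ uvF(1) G(3)]
        at_most_two_facets[OF P F H(1) K(1) _ _ _ uvF(2) H(3)] G(2) H(2) K(2) by metis
  qed
  have meet: "F \<inter> G \<noteq> {}" "F \<inter> H \<noteq> {}" using G H uvF by auto
  have "{K \<in> facets P. K \<noteq> F \<and> F \<inter> K \<noteq> {}} = {G, H}"
  proof (intro equalityI subsetI)
    fix K assume "K \<in> {G, H}"
    then have "K = G \<or> K = H" by simp
    then show "K \<in> {K \<in> facets P. K \<noteq> F \<and> F \<inter> K \<noteq> {}}" using G H meet by (elim disjE) simp_all
  qed (use only in simp)
  with GH show ?thesis by (rule that)
qed

text \<open>The boundary of a polygon is connected.\<close>

lemma facets_connected:
  assumes P: "polygon P" and A: "A \<subseteq> facets P" "A \<noteq> {}"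
    and cl: "\<And>F G. F \<in> A \<Longrightarrow> G \<in> facets P \<Longrightarrow> F \<inter> G \<noteq> {} \<Longrightarrow> G \<in> A"
  shows "A = facets P"
proof -
  have "affine hull P = UNIV"
    using P aff_dim_eq_full[of P] by (simp add: polygon_def)
  then have fr: "frontier P = \<Union> (facets P)"
    using rel_frontier_of_polyhedron[OF polygon_polyhedron[OF P]] rel_frontier_frontier[of P]
    by (simp add: facets_def)
  have "connected (frontier P)"
    using polygon_convex[OF P] compact_imp_bounded[OF polygon_compact[OF P]]
    by (intro connected_frontier_simple convex_connected connected_complement_bounded_convex) auto
  moreover have "closed (\<Union> A)" "closed (\<Union> (facets P - A))"
    using A finite_facets[OF P] facet_closed[OF P]
    by (auto intro!: closed_Union finite_subset[of _ "facets P"])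
  moreover have "\<Union> A \<inter> \<Union> (facets P - A) = {}" using cl by blast
  moreover have "frontier P \<subseteq> \<Union> A \<union> \<Union> (facets P - A)" using fr by blast
  ultimately have "\<Union> A \<inter> frontier P = {} \<or> \<Union> (facets P - A) \<inter> frontier P = {}"
    unfolding connected_closed by blast
  then have "\<Union> A = {} \<or> \<Union> (facets P - A) = {}" using fr A by blast
  moreover have "\<Union> A \<noteq> {}" using A facet_nonempty by blast
  ultimately have "facets P - A = {}" using facet_nonempty by blast
  then show ?thesis using A by blast
qed

lemma facets_nonempty:
  assumes P: "polygon P"
  shows "facets P \<noteq> {}"
  using polytope_facet_exists[of P] P unfolding polygon_def facets_def by auto

lemma vertex_exists:
  assumes P: "polygon P"
  obtains F G x where "F \<in> facets P" "G \<in> facets P" "F \<noteq> G" "x \<in> F" "x \<in> G"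
proof -
  obtain F where F: "F \<in> facets P" using facets_nonempty[OF P] by blast
  obtain G H where "{K \<in> facets P. K \<noteq> F \<and> F \<inter> K \<noteq> {}} = {G, H}"
    using facet_two_neighbours[OF P F] .
  then have "G \<in> {K \<in> facets P. K \<noteq> F \<and> F \<inter> K \<noteq> {}}" by simp
  then have "G \<in> facets P" "F \<noteq> G" "F \<inter> G \<noteq> {}" by auto
  then show ?thesis using that F by (metis disjoint_iff)
qed

definition cyclic_neighbours :: "nat \<Rightarrow> nat \<Rightarrow> nat \<Rightarrow> bool" where
  "cyclic_neighbours m i j \<longleftrightarrow> Suc i mod m = j \<or> Suc j mod m = i"

text \<open>
  A walk that never turns back first returns to a vertex already visited at its starting point,
  and the vertices on this closed walk have no neighbours outside of it.
\<close>

lemma two_regular_cycle: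
  assumes fin: "finite V" and ne: "V \<noteq> {}" and sym: "\<And>v w. adj v w \<Longrightarrow> adj w v"
    and two: "\<And>v. v \<in> V \<Longrightarrow> \<exists>x y. x \<noteq> y \<and> {w \<in> V. adj v w} = {x, y}"
    and irrefl: "\<And>v. \<not> adj v v"
    and conn: "\<And>A. A \<subseteq> V \<Longrightarrow> A \<noteq> {} \<Longrightarrow> (\<And>v w. v \<in> A \<Longrightarrow> w \<in> V \<Longrightarrow> adj v w \<Longrightarrow> w \<in> A) \<Longrightarrow> A = V"
  obtains e m where "3 \<le> m" "bij_betw e {..<m} V"
    "\<And>i j. i < m \<Longrightarrow> j < m \<Longrightarrow> adj (e i) (e j) \<longleftrightarrow> cyclic_neighbours m i j"
proof -
  obtain v0 where v0: "v0 \<in> V" using ne by blast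
  obtain v1 where v1: "v1 \<in> V" "adj v0 v1" using two[OF v0] by blast
  have ex: "\<exists>w. w \<in> V \<and> adj b w \<and> {w \<in> V. adj b w} = {a, w} \<and> a \<noteq> w"
    if ab: "a \<in> V" "b \<in> V" "adj a b" for a b
  proof -
    obtain x y where xy: "x \<noteq> y" "{w \<in> V. adj b w} = {x, y}" using two[OF ab(2)] by blast
    have "a \<in> {w \<in> V. adj b w}" using ab sym by blast
    then have "a \<in> {x, y}" using xy by simp
    then show ?thesis
    proof
      assume "a = x" then show ?thesis using xy by (intro exI[of _ y]) auto
    next
      assume "a \<in> {y}" then show ?thesis using xy by (intro exI[of _ x]) auto
    qed
  qed
  define nxt where "nxt a b = (SOME w. w \<in> V \<and> adj b w \<and> {w \<in> V. adj b w} = {a, w} \<and> a \<noteq> w)" for a b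
  have nxt: "nxt a b \<in> V \<and> adj b (nxt a b) \<and> {w \<in> V. adj b w} = {a, nxt a b} \<and> a \<noteq> nxt a b"
    if "a \<in> V" "b \<in> V" "adj a b" for a b
    unfolding nxt_def using someI_ex[OF ex[OF that]] .
  define p where "p n = ((\<lambda>(a, b). (b, nxt a b)) ^^ n) (v0, v1)" for n
  define s where "s n = fst (p n)" for n
  have p_Suc: "p (Suc n) = (snd (p n), nxt (fst (p n)) (snd (p n)))" for n
    by (simp add: p_def split_def)
  have sndp: "snd (p n) = s (Suc n)" for n by (simp add: s_def p_Suc)
  have s2: "s (Suc (Suc n)) = nxt (s n) (s (Suc n))" for n
    by (simp add: s_def p_Suc)
  have s01: "s 0 = v0" "s (Suc 0) = v1" by (simp_all add: s_def p_def)
  have walk: "s n \<in> V \<and> s (Suc n) \<in> V \<and> adj (s n) (s (Suc n))" for n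
  proof (induction n)
    case 0 then show ?case using s01 v0 v1 by simp
  next
    case (Suc n) then show ?case using nxt[of "s n" "s (Suc n)"] by (simp add: s2)
  qed
  have nb: "{w \<in> V. adj (s (Suc n)) w} = {s n, s (Suc (Suc n))}" and turn: "s n \<noteq> s (Suc (Suc n))" for n
    using nxt[of "s n" "s (Suc n)"] walk[of n] by (simp_all add: s2)
  have "\<not> inj s"
    using fin walk finite_subset[of "range s" V] finite_imageD[of s UNIV] by auto
  then have "\<exists>m. \<exists>i<m. s i = s m" by (metis injI linorder_neqE_nat)
  define m where "m = (LEAST m. \<exists>i<m. s i = s m)"
  have m: "\<exists>i<m. s i = s m" unfolding m_def using \<open>\<exists>m. \<exists>i<m. s i = s m\<close> by (rule LeastI_ex)
  have least: "s i \<noteq> s j" if "i < j" "j < m" for i j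
    using not_less_Least[of j "\<lambda>m. \<exists>i<m. s i = s m"] that unfolding m_def[symmetric] by blast
  obtain i where i: "i < m" "s i = s m" using m by blast
  have step: "s n \<noteq> s (Suc n)" for n using walk[of n] irrefl by metis
  have "i = 0"
  proof (rule ccontr)
    assume "i \<noteq> 0"
    then obtain i' where i': "i = Suc i'" using not0_implies_Suc by blast
    obtain m' where m': "m = Suc m'" using i(1) by (cases m) auto
    have "adj (s i) (s m')" using walk[of m'] i(2) m' sym by auto
    then have "s m' \<in> {s i', s (Suc i)}" using nb[of i'] walk i' by blast
    moreover have "s m' \<noteq> s i'" using least[of i' m'] i i' m' by auto
    ultimately have eq: "s m' = s (Suc i)" by simp
    have "m' \<noteq> i" using step[of i] i(2) m' by auto
    then have "\<not> Suc i < m'" using least[of "Suc i" m'] eq m' by auto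
    then have "m' = Suc i" using \<open>m' \<noteq> i\<close> i m' by simp
    then show False using turn[of i] i(2) m' by simp
  qed
  then have s0m: "s m = s 0" using i by simp
  have "3 \<le> m"
  proof -
    have "m \<noteq> 0" "m \<noteq> 1" "m \<noteq> 2"
      using i s0m step[of 0] turn[of 0] by (auto simp: numeral_2_eq_2)
    then show ?thesis by simp
  qed
  obtain m' where m': "m = Suc m'" using \<open>3 \<le> m\<close> by (cases m) auto
  have nb0: "{w \<in> V. adj (s 0) w} = {s (Suc 0), s m'}"
  proof -
    have a: "adj (s 0) (s m')" using walk[of m'] sym s0m m' by simp
    have "s (Suc 0) \<noteq> s m'" using least[of "Suc 0" m'] m' \<open>3 \<le> m\<close> by simp
    moreover obtain x y where xy: "{w \<in> V. adj (s 0) w} = {x, y}" using two[of "s 0"] walk[of 0] by metis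
    moreover have "s (Suc 0) \<in> {w \<in> V. adj (s 0) w}" "s m' \<in> {w \<in> V. adj (s 0) w}"
      using a walk[of 0] walk[of m'] by simp_all
    ultimately show ?thesis unfolding xy by auto
  qed
  have nbi: "{w \<in> V. adj (s i) w} = {s (Suc i mod m), s (if i = 0 then m' else i - 1)}" if "i < m" for i
  proof (cases i)
    case 0 then show ?thesis using nb0 \<open>3 \<le> m\<close> by simp
  next
    case (Suc j)
    have "s (Suc i) = s (Suc i mod m)" using that s0m by (cases "Suc i = m") auto
    then show ?thesis using nb[of j] Suc by auto
  qed
  have inj: "inj_on s {..<m}" using least by (intro inj_onI) (metis lessThan_iff linorder_neqE_nat)
  have "s ` {..<m} = V"
  proof (rule conn)
    fix v w assume vw: "v \<in> s ` {..<m}" "w \<in> V" "adj v w"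
    then obtain i where i: "i < m" "v = s i" by auto
    then have "w \<in> {w \<in> V. adj (s i) w}" using vw by simp
    then have "w \<in> {s (Suc i mod m), s (if i = 0 then m' else i - 1)}" unfolding nbi[OF i(1)] .
    moreover have "Suc i mod m < m" using \<open>3 \<le> m\<close> by simp
    moreover have "(if i = 0 then m' else i - 1) < m" using m' i(1) by (cases i) auto
    ultimately show "w \<in> s ` {..<m}" by (auto simp del: mod_Suc)
  next
    have "0 \<in> {..<m}" using \<open>3 \<le> m\<close> by simp
    then show "s ` {..<m} \<noteq> {}" by blast
  qed (use walk in auto)
  then have bij: "bij_betw s {..<m} V" using inj by (simp add: bij_betw_def)
  have "adj (s i) (s j) \<longleftrightarrow> cyclic_neighbours m i j" if ij: "i < m" "j < m" for i j
  proof -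
    have "adj (s i) (s j) \<longleftrightarrow> s j \<in> {s (Suc i mod m), s (if i = 0 then m' else i - 1)}"
      unfolding nbi[OF ij(1), symmetric] using walk[of j] by simp
    also have "\<dots> \<longleftrightarrow> j = Suc i mod m \<or> j = (if i = 0 then m' else i - 1)"
    proof -
      have "Suc i mod m < m" "(if i = 0 then m' else i - 1) < m"
        using m' ij by (simp, cases i, auto)
      then show ?thesis using ij by (simp only: insert_iff empty_iff inj_on_eq_iff[OF inj] lessThan_iff simp_thms)
    qed
    also have "j = (if i = 0 then m' else i - 1) \<longleftrightarrow> Suc j mod m = i"
      using ij m' by (cases "Suc j = m"; cases i) auto
    finally show ?thesis unfolding cyclic_neighbours_def by auto
  qed
  then show ?thesis using that \<open>3 \<le> m\<close> bij by blast
qed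

definition edge_cycle :: "plane set \<Rightarrow> nat \<Rightarrow> (nat \<Rightarrow> plane set) \<Rightarrow> bool" where
  "edge_cycle P m e \<longleftrightarrow> polygon P \<and> 3 \<le> m \<and> bij_betw e {..<m} (facets P) \<and>
     (\<forall>i<m. \<forall>j<m. i \<noteq> j \<longrightarrow> (e i \<inter> e j \<noteq> {} \<longleftrightarrow> cyclic_neighbours m i j))"

lemma edge_cycle_exists:
  assumes P: "polygon P"
  obtains m e where "edge_cycle P m e"
proof -
  let ?adj = "\<lambda>F G. F \<noteq> G \<and> F \<inter> G \<noteq> {}"
  show ?thesis
  proof (rule two_regular_cycle[of "facets P" ?adj])
    fix v assume "v \<in> facets P"
    then obtain G H where "G \<noteq> H" "{K \<in> facets P. K \<noteq> v \<and> v \<inter> K \<noteq> {}} = {G, H}"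
      using facet_two_neighbours[OF P] by blast
    moreover have "{w \<in> facets P. v \<noteq> w \<and> v \<inter> w \<noteq> {}} = {K \<in> facets P. K \<noteq> v \<and> v \<inter> K \<noteq> {}}"
      by (auto simp del: disjoint_iff)
    ultimately show "\<exists>x y. x \<noteq> y \<and> {w \<in> facets P. v \<noteq> w \<and> v \<inter> w \<noteq> {}} = {x, y}" by metis
  next
    fix A
    assume A: "A \<subseteq> facets P" "A \<noteq> {}"
      "\<And>v w. v \<in> A \<Longrightarrow> w \<in> facets P \<Longrightarrow> v \<noteq> w \<and> v \<inter> w \<noteq> {} \<Longrightarrow> w \<in> A"
    have "G \<in> A" if "F \<in> A" "G \<in> facets P" "F \<inter> G \<noteq> {}" for F G
      using A(3)[OF that(1,2)] that by (cases "F = G") auto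
    then show "A = facets P" by (rule facets_connected[OF P A(1,2)])
  next
    fix e :: "nat \<Rightarrow> plane set" and m
    assume em: "3 \<le> m" "bij_betw e {..<m} (facets P)"
      "\<And>i j. i < m \<Longrightarrow> j < m \<Longrightarrow> ?adj (e i) (e j) \<longleftrightarrow> cyclic_neighbours m i j"
    have "e i \<noteq> e j" if "i < m" "j < m" "i \<noteq> j" for i j
      using inj_on_eq_iff[OF bij_betw_imp_inj_on[OF em(2)], of i j] that by simp
    then have "e i \<inter> e j \<noteq> {} \<longleftrightarrow> cyclic_neighbours m i j" if "i < m" "j < m" "i \<noteq> j" for i j
      using em(3)[OF that(1,2)] that by metis
    then have "edge_cycle P m e" unfolding edge_cycle_def using P em(1,2) by blast
    then show ?thesis by (rule that)
  qed (use finite_facets[OF P] facets_nonempty[OF P] in \<open>auto simp: Int_commute\<close>)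
qed

lemma edge_cycle_card: "edge_cycle P m e \<Longrightarrow> card (facets P) = m"
  unfolding edge_cycle_def by (metis bij_betw_same_card card_lessThan)

text \<open>Every edge has two end points and every vertex lies on two edges.\<close>

lemma card_extreme_points:
  assumes P: "polygon P"
  shows "finite {v. v extreme_point_of P}" "card {v. v extreme_point_of P} = card (facets P)"
proof -
  let ?X = "{v. v extreme_point_of P}"
  show fin: "finite ?X" using finite_polyhedron_extreme_points[OF polygon_polyhedron[OF P]] .
  have "card {F \<in> facets P. v \<in> F} = 2" if v: "v \<in> ?X" for v
  proof -
    have "{v} face_of P" "{v} \<noteq> P" using v P face_of_singleton by (auto simp: polygon_def)
    then obtain F where F: "F \<in> facets P" "v \<in> F"
      using face_of_polyhedron_subset_facet[OF polygon_polyhedron[OF P], of "{v}"] unfolding facets_def by auto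
    obtain G where G: "G \<in> facets P" "G \<noteq> F" "v \<in> G"
      using extreme_point_two_facets[OF P _ F] v by blast
    have "K = F \<or> K = G" if "K \<in> facets P" "v \<in> K" for K
      using at_most_two_facets[OF P F(1) G(1) that(1) _ _ _ F(2) G(3) that(2)] G(2) by metis
    then have "{F \<in> facets P. v \<in> F} = {F, G}"
      using F G by (intro equalityI subsetI) auto
    then show ?thesis using G by simp
  qed
  then have "(\<Sum>F\<in>facets P. card {v \<in> ?X. v \<in> F}) = 2 * card ?X"
    using sum_multicount[of "facets P" ?X "\<lambda>F v. v \<in> F" 2] finite_facets[OF P] fin by blast
  moreover have "card {v \<in> ?X. v \<in> F} = 2" if F: "F \<in> facets P" for F
  proof -
    obtain u v where uv: "u \<noteq> v" "F = closed_segment u v" using facet_segment[OF P F] .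
    have "{v \<in> ?X. v \<in> F} = {u, v}" using facet_extreme_points[OF P F uv(2)] by auto
    then show ?thesis using uv by simp
  qed
  ultimately show "card ?X = card (facets P)" by simp
qed

text \<open>
  The convex hull of \<open>n\<close> vertices is such a polygon.
\<close>

lemma polygon_with_fewer_edges:
  assumes P: "polygon P" and n: "3 \<le> n" "n \<le> card (facets P)"
  obtains W e where "edge_cycle W n e"
proof -
  obtain S where S: "S \<subseteq> {v. v extreme_point_of P}" "card S = n"
    using obtain_subset_with_card_n[of n] card_extreme_points[OF P] n by metis
  then have fin: "finite S" using n card.infinite by fastforce
  let ?W = "convex hull S"
  have SP: "S \<subseteq> P" using S extreme_point_of_def by blast
  have "a \<notin> convex hull (S - {a})" if a: "a \<in> S" for a
  proof
    assume "a \<in> convex hull (S - {a})"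
    moreover have "convex hull (S - {a}) \<subseteq> P" by (rule hull_minimal) (use SP polygon_convex[OF P] in auto)
    moreover have aP: "a extreme_point_of P" using a S by blast
    ultimately have "a extreme_point_of (convex hull (S - {a}))"
      unfolding extreme_point_of_def by blast
    then show False using extreme_point_of_convex_hull by blast
  qed
  then have ext: "x extreme_point_of ?W \<longleftrightarrow> x \<in> S" for x
    using extreme_point_of_convex_hull_convex_independent[OF finite_imp_compact[OF fin]] by metis
  have "aff_dim S \<le> 2" using aff_dim_le_DIM[of S] by simp
  moreover have "\<not> aff_dim S \<le> 1"
  proof
    assume "aff_dim S \<le> 1"
    then have low: "aff_dim ?W \<le> 1" by (simp add: aff_dim_convex_hull)
    obtain k where k: "k simplex ?W"
      by (rule polytope_lowdim_imp_simplex[OF polytope_convex_hull[OF fin] low])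
    then obtain C where C: "\<not> affine_dependent C" "int (card C) = k + 1" "?W = convex hull C"
      unfolding simplex_def by auto
    have "k \<le> 1" using aff_dim_simplex[OF k] low by simp
    have "S \<subseteq> C"
    proof
      fix x assume "x \<in> S"
      then have "x extreme_point_of (convex hull C)" unfolding C(3)[symmetric] using ext by simp
      then show "x \<in> C" by (rule extreme_point_of_convex_hull)
    qed
    then have "n \<le> card C" using S(2) card_mono aff_independent_finite[OF C(1)] by blast
    then show False using C(2) \<open>k \<le> 1\<close> n by simp
  qed
  ultimately have W: "polygon ?W" unfolding polygon_def using polytope_convex_hull[OF fin] by (simp add: aff_dim_convex_hull)
  have "card (facets ?W) = n" using card_extreme_points(2)[OF W] ext S(2) by simp
  then show ?thesis using edge_cycle_exists[OF W] edge_cycle_card that by metis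
qed

section \<open>Binary vectors and generated subgroups\<close>

instance bit :: finite
proof
  have "(UNIV :: bit set) = {0, 1}" using bit.exhaust by blast
  then show "finite (UNIV :: bit set)" by (metis finite.emptyI finite_insert)
qed

lemma bit_add_self [simp]: "(b::bit) + b = 0" by (cases b) simp_all

lemma bit_vec_add_self [simp]: "(v :: bit^'n::finite) + v = 0"
  by (simp add: vec_eq_iff)

lemma bit_vec_add_self_left [simp]: "(v :: bit^'n::finite) + (v + w) = w"
  by (metis add.assoc add.left_neutral bit_vec_add_self)

lemma bit_vec_uminus [simp]: "- (v :: bit^'n::finite) = v"
  by (metis add_eq_0_iff bit_vec_add_self)

lemma base_group_cases:
  fixes a b v :: base_group
  assumes "a \<noteq> 0" "b \<noteq> 0" "a \<noteq> b"
  shows "v = 0 \<or> v = a \<or> v = b \<or> v = a + b"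
  using assms
  by (cases "a $ 1"; cases "a $ 2"; cases "b $ 1"; cases "b $ 2"; cases "v $ 1"; cases "v $ 2")
    (auto simp: vec_eq_iff forall_2)

lemma span_base_group:
  fixes a b :: base_group
  shows "vec.span {a, b} = UNIV \<longleftrightarrow> a \<noteq> 0 \<and> b \<noteq> 0 \<and> a \<noteq> b"
proof
  assume sp: "vec.span {a, b} = UNIV"
  have ne: "axis 1 1 \<noteq> (axis 2 1 :: base_group)" "axis 1 1 \<noteq> (0 :: base_group)" "axis 2 1 \<noteq> (0 :: base_group)"
    by (auto simp: vec_eq_iff axis_def forall_2)
  have one: "vec.span {c} \<noteq> (UNIV :: base_group set)" for c :: base_group
  proof
    assume "vec.span {c} = UNIV"
    then have r: "range (\<lambda>k. k *s c) = UNIV" using vec.span_singleton[of c] by simp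
    have "v = 0 \<or> v = c" for v
    proof -
      have "v \<in> range (\<lambda>k. k *s c)" using r by simp
      then obtain k where "v = k *s c" by (rule imageE)
      then show ?thesis by (cases k) simp_all
    qed
    then show False using ne by metis
  qed
  show "a \<noteq> 0 \<and> b \<noteq> 0 \<and> a \<noteq> b"
    using sp one[of a] one[of b] by (auto simp: insert_commute[of _ 0] vec.span_insert_0)
next
  assume ab: "a \<noteq> 0 \<and> b \<noteq> 0 \<and> a \<noteq> b"
  have "v \<in> vec.span {a, b}" for v
    using base_group_cases[of a b v] ab
    by (auto intro: vec.span_add vec.span_base vec.span_zero)
  then show "vec.span {a, b} = UNIV" by auto
qed

definition sgn_bit :: "bit \<Rightarrow> real" where
  "sgn_bit b = (if b = 1 then - 1 else 1)"

lemma sgn_bit_simps [simp]: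
  "sgn_bit 0 = 1" "sgn_bit 1 = - 1" "sgn_bit (a + b) = sgn_bit a * sgn_bit b"
  "sgn_bit a * sgn_bit a = 1" "sgn_bit a \<noteq> 0" "\<bar>sgn_bit a\<bar> = 1"
  by (cases a; cases b; simp add: sgn_bit_def)+

lemma sgn_bit_inj: "sgn_bit a = sgn_bit b \<longleftrightarrow> a = b"
  by (cases a; cases b) simp_all

lemma constant_sign:
  fixes c :: "'a::topological_space \<Rightarrow> real"
  assumes "connected F" "continuous_on F c" "\<And>x. x \<in> F \<Longrightarrow> \<bar>c x\<bar> = 1"
  obtains b where "\<And>x. x \<in> F \<Longrightarrow> c x = sgn_bit b"
proof -
  have conn: "connected (c ` F)" using assms by (intro connected_continuous_image)
  have "\<not> (1 \<in> c ` F \<and> - 1 \<in> c ` F)"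
  proof
    assume "1 \<in> c ` F \<and> - 1 \<in> c ` F"
    then have "0 \<in> c ` F" using connectedD_interval[OF conn, of "-1" 1 0] by auto
    then show False using assms(3) by force
  qed
  then have "(\<forall>x\<in>F. c x = 1) \<or> (\<forall>x\<in>F. c x = - 1)"
    using assms(3) by (metis abs_eq_iff abs_of_nonneg imageI zero_le_one)
  then show ?thesis using that[of 0] that[of 1] by auto
qed

lemma subgroup_generated: "0 \<in> generated_subgroup S"
    "x \<in> generated_subgroup S \<Longrightarrow> y \<in> generated_subgroup S \<Longrightarrow> x - y \<in> generated_subgroup S"
proof -
  have "0 \<in> generated_subgroup S \<and> (\<forall>x\<in>generated_subgroup S. \<forall>y\<in>generated_subgroup S. x - y \<in> generated_subgroup S)"
    unfolding generated_subgroup_def by (rule hull_in) blast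
  then show "0 \<in> generated_subgroup S"
    "x \<in> generated_subgroup S \<Longrightarrow> y \<in> generated_subgroup S \<Longrightarrow> x - y \<in> generated_subgroup S" by blast+
qed

lemma generated_uminus: "x \<in> generated_subgroup S \<Longrightarrow> - x \<in> generated_subgroup S"
  using subgroup_generated[where S = S] by (metis diff_0)

lemma generated_add: "x \<in> generated_subgroup S \<Longrightarrow> y \<in> generated_subgroup S \<Longrightarrow> x + y \<in> generated_subgroup S"
  using subgroup_generated(2)[of x S "- y"] generated_uminus by (metis diff_minus_eq_add)

lemma generated_inc: "x \<in> S \<Longrightarrow> x \<in> generated_subgroup S"
  unfolding generated_subgroup_def by (rule hull_inc)

lemma generated_mono: "S \<subseteq> T \<Longrightarrow> generated_subgroup S \<subseteq> generated_subgroup T"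
  unfolding generated_subgroup_def by (rule hull_mono)

lemma generated_induct [consumes 1, case_names generator zero diff]:
  assumes "x \<in> generated_subgroup S" "\<And>x. x \<in> S \<Longrightarrow> R x" "R 0" "\<And>x y. R x \<Longrightarrow> R y \<Longrightarrow> R (x - y)"
  shows "R x"
  using assms(1) unfolding generated_subgroup_def
  by (rule hull_induct) (use assms(2-) in auto)

lemma glue_class_eq_iff:
  assumes "t \<in> G" "t' \<in> G"
  shows "glue_class G C (t, x) = glue_class G C (t', x') \<longleftrightarrow> x = x' \<and> - t + t' \<in> isotropy_at C x"
proof
  assume eq: "glue_class G C (t, x) = glue_class G C (t', x')"
  have "(t', x') \<in> glue_class G C (t', x')"
    using assms subgroup_generated(1) by (auto simp: glue_class_def isotropy_at_def)
  then have "(t', x') \<in> glue_class G C (t, x)" using eq by simp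
  then show "x = x' \<and> - t + t' \<in> isotropy_at C x" by (auto simp: glue_class_def)
next
  assume xt: "x = x' \<and> - t + t' \<in> isotropy_at C x"
  define S where "S = {v. \<exists>F. (F, v) \<in> C \<and> x \<in> F}"
  have S: "isotropy_at C x = generated_subgroup S" by (simp add: isotropy_at_def S_def)
  have d: "- t + t' \<in> generated_subgroup S" using xt S by simp
  have "- t + s \<in> isotropy_at C x \<longleftrightarrow> - t' + s \<in> isotropy_at C x" for s
  proof
    assume "- t + s \<in> isotropy_at C x"
    then have "- (- t + t') + (- t + s) \<in> generated_subgroup S"
      unfolding S by (rule generated_add[OF generated_uminus[OF d]])
    then show "- t' + s \<in> isotropy_at C x" by (simp add: S minus_add add.assoc)
  next
    assume "- t' + s \<in> isotropy_at C x"
    then have "(- t + t') + (- t' + s) \<in> generated_subgroup S"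
      unfolding S by (rule generated_add[OF d])
    then show "- t + s \<in> isotropy_at C x" by (simp add: S add.assoc)
  qed
  then show "glue_class G C (t, x) = glue_class G C (t', x')"
    using xt by (auto simp: glue_class_def)
qed

section \<open>Small covers as quotients of copies of a polygon\<close>

text \<open>
  \<open>M\<close> is glued from the copies \<open>{g} \<times> P\<close> by \<open>q\<close>.  The automorphism \<open>\<psi>\<close> allows for actions that
  agree with the standard one only after a change of coordinates in the group.
\<close>

locale surface_model =
  fixes P :: "plane set" and \<mu> :: "plane set \<Rightarrow> base_group"
    and M :: "'m topology" and a :: "base_group \<Rightarrow> 'm \<Rightarrow> 'm"
    and \<psi> :: "base_group \<Rightarrow> base_group" and q :: "base_group \<times> plane \<Rightarrow> 'm"
  assumes polygon: "polygon P"
    and characteristic: "characteristic_function P \<mu>"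
    and quotient: "quotient_map (prod_topology (discrete_topology UNIV) (top_of_set P)) M q"
    and kernel: "\<And>g h x y. x \<in> P \<Longrightarrow> y \<in> P \<Longrightarrow>
      q (g, x) = q (h, y) \<longleftrightarrow> x = y \<and> g + h \<in> generated_subgroup {\<mu> F | F. F \<in> facets P \<and> x \<in> F}"
    and automorphism: "group_automorphism UNIV \<psi>"
    and action: "\<And>g h x. x \<in> P \<Longrightarrow> a h (q (g, x)) = q (\<psi> h + g, x)"
begin

abbreviation "X \<equiv> prod_topology (discrete_topology (UNIV :: base_group set)) (top_of_set P)"

abbreviation "\<psi>' \<equiv> inv_into UNIV \<psi>"

definition iso :: "plane \<Rightarrow> base_group set" where
  "iso x = generated_subgroup {\<mu> F | F. F \<in> facets P \<and> x \<in> F}"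

lemma kernel': "x \<in> P \<Longrightarrow> q (g, x) = q (g + d, x) \<longleftrightarrow> d \<in> iso x"
  using kernel[of x x g "g + d"] by (simp add: iso_def)

lemma characteristic_meet:
  assumes "F \<in> facets P" "G \<in> facets P" "F \<noteq> G" "x \<in> F" "x \<in> G"
  shows "\<mu> F \<noteq> 0" "\<mu> G \<noteq> 0" "\<mu> F \<noteq> \<mu> G"
  using characteristic assms unfolding characteristic_function_def span_base_group by blast+

lemma facet_iso: "F \<in> facets P \<Longrightarrow> x \<in> F \<Longrightarrow> \<mu> F \<in> iso x"
  unfolding iso_def by (rule generated_inc) blast

lemma continuous_sheet: "continuous_map (top_of_set P) M (\<lambda>x. q (g, x))"
  using quotient_imp_continuous_map[OF quotient] unfolding continuous_map_from_discrete_prod by blast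

lemma topspace_M: "topspace M = q ` (UNIV \<times> P)"
  using quotient_imp_surjective_map[OF quotient] by auto

lemma sheet_in: "x \<in> P \<Longrightarrow> q (g, x) \<in> topspace M"
  unfolding topspace_M by blast

lemma surjE:
  assumes "m \<in> topspace M"
  obtains g x where "x \<in> P" "q (g, x) = m"
  using assms unfolding topspace_M by auto

lemma closed_iso: "closed {x \<in> P. d \<in> iso x}"
proof -
  let ?S = "{S. S \<subseteq> facets P \<and> d \<in> generated_subgroup (\<mu> ` S)}"
  have "{x \<in> P. d \<in> iso x} = P \<inter> (\<Union>S\<in>?S. \<Inter>S)"
  proof (intro equalityI subsetI)
    fix x assume x: "x \<in> {x \<in> P. d \<in> iso x}"
    have "{\<mu> F | F. F \<in> facets P \<and> x \<in> F} = \<mu> ` {F \<in> facets P. x \<in> F}" by auto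
    then have "{F \<in> facets P. x \<in> F} \<in> ?S" using x unfolding iso_def by auto
    then show "x \<in> P \<inter> (\<Union>S\<in>?S. \<Inter>S)" using x by blast
  next
    fix x assume "x \<in> P \<inter> (\<Union>S\<in>?S. \<Inter>S)"
    then obtain S where S: "x \<in> P" "S \<subseteq> facets P" "d \<in> generated_subgroup (\<mu> ` S)" "\<forall>F\<in>S. x \<in> F" by blast
    then have "generated_subgroup (\<mu> ` S) \<subseteq> iso x"
      unfolding iso_def by (intro generated_mono) blast
    then show "x \<in> {x \<in> P. d \<in> iso x}" using S by blast
  qed
  moreover have "closed (P \<inter> (\<Union>S\<in>?S. \<Inter>S))"
    using finite_facets[OF polygon] facet_closed[OF polygon] compact_imp_closed[OF polygon_compact[OF polygon]]
    by (intro closed_Int closed_UN closed_Inter) auto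
  ultimately show ?thesis by simp
qed

lemma compact_sheets: "compact_space X"
  using polygon_compact[OF polygon]
  by (simp add: compact_space_prod_topology compact_space_discrete_topology compact_space_subtopology)

lemma Hausdorff_sheets: "Hausdorff_space X"
  by (simp add: Hausdorff_space_prod_topology Hausdorff_space_subtopology)

text \<open>The saturation of a closed set is a finite union of closed sets, one for each group element.\<close>

lemma closed_map_q: "closed_map X M q"
  unfolding closed_map_def
proof (intro allI impI)
  fix C assume C: "closedin X C"
  have Csub: "C \<subseteq> UNIV \<times> P" using closedin_subset[OF C] by simp
  have shift: "continuous_map X X (\<lambda>(h, y). (h + d, y))" for d
    by (simp add: continuous_map_from_discrete_prod continuous_map_pairedI)
  have "{z \<in> topspace X. q z \<in> q ` C} =
      (\<Union>d. {z \<in> topspace X. (\<lambda>(h, y). (h + d, y)) z \<in> C} \<inter> {z \<in> topspace X. snd z \<in> {x \<in> P. d \<in> iso x}})"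
    (is "?L = (\<Union>d. ?A d \<inter> ?B d)")
  proof (intro equalityI subsetI)
    fix z assume "z \<in> ?L"
    then obtain h y g x where z: "z = (h, y)" "y \<in> P" "(g, x) \<in> C" "q (h, y) = q (g, x)" by force
    then have "x \<in> P" using Csub by blast
    then have "x = y" "h + g \<in> iso y" 
      using kernel[OF z(2) \<open>x \<in> P\<close>, of h g] z(4) by (auto simp: iso_def)
    then have "z \<in> ?A (h + g) \<inter> ?B (h + g)" using z by simp
    then show "z \<in> (\<Union>d. ?A d \<inter> ?B d)" by blast
  next
    fix z assume "z \<in> (\<Union>d. ?A d \<inter> ?B d)"
    then obtain d h y where z: "z = (h, y)" "y \<in> P" "(h + d, y) \<in> C" "d \<in> iso y" by force
    then have "q (h, y) = q (h + d, y)" using kernel' by blast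
    then show "z \<in> ?L" using z by force
  qed
  moreover have "closedin X (?A d \<inter> ?B d)" for d
  proof (rule closedin_Int)
    show "closedin X (?A d)" by (rule closedin_continuous_map_preimage[OF shift C])
    show "closedin X (?B d)"
      by (rule closedin_continuous_map_preimage[OF continuous_map_snd])
        (use closed_iso in \<open>auto intro: closed_subset\<close>)
  qed
  ultimately have "closedin X {z \<in> topspace X. q z \<in> q ` C}"
    by (auto intro: closedin_Union)
  moreover have "q ` C \<subseteq> topspace M" unfolding topspace_M using Csub by blast
  moreover have "\<forall>U. U \<subseteq> topspace M \<longrightarrow> closedin X {z \<in> topspace X. q z \<in> U} = closedin M U"
    using quotient unfolding quotient_map_closedin by (rule conjunct2)
  ultimately show "closedin M (q ` C)" by simp
qed

lemma Hausdorff_M: "Hausdorff_space M"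
  using normal_Hausdorff_space_closed_continuous_map_image[OF _ Hausdorff_sheets closed_map_q]
    quotient_imp_continuous_map[OF quotient] quotient_imp_surjective_map[OF quotient]
    compact_Hausdorff_or_regular_imp_normal_space compact_sheets Hausdorff_sheets by blast

lemma \<psi>_add: "\<psi> (g + h) = \<psi> g + \<psi> h" and \<psi>_bij: "bij \<psi>"
  using automorphism unfolding group_automorphism_def by auto

lemma \<psi>_zero [simp]: "\<psi> 0 = 0"
  using \<psi>_add[of 0 0] by simp

lemma inv_\<psi>: "\<psi>' (\<psi> g) = g" "\<psi> (\<psi>' g) = g"
  using \<psi>_bij by (simp_all add: bij_is_inj bij_is_surj surj_f_inv_f)

lemma inv_\<psi>_add: "\<psi>' (g + h) = \<psi>' g + \<psi>' h"
  by (metis \<psi>_add inv_\<psi>)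

section \<open>Framings of equivariant line bundles\<close>

text \<open>
  A framing trivializes the pullback of a line bundle to the copies of \<open>P\<close> in such a way that
  crossing the edge \<open>F\<close> multiplies by a sign that is the same for all copies.
\<close>

definition frame :: "('e, 'm) vbundle \<Rightarrow> (base_group \<Rightarrow> plane \<Rightarrow> 'e) \<Rightarrow> (plane set \<Rightarrow> bit) \<Rightarrow> bool" where
  "frame L s \<epsilon> \<longleftrightarrow>
     (\<forall>g. continuous_map (top_of_set P) (vb_total L) (s g)) \<and>
     (\<forall>g. \<forall>x\<in>P. s g x \<in> nonzero_vectors L \<and> vb_proj L (s g x) = q (g, x)) \<and>
     (\<forall>g. \<forall>F\<in>facets P. \<forall>x\<in>F. s (g + \<mu> F) x = vb_scale L (sgn_bit (\<epsilon> F)) (s g x))"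

definition equivariant_frame ::
  "(base_group \<Rightarrow> 'e \<Rightarrow> 'e) \<Rightarrow> (base_group \<Rightarrow> plane \<Rightarrow> 'e) \<Rightarrow> bool" where
  "equivariant_frame A s \<longleftrightarrow> (\<forall>h g. \<forall>x\<in>P. A h (s g x) = s (\<psi> h + g) x)"

text \<open>
  Given a lift of the action, translating one section over the copy of \<open>0\<close> around yields a
  framing: on \<open>F\<close> the translate by \<open>\<mu> F\<close> is a multiple of the original section, by a function of
  square one since the lift is an involution.
\<close>

lemma frame_of_lift:
  fixes L :: "('e, 'm) vbundle"
  assumes L: "line_bundle_over M L" and A: "lifts_action a L A"
  obtains s \<epsilon> where "frame L s \<epsilon>" "equivariant_frame A s"
proof -
  interpret L: line_bundle L using L by (simp add: line_bundle_over_def line_bundle_def)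
  have base: "vb_base L = M" using L by (simp add: line_bundle_over_def)
  have Ac: "continuous_map (vb_total L) (vb_total L) (A g)"
    and A0: "v \<in> topspace (vb_total L) \<Longrightarrow> A 0 v = v"
    and Aadd: "v \<in> topspace (vb_total L) \<Longrightarrow> A (g + h) v = A g (A h v)"
    and Ap: "v \<in> topspace (vb_total L) \<Longrightarrow> vb_proj L (A g v) = a g (vb_proj L v)"
    and As: "v \<in> topspace (vb_total L) \<Longrightarrow> A g (vb_scale L r v) = vb_scale L r (A g v)" for g h v r
    using A unfolding lifts_action_def group_action_on_def fibrewise_linear_def by blast+
  have Ain: "A g v \<in> topspace (vb_total L)" if "v \<in> topspace (vb_total L)" for g v
    using continuous_map_image_subset_topspace[OF Ac] that by blast
  have Anz: "A g v \<in> nonzero_vectors L" if v: "v \<in> nonzero_vectors L" for g v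
  proof -
    have v': "v \<in> topspace (vb_total L)" using v L.nonzero_in by blast
    have "A g v \<noteq> vb_scale L 0 (A g v)"
    proof
      assume "A g v = vb_scale L 0 (A g v)"
      then have "A g (A g v) = A g (A g (vb_scale L 0 v))" by (simp add: As v')
      then have "v = vb_scale L 0 v"
        using Aadd[OF v', of g g] Aadd[OF L.scale_in[OF v'], of g g 0] A0 v' L.scale_in by simp
      then show False using v by (simp add: nonzero_vectors_def)
    qed
    then show ?thesis using Ain[OF v'] by (simp add: nonzero_vectors_def)
  qed
  have "continuous_map (top_of_set P) (vb_base L) (\<lambda>x. q (0, x))"
    using continuous_sheet base by simp
  then obtain s0 where s0: "L.section_over (\<lambda>x. q (0, x)) P s0"
    using L.section_over_convex[OF polygon_convex[OF polygon] polygon_compact[OF polygon]] by blast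
  then have s0c: "continuous_map (top_of_set P) (vb_total L) s0"
    and s0n: "\<And>x. x \<in> P \<Longrightarrow> s0 x \<in> nonzero_vectors L" and s0p: "\<And>x. x \<in> P \<Longrightarrow> vb_proj L (s0 x) = q (0, x)"
    unfolding L.section_over_def by auto
  have s0i: "x \<in> P \<Longrightarrow> s0 x \<in> topspace (vb_total L)" for x using s0n L.nonzero_in by blast
  define s where "s g x = A (\<psi>' g) (s0 x)" for g x
  have sign: "\<exists>b. \<forall>x\<in>F. A (\<psi>' (\<mu> F)) (s0 x) = vb_scale L (sgn_bit b) (s0 x)" if F: "F \<in> facets P" for F
  proof -
    define h where "h = \<psi>' (\<mu> F)"
    define c where "c x = ratio L (A h (s0 x)) (s0 x)" for x
    have FP: "F \<subseteq> P" using facet_subset[OF F] .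
    have hp: "vb_proj L (A h (s0 x)) = vb_proj L (s0 x)" if "x \<in> F" for x
      using kernel'[of x 0 "\<mu> F"] facet_iso[OF F that] that FP
      by (auto simp: Ap s0i s0p action h_def inv_\<psi> subset_iff)
    have eq: "A h (s0 x) = vb_scale L (c x) (s0 x)" if x: "x \<in> F" for x
      unfolding c_def using x FP hp[OF x] by (auto simp: L.scale_ratio s0n s0i Ain)
    have "\<bar>c x\<bar> = 1" if x: "x \<in> F" for x
    proof -
      have xP: "x \<in> P" using x FP by blast
      have "vb_scale L 1 (s0 x) = A (h + h) (s0 x)"
        by (simp only: bit_vec_add_self A0[OF s0i[OF xP]] L.scale_one[OF s0i[OF xP]])
      also have "\<dots> = vb_scale L (c x * c x) (s0 x)"
        by (simp only: Aadd[OF s0i[OF xP]] eq[OF x] As[OF s0i[OF xP]] L.scale_scale[OF s0i[OF xP]])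
      finally have "c x * c x = 1" using L.scale_cancel[OF s0n[OF xP]] by simp
      then show ?thesis by (metis abs_1 abs_mult_self_eq abs_of_nonneg abs_ge_zero abs_square_eq_1 power2_eq_square)
    qed
    moreover have "continuous_map (top_of_set F) euclideanreal c"
      unfolding c_def
    proof (rule L.continuous_ratio)
      show "continuous_map (top_of_set F) (vb_total L) (\<lambda>x. A h (s0 x))"
        by (rule continuous_map_from_subtopology_mono[OF continuous_map_compose[OF s0c Ac, unfolded o_def] FP])
      show "continuous_map (top_of_set F) (vb_total L) s0"
        by (rule continuous_map_from_subtopology_mono[OF s0c FP])
    qed (use FP hp s0n in auto)
    then have "continuous_on F c" by simp
    moreover have "connected F" using facet_convex[OF polygon F] convex_connected by blast
    ultimately obtain b where "\<And>x. x \<in> F \<Longrightarrow> c x = sgn_bit b" using constant_sign by blast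
    then show ?thesis using eq unfolding h_def by metis
  qed
  define \<epsilon> where "\<epsilon> F = (SOME b. \<forall>x\<in>F. A (\<psi>' (\<mu> F)) (s0 x) = vb_scale L (sgn_bit b) (s0 x))" for F
  have \<epsilon>: "A (\<psi>' (\<mu> F)) (s0 x) = vb_scale L (sgn_bit (\<epsilon> F)) (s0 x)" if "F \<in> facets P" "x \<in> F" for F x
    using someI_ex[OF sign[OF that(1)]] that(2) unfolding \<epsilon>_def by blast
  have "frame L s \<epsilon>"
    unfolding frame_def
  proof (intro conjI allI ballI)
    show "continuous_map (top_of_set P) (vb_total L) (s g)" for g
      using continuous_map_compose[OF s0c Ac] unfolding s_def o_def .
    fix g x
    show "x \<in> P \<Longrightarrow> s g x \<in> nonzero_vectors L"
      using Anz s0n unfolding s_def by blast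
    show "x \<in> P \<Longrightarrow> vb_proj L (s g x) = q (g, x)"
      by (simp add: s_def Ap s0i s0p action inv_\<psi>)
    fix F assume F: "F \<in> facets P" "x \<in> F"
    then have "x \<in> P" using facet_subset by blast
    then show "s (g + \<mu> F) x = vb_scale L (sgn_bit (\<epsilon> F)) (s g x)"
      by (simp add: s_def inv_\<psi>_add Aadd s0i \<epsilon>[OF F] As)
  qed
  moreover have "equivariant_frame A s"
    unfolding equivariant_frame_def s_def by (simp add: inv_\<psi>_add inv_\<psi> Aadd s0i)
  ultimately show ?thesis using that by blast
qed

lemma frame_transition:
  assumes L: "line_bundle_over M L" and s: "frame L s \<epsilon>" and x: "x \<in> P" and d: "d \<in> iso x"
  shows "\<exists>b. \<forall>g. s (g + d) x = vb_scale L (sgn_bit b) (s g x)"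
proof -
  interpret L: line_bundle L using L by (simp add: line_bundle_over_def line_bundle_def)
  have sin: "s g x \<in> topspace (vb_total L)" for g using s x L.nonzero_in unfolding frame_def by blast
  show ?thesis
    using d unfolding iso_def
  proof (induction rule: generated_induct)
    case (generator d)
    then show ?case using s unfolding frame_def by blast
  next
    case zero
    show ?case by (rule exI[of _ 0]) (simp add: L.scale_one sin)
  next
    case (diff d e)
    then obtain b c where b: "\<And>g. s (g + d) x = vb_scale L (sgn_bit b) (s g x)"
      and c: "\<And>g. s (g + e) x = vb_scale L (sgn_bit c) (s g x)" by blast
    have eq: "g + (d - e) = g + d + e" for g
      by (metis add.assoc bit_vec_uminus diff_conv_add_uminus)
    show ?case
      by (intro exI[of _ "c + b"] allI) (simp only: eq b c L.scale_scale[OF sin] sgn_bit_simps)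
  qed
qed

text \<open>
  The lift permutes the sections of the framing.  It is continuous since each copy of \<open>P\<close> is
  embedded in \<open>M\<close> as a closed set, and over this set the base point and the coefficient depend
  continuously on the vector.
\<close>

lemma lift_of_frame:
  fixes L :: "('e, 'm) vbundle"
  assumes L: "line_bundle_over M L" and s: "frame L s \<epsilon>"
  obtains A where "lifts_action a L A" "equivariant_frame A s"
proof -
  interpret L: line_bundle L using L by (simp add: line_bundle_over_def line_bundle_def)
  have base: "vb_base L = M" using L by (simp add: line_bundle_over_def)
  let ?E = "vb_total L"
  have sc: "continuous_map (top_of_set P) ?E (s g)" for g using s unfolding frame_def by blast
  have sn: "s g x \<in> nonzero_vectors L" and sp: "vb_proj L (s g x) = q (g, x)" if "x \<in> P" for g x
    using s that unfolding frame_def by blast+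
  have sin: "s g x \<in> topspace ?E" if "x \<in> P" for g x using sn[OF that] L.nonzero_in by blast
  define rep where "rep v = (SOME z. snd z \<in> P \<and> q z = vb_proj L v)" for v
  define A where "A h v = vb_scale L (ratio L v (s (fst (rep v)) (snd (rep v))))
      (s (\<psi> h + fst (rep v)) (snd (rep v)))" for h v
  have Ascale: "A h (vb_scale L r (s g x)) = vb_scale L r (s (\<psi> h + g) x)" if x: "x \<in> P" for h r g x
  proof -
    let ?v = "vb_scale L r (s g x)"
    define g' x' where "g' = fst (rep ?v)" and "x' = snd (rep ?v)"
    have "\<exists>z. snd z \<in> P \<and> q z = vb_proj L ?v" using x sin sp by (intro exI[of _ "(g, x)"]) simp
    from someI_ex[OF this] have r': "x' \<in> P" "q (g', x') = q (g, x)"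
      using x sin sp unfolding rep_def[symmetric] g'_def x'_def by simp_all
    then have xx: "x' = x" and d: "g + g' \<in> iso x" using kernel[OF r'(1) x] by (auto simp: iso_def add.commute)
    obtain b where b: "\<And>k. s (k + (g + g')) x = vb_scale L (sgn_bit b) (s k x)"
      using frame_transition[OF L s x d] by blast
    have 1: "s g' x = vb_scale L (sgn_bit b) (s g x)" using b[of g] by (simp add: add.assoc)
    have 2: "s (\<psi> h + g') x = vb_scale L (sgn_bit b) (s (\<psi> h + g) x)"
      using b[of "\<psi> h + g"] by (simp add: add.assoc)
    have "?v = vb_scale L (r * sgn_bit b) (s g' x)"
      unfolding 1 by (simp add: L.scale_scale sin x mult.assoc)
    then have "ratio L ?v (s g' x) = r * sgn_bit b" using L.ratio_scale sn x by metis
    then show ?thesis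
      unfolding A_def g'_def[symmetric] x'_def[symmetric] xx 2
      by (simp add: L.scale_scale sin x mult.assoc)
  qed
  have repr: "\<exists>g x. x \<in> P \<and> vb_proj L v = q (g, x) \<and> (\<exists>r. v = vb_scale L r (s g x))" if v: "v \<in> topspace ?E" for v
  proof -
    have "vb_proj L v \<in> topspace M" using L.proj_in[OF v] base by simp
    then obtain g x where "x \<in> P" "q (g, x) = vb_proj L v" by (rule surjE)
    then show ?thesis using L.ex_scale[OF v sn] sp by metis
  qed
  have "continuous_map ?E ?E (A h)" for h
  proof (rule pasting_lemma_closed[where I = UNIV and
        T = "\<lambda>g. {v \<in> topspace ?E. vb_proj L v \<in> q ` ({g} \<times> P)}" and f = "\<lambda>_. A h"])
    fix g
    have cl: "closedin M (q ` ({g} \<times> P))"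
    proof -
      have "closedin X ({g} \<times> P)" by (simp add: closedin_prod_Times_iff)
      then show ?thesis using closed_map_q unfolding closed_map_def by blast
    qed
    let ?Y = "subtopology ?E {v \<in> topspace ?E. vb_proj L v \<in> q ` ({g} \<times> P)}"
    show "closedin ?E {v \<in> topspace ?E. vb_proj L v \<in> q ` ({g} \<times> P)}"
      using closedin_continuous_map_preimage[OF L.continuous_proj] cl base by simp
    let ?q = "\<lambda>x. q (g, x)"
    have img: "?q ` P = q ` ({g} \<times> P)" by auto
    have "inj_on ?q P" using kernel by (auto intro: inj_onI)
    moreover have "closed_map (top_of_set P) M ?q"
      using continuous_imp_closed_map[OF continuous_sheet[of g] _ Hausdorff_M]
        polygon_compact[OF polygon] by (simp add: compact_space_subtopology)
    ultimately have "embedding_map (top_of_set P) M ?q"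
      using continuous_sheet[of g] by (intro injective_closed_imp_embedding_map) auto
    then obtain k where "homeomorphic_maps (top_of_set P) (subtopology M (q ` ({g} \<times> P))) ?q k"
      unfolding embedding_map_def homeomorphic_map_maps by (auto simp: img)
    then have kc: "continuous_map (subtopology M (q ` ({g} \<times> P))) (top_of_set P) k"
      and kq: "\<And>x. x \<in> P \<Longrightarrow> k (q (g, x)) = x"
      unfolding homeomorphic_maps_def by auto
    have "continuous_map ?Y (subtopology M (q ` ({g} \<times> P))) (vb_proj L)"
      using L.continuous_proj unfolding base
      by (auto simp: continuous_map_in_subtopology continuous_map_from_subtopology)
    from continuous_map_compose[OF this kc]
    have kc': "continuous_map ?Y (top_of_set P) (\<lambda>v. k (vb_proj L v))" by (simp add: o_def)
    have sc': "continuous_map ?Y ?E (\<lambda>v. s g' (k (vb_proj L v)))" for g'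
      using continuous_map_compose[OF kc' sc] by (simp add: o_def)
    have pk: "\<exists>x\<in>P. vb_proj L v = q (g, x) \<and> k (vb_proj L v) = x" if "v \<in> topspace ?Y" for v
      using that kq by auto
    have "continuous_map ?Y ?E (\<lambda>v. vb_scale L (ratio L v (s g (k (vb_proj L v)))) (s (\<psi> h + g) (k (vb_proj L v))))"
    proof (intro L.continuous_scale sc' L.continuous_ratio)
      show "continuous_map ?Y ?E (\<lambda>v. v)" by (simp add: continuous_map_from_subtopology)
    qed (use pk sp sn in fastforce)+
    then show "continuous_map ?Y ?E (A h)"
    proof (rule continuous_map_eq)
      fix v assume v: "v \<in> topspace ?Y"
      then obtain x where x: "x \<in> P" "vb_proj L v = q (g, x)" "k (vb_proj L v) = x" using pk by blast
      have "vb_scale L (ratio L v (s g x)) (s g x) = v"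
        using v x sp sn by (intro L.scale_ratio) auto
      then show "vb_scale L (ratio L v (s g (k (vb_proj L v)))) (s (\<psi> h + g) (k (vb_proj L v))) = A h v"
        using Ascale[OF x(1), of h "ratio L v (s g x)" g] x(3) by simp
    qed
  next
    fix v assume "v \<in> topspace ?E"
    then obtain g x where "x \<in> P" "vb_proj L v = q (g, x)" using repr by blast
    then show "\<exists>g. g \<in> UNIV \<and> v \<in> {v \<in> topspace ?E. vb_proj L v \<in> q ` ({g} \<times> P)} \<and> A h v = A h v"
      using \<open>v \<in> topspace ?E\<close> by blast
  qed auto
  moreover have "A 0 v = v" "A (g + h) v = A g (A h v)" "vb_proj L (A g v) = a g (vb_proj L v)"
    "A g (vb_scale L r v) = vb_scale L r (A g v)" if v: "v \<in> topspace ?E" for v g h r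
  proof -
    obtain k x t where k: "x \<in> P" "vb_proj L v = q (k, x)" "v = vb_scale L t (s k x)" using repr[OF v] by blast
    show "A 0 v = v" "A (g + h) v = A g (A h v)" "A g (vb_scale L r v) = vb_scale L r (A g v)"
      unfolding k(3) by (simp_all add: Ascale k(1) \<psi>_add add.assoc L.scale_scale sin)
    show "vb_proj L (A g v) = a g (vb_proj L v)"
      using k(1,2) unfolding k(3) by (simp add: Ascale sin sp action)
  qed
  moreover have "A g (vb_add L v w) = vb_add L (A g v) (A g w)"
    if v: "v \<in> topspace ?E" and w: "w \<in> topspace ?E" and vw: "vb_proj L v = vb_proj L w" for v w g
  proof -
    obtain k x t where k: "x \<in> P" "vb_proj L v = q (k, x)" "v = vb_scale L t (s k x)" using repr[OF v] by blast
    obtain t' where t': "w = vb_scale L t' (s k x)" using L.ex_scale[OF w sn[OF k(1)]] sp[OF k(1)] k(2) vw by metis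
    show ?thesis unfolding k(3) t' by (simp add: L.add_scale sin k(1) Ascale)
  qed
  ultimately have "lifts_action a L A"
    unfolding lifts_action_def group_action_on_def fibrewise_linear_def by blast
  moreover have "equivariant_frame A s"
    unfolding equivariant_frame_def using Ascale[of _ _ 1] by (auto simp: L.scale_one sin)
  ultimately show ?thesis using that by blast
qed

end

section \<open>Every line bundle over a small cover has a framing\<close>

context surface_model
begin

lemma iso_vertex:
  assumes "F \<in> facets P" "G \<in> facets P" "F \<noteq> G" "x \<in> F" "x \<in> G"
  shows "iso x = UNIV"
proof -
  have "v \<in> iso x" for v
  proof -
    have "\<mu> F \<in> iso x" "\<mu> G \<in> iso x" using assms facet_iso by blast+
    moreover from this have "\<mu> F + \<mu> G \<in> iso x" unfolding iso_def by (rule generated_add)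
    moreover have "0 \<in> iso x" unfolding iso_def by (rule subgroup_generated)
    ultimately show ?thesis using base_group_cases[OF characteristic_meet[OF assms], of v] by auto
  qed
  then show ?thesis by auto
qed

text \<open>
  The sections \<open>t g\<close> trivialize the pullback of \<open>L\<close> to the copies of the polygon.  A function \<open>n\<close>
  as below is the norm of these sections with respect to a fibre metric on \<open>L\<close>, restricted to the
  part of \<open>M\<close> that lies over \<open>S\<close>.
\<close>

definition norm_on :: "('e, 'm) vbundle \<Rightarrow> (base_group \<Rightarrow> plane \<Rightarrow> 'e) \<Rightarrow> plane set
    \<Rightarrow> (base_group \<Rightarrow> plane \<Rightarrow> real) \<Rightarrow> bool" where
  "norm_on L t S n \<longleftrightarrow> (\<forall>g. continuous_on S (n g)) \<and> (\<forall>g. \<forall>x\<in>S. 0 < n g x) \<and>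
     (\<forall>g. \<forall>F\<in>facets P. \<forall>x\<in>F \<inter> S. n (g + \<mu> F) x = \<bar>ratio L (t (g + \<mu> F) x) (t g x)\<bar> * n g x)"

lemma facet_glued: "F \<in> facets P \<Longrightarrow> x \<in> F \<Longrightarrow> q (g + \<mu> F, x) = q (g, x)"
  using kernel'[of x g "\<mu> F"] facet_iso facet_subset by (metis subsetD)

text \<open>
  The absolute value of the coordinate in a chart is a norm.  The chart is chosen for each point
  of \<open>M\<close> over \<open>x0\<close>, so that copies of \<open>P\<close> that are glued at \<open>x0\<close> use the same chart.
\<close>

lemma norm_near:
  fixes L :: "('e, 'm) vbundle"
  assumes L: "line_bundle_over M L"
    and tc: "\<And>g. continuous_map (top_of_set P) (vb_total L) (t g)"
    and tn: "\<And>g x. x \<in> P \<Longrightarrow> t g x \<in> nonzero_vectors L"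
    and tp: "\<And>g x. x \<in> P \<Longrightarrow> vb_proj L (t g x) = q (g, x)"
    and x0: "x0 \<in> P"
  obtains r n where "r > 0" "norm_on L t (P \<inter> cball x0 r) n"
proof -
  interpret L: line_bundle L using L by (simp add: line_bundle_over_def line_bundle_def)
  have base: "vb_base L = M" using L by (simp add: line_bundle_over_def)
  have tin: "t g x \<in> topspace (vb_total L)" if "x \<in> P" for g x using tn[OF that] L.nonzero_in by blast
  have "\<forall>m\<in>topspace M. \<exists>Uc. m \<in> fst Uc \<and> (\<exists>w. chart L (fst Uc) (snd Uc) w)"
  proof
    fix m assume "m \<in> topspace M"
    then obtain U c w where "m \<in> U" "chart L U c w" using L.chart_exists base by metis
    then show "\<exists>Uc. m \<in> fst Uc \<and> (\<exists>w. chart L (fst Uc) (snd Uc) w)"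
      by (intro exI[of _ "(U, c)"]) auto
  qed
  from bchoice[OF this] obtain Uc where Uc: "\<And>m. m \<in> topspace M \<Longrightarrow> m \<in> fst (Uc m) \<and> (\<exists>w. chart L (fst (Uc m)) (snd (Uc m)) w)"
    by blast
  define U c where "U m = fst (Uc m)" and "c m = snd (Uc m)" for m
  have U: "q (g, x0) \<in> U (q (g, x0))" "\<exists>w. chart L (U (q (g, x0))) (c (q (g, x0))) w" for g
    using Uc[OF sheet_in[OF x0]] by (auto simp: U_def c_def)
  define V where "V g = {x \<in> P. q (g, x) \<in> U (q (g, x0))}" for g
  have opV: "openin (top_of_set P) (V g)" for g
  proof -
    have "openin M (U (q (g, x0)))" using U(2)[of g] base unfolding chart_def by blast
    from openin_continuous_map_preimage[OF continuous_sheet this]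
    show ?thesis by (simp add: V_def)
  qed
  define Z where "Z = \<Union>{F \<in> facets P. x0 \<notin> F}"
  have "closed Z"
    unfolding Z_def using finite_facets[OF polygon] facet_closed[OF polygon] by (intro closed_Union) auto
  then have opZ: "openin (top_of_set P) (P - Z)"
    by (metis Diff_eq open_Compl openin_open_Int)
  define W where "W = (P - Z) \<inter> (\<Inter>g. V g)"
  have opW: "openin (top_of_set P) W"
    unfolding W_def using opV opZ by (intro openin_Int openin_INT2) auto
  moreover have "x0 \<in> W" using x0 U(1) by (auto simp: W_def Z_def V_def)
  ultimately obtain r where r: "r > 0" "cball x0 r \<inter> P \<subseteq> W"
    using openin_contains_cball[of P W] by blast
  let ?S = "P \<inter> cball x0 r"
  have SW: "x \<in> W" if "x \<in> ?S" for x using r that by blast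
  define n where "n g x = \<bar>c (q (g, x0)) (t g x)\<bar>" for g x
  have inU: "vb_proj L (t g x) \<in> U (q (g, x0))" if "x \<in> ?S" for g x
    using SW[OF that] that tp by (auto simp: W_def V_def)
  have "norm_on L t ?S n"
    unfolding norm_on_def
  proof (intro conjI allI ballI)
    fix g
    obtain w where w: "chart L (U (q (g, x0))) (c (q (g, x0))) w" using U(2) by blast
    have "continuous_map (top_of_set ?S) (vb_total L) (t g)"
      by (rule continuous_map_from_subtopology_mono[OF tc]) auto
    then have "continuous_map (top_of_set ?S) euclideanreal (\<lambda>x. c (q (g, x0)) (t g x))"
      by (rule L.chart_continuous[OF w]) (use inU in auto)
    then show "continuous_on ?S (n g)"
      unfolding n_def by (intro continuous_on_rabs) simp
    fix x
    show "0 < n g x" if "x \<in> ?S"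
      using L.chart_nonzero[OF w tin inU[OF that]] tn that by (auto simp: n_def)
    fix F assume F: "F \<in> facets P" and x: "x \<in> F \<inter> ?S"
    have "x0 \<in> F" using SW[of x] x F by (auto simp: W_def Z_def)
    then have eq: "q (g + \<mu> F, x0) = q (g, x0)" using facet_glued F by blast
    have xP: "x \<in> P" using x by blast
    have "vb_proj L (t (g + \<mu> F) x) = vb_proj L (t g x)"
      using tp[OF xP] facet_glued[OF F, of x g] x by simp
    then have "t (g + \<mu> F) x = vb_scale L (ratio L (t (g + \<mu> F) x) (t g x)) (t g x)"
      using L.scale_ratio[OF tin[OF xP] tn[OF xP]] by metis
    then have "c (q (g, x0)) (t (g + \<mu> F) x) = ratio L (t (g + \<mu> F) x) (t g x) * c (q (g, x0)) (t g x)"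
      using L.chart_scale[OF w tin[OF xP] inU] x by (metis IntD2)
    then show "n (g + \<mu> F) x = \<bar>ratio L (t (g + \<mu> F) x) (t g x)\<bar> * n g x"
      unfolding n_def eq by (simp add: abs_mult)
  qed
  then show ?thesis using that r(1) by blast
qed

text \<open>
  Local norms are combined with weights that are functions on \<open>P\<close>, so that the weights of
  corresponding points in all copies of \<open>P\<close> agree.
\<close>

lemma norm_exists:
  fixes L :: "('e, 'm) vbundle"
  assumes L: "line_bundle_over M L"
    and tc: "\<And>g. continuous_map (top_of_set P) (vb_total L) (t g)"
    and tn: "\<And>g x. x \<in> P \<Longrightarrow> t g x \<in> nonzero_vectors L"
    and tp: "\<And>g x. x \<in> P \<Longrightarrow> vb_proj L (t g x) = q (g, x)"
  obtains n where "norm_on L t P n"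
proof -
  have "\<forall>x\<in>P. \<exists>rn. fst rn > 0 \<and> norm_on L t (P \<inter> cball x (fst rn)) (snd rn)"
  proof
    fix x assume "x \<in> P"
    then obtain r n where "r > 0" "norm_on L t (P \<inter> cball x r) n"
      using norm_near[OF L tc tn tp] by blast
    then show "\<exists>rn. fst rn > 0 \<and> norm_on L t (P \<inter> cball x (fst rn)) (snd rn)"
      by (intro exI[of _ "(r, n)"]) auto
  qed
  from bchoice[OF this] obtain rn where rn: "\<And>x. x \<in> P \<Longrightarrow> fst (rn x) > 0 \<and> norm_on L t (P \<inter> cball x (fst (rn x))) (snd (rn x))"
    by blast
  define r n where "r x = fst (rn x)" and "n x = snd (rn x)" for x
  have r: "r x > 0" and n: "norm_on L t (P \<inter> cball x (r x)) (n x)" if "x \<in> P" for x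
    using rn[OF that] by (auto simp: r_def n_def)
  have "P \<subseteq> (\<Union>x\<in>P. ball x (r x))" using r by force
  then obtain K where K: "K \<subseteq> P" "finite K" "P \<subseteq> (\<Union>x\<in>K. ball x (r x))"
    using compactE_image[OF polygon_compact[OF polygon], of P "\<lambda>x. ball x (r x)"] by auto
  define \<phi> where "\<phi> x y = max 0 (r x - dist x y)" for x y
  define N where "N g y = (\<Sum>x\<in>K. \<phi> x y * n x g y)" for g y
  have \<phi>0: "\<phi> x y = 0 \<or> y \<in> cball x (r x)" for x y by (auto simp: \<phi>_def)
  have "norm_on L t P N"
    unfolding norm_on_def
  proof (intro conjI allI ballI)
    fix g
    show "continuous_on P (N g)"
      unfolding N_def
    proof (rule continuous_on_sum)
      fix x assume "x \<in> K"
      then have x: "x \<in> P" using K by blast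
      let ?S = "P \<inter> cball x (r x)" and ?T = "P \<inter> {y. r x \<le> dist x y}"
      have "continuous_on ?S (n x g)" using n[OF x] unfolding norm_on_def by blast
      then have "continuous_on ?S (\<lambda>y. \<phi> x y * n x g y)"
        unfolding \<phi>_def by (intro continuous_intros)
      moreover have "continuous_on ?T (\<lambda>y. \<phi> x y * n x g y)"
        by (rule continuous_on_eq[OF continuous_on_const[of _ 0]]) (auto simp: \<phi>_def)
      moreover have "closed ?S" "closed ?T"
        using compact_imp_closed[OF polygon_compact[OF polygon]]
        by (auto intro!: closed_Int closed_Collect_le continuous_intros)
      ultimately have "continuous_on (?S \<union> ?T) (\<lambda>y. \<phi> x y * n x g y)"
        using continuous_on_closed_Un by blast
      moreover have "?S \<union> ?T = P" by auto
      ultimately show "continuous_on P (\<lambda>y. \<phi> x y * n x g y)" by simp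
    qed
    fix y
    show "0 < N g y" if y: "y \<in> P"
    proof -
      obtain x where x: "x \<in> K" "y \<in> ball x (r x)" using K y by blast
      have pos: "0 < n z g y" if "z \<in> K" "y \<in> cball z (r z)" for z
        using n[of z] K that y unfolding norm_on_def by blast
      show ?thesis
        unfolding N_def
      proof (rule sum_pos2[OF K(2) x(1)])
        show "0 < \<phi> x y * n x g y" using x pos[of x] by (auto simp: \<phi>_def)
        show "0 \<le> \<phi> z y * n z g y" if "z \<in> K" for z
          using \<phi>0[of z y] pos[OF that] by (auto simp: \<phi>_def)
      qed
    qed
    fix F assume F: "F \<in> facets P" and y: "y \<in> F \<inter> P"
    have "\<phi> x y * n x (g + \<mu> F) y = \<bar>ratio L (t (g + \<mu> F) y) (t g y)\<bar> * (\<phi> x y * n x g y)" if x: "x \<in> K" for x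
    proof (cases "\<phi> x y = 0")
      case False
      then have "y \<in> F \<inter> (P \<inter> cball x (r x))" using \<phi>0[of x y] y by blast
      then have "n x (g + \<mu> F) y = \<bar>ratio L (t (g + \<mu> F) y) (t g y)\<bar> * n x g y"
        using n[of x] K x F unfolding norm_on_def by blast
      then show ?thesis by simp
    qed simp
    then show "N (g + \<mu> F) y = \<bar>ratio L (t (g + \<mu> F) y) (t g y)\<bar> * N g y"
      unfolding N_def sum_distrib_left by (intro sum.cong) auto
  qed
  then show ?thesis using that by blast
qed

text \<open>
  Two unit vectors on a line agree up to sign, and the sign is constant along an edge because the
  edge is connected.  At this stage it may still depend on the copy \<open>g\<close>.
\<close>

lemma unit_sections:
  fixes L :: "('e, 'm) vbundle"
  assumes L: "line_bundle_over M L"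
  obtains u e where "\<And>g. continuous_map (top_of_set P) (vb_total L) (u g)"
    "\<And>g x. x \<in> P \<Longrightarrow> u g x \<in> nonzero_vectors L" "\<And>g x. x \<in> P \<Longrightarrow> vb_proj L (u g x) = q (g, x)"
    "\<And>g F x. F \<in> facets P \<Longrightarrow> x \<in> F \<Longrightarrow> u (g + \<mu> F) x = vb_scale L (sgn_bit (e g F)) (u g x)"
proof -
  interpret L: line_bundle L using L by (simp add: line_bundle_over_def line_bundle_def)
  have base: "vb_base L = M" using L by (simp add: line_bundle_over_def)
  have "\<exists>s. L.section_over (\<lambda>x. q (g, x)) P s" for g
    using L.section_over_convex[OF polygon_convex[OF polygon] polygon_compact[OF polygon]]
      continuous_sheet[of g] base by simp
  then obtain t where t: "\<And>g. L.section_over (\<lambda>x. q (g, x)) P (t g)" by metis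
  have tc: "continuous_map (top_of_set P) (vb_total L) (t g)" for g
    using t unfolding L.section_over_def by blast
  have tn: "t g x \<in> nonzero_vectors L" and tp: "vb_proj L (t g x) = q (g, x)" if "x \<in> P" for g x
    using t that unfolding L.section_over_def by blast+
  have tin: "t g x \<in> topspace (vb_total L)" if "x \<in> P" for g x using tn[OF that] L.nonzero_in by blast
  obtain n where n: "norm_on L t P n" using norm_exists[OF L tc tn tp] .
  have npos: "0 < n g x" if "x \<in> P" for g x using n that unfolding norm_on_def by blast
  have nc: "continuous_on P (n g)" for g using n unfolding norm_on_def by blast
  define u where "u g x = vb_scale L (1 / n g x) (t g x)" for g x
  have uc: "continuous_map (top_of_set P) (vb_total L) (u g)" for g
  proof -
    have "continuous_on P (\<lambda>x. 1 / n g x)"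
      using nc npos by (intro continuous_intros) (auto simp: less_imp_neq[symmetric])
    then show ?thesis unfolding u_def by (intro L.continuous_scale tc) simp
  qed
  have un: "u g x \<in> nonzero_vectors L" and up: "vb_proj L (u g x) = q (g, x)" if "x \<in> P" for g x
    using npos[OF that, of g] that by (auto simp: u_def L.nonzero_scale tn tp tin)
  have uin: "u g x \<in> topspace (vb_total L)" if "x \<in> P" for g x using un[OF that] L.nonzero_in by blast
  have "\<exists>b. \<forall>x\<in>F. u (g + \<mu> F) x = vb_scale L (sgn_bit b) (u g x)" if F: "F \<in> facets P" for g F
  proof -
    have FP: "F \<subseteq> P" using facet_subset[OF F] .
    define c where "c x = ratio L (u (g + \<mu> F) x) (u g x)" for x
    have proj: "vb_proj L (u (g + \<mu> F) x) = vb_proj L (u g x)"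
      "vb_proj L (t (g + \<mu> F) x) = vb_proj L (t g x)" if "x \<in> F" for x
      using facet_glued[OF F that] that FP by (auto simp: up tp subset_iff)
    have eq: "u (g + \<mu> F) x = vb_scale L (c x) (u g x)" if x: "x \<in> F" for x
      unfolding c_def using x FP by (intro L.scale_ratio[symmetric] uin un proj) auto
    have "\<bar>c x\<bar> = 1" if x: "x \<in> F" for x
    proof -
      have xP: "x \<in> P" using x FP by blast
      define \<rho> where "\<rho> = ratio L (t (g + \<mu> F) x) (t g x)"
      have \<rho>: "\<rho> \<noteq> 0" unfolding \<rho>_def using xP proj(2)[OF x] by (intro L.ratio_nonzero tn)
      have nn: "n (g + \<mu> F) x = \<bar>\<rho>\<bar> * n g x"
        using n F x xP unfolding norm_on_def \<rho>_def by blast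
      have "t (g + \<mu> F) x = vb_scale L \<rho> (t g x)"
        unfolding \<rho>_def using xP proj(2)[OF x] by (intro L.scale_ratio[symmetric] tin tn)
      then have "u (g + \<mu> F) x = vb_scale L (\<rho> / (\<bar>\<rho>\<bar> * n g x)) (t g x)"
        unfolding u_def nn by (simp add: L.scale_scale tin xP)
      also have "\<dots> = vb_scale L (\<rho> / \<bar>\<rho>\<bar>) (u g x)"
        unfolding u_def by (simp add: L.scale_scale tin xP)
      finally have "c x = \<rho> / \<bar>\<rho>\<bar>" unfolding c_def using un xP by (simp add: L.ratio_scale)
      then show ?thesis using \<rho> by simp
    qed
    moreover have "continuous_map (top_of_set F) euclideanreal c"
      unfolding c_def
    proof (rule L.continuous_ratio)
      show "continuous_map (top_of_set F) (vb_total L) (u h)" for h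
        by (rule continuous_map_from_subtopology_mono[OF uc FP])
      show "continuous_map (top_of_set F) (vb_total L) (u g)"
        by (rule continuous_map_from_subtopology_mono[OF uc FP])
    qed (use FP proj un in auto)
    then have "continuous_on F c" by simp
    moreover have "connected F" using facet_convex[OF polygon F] convex_connected by blast
    ultimately obtain b where "\<And>x. x \<in> F \<Longrightarrow> c x = sgn_bit b" using constant_sign by blast
    then show ?thesis using eq by metis
  qed
  then have "\<forall>g F. \<exists>b. F \<in> facets P \<longrightarrow> (\<forall>x\<in>F. u (g + \<mu> F) x = vb_scale L (sgn_bit b) (u g x))" by metis
  then obtain e where "\<And>g F. F \<in> facets P \<Longrightarrow> (\<forall>x\<in>F. u (g + \<mu> F) x = vb_scale L (sgn_bit (e g F)) (u g x))"
    by metis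
  then show ?thesis using that uc un up by metis
qed

text \<open>
  Normalizing the signs of the unit sections at a vertex makes the signs along one edge through
  that vertex trivial.  Going around the vertex that \<open>F\<close> shares with a neighbouring edge \<open>G\<close> shows
  that the sign along \<open>G\<close> is the same for all copies if the one along \<open>F\<close> is, and every edge is
  reached in this way.
\<close>

lemma frame_exists:
  fixes L :: "('e, 'm) vbundle"
  assumes L: "line_bundle_over M L"
  obtains s \<epsilon> where "frame L s \<epsilon>"
proof -
  interpret L: line_bundle L using L by (simp add: line_bundle_over_def line_bundle_def)
  obtain u e where uc: "\<And>g. continuous_map (top_of_set P) (vb_total L) (u g)"
    and un: "\<And>g x. x \<in> P \<Longrightarrow> u g x \<in> nonzero_vectors L"
    and up: "\<And>g x. x \<in> P \<Longrightarrow> vb_proj L (u g x) = q (g, x)"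
    and ue: "\<And>g F x. F \<in> facets P \<Longrightarrow> x \<in> F \<Longrightarrow> u (g + \<mu> F) x = vb_scale L (sgn_bit (e g F)) (u g x)"
    using unit_sections[OF L] by blast
  have uin: "u g x \<in> topspace (vb_total L)" if "x \<in> P" for g x using un[OF that] L.nonzero_in by blast
  obtain F1 F2 x0 where v: "F1 \<in> facets P" "F2 \<in> facets P" "F1 \<noteq> F2" "x0 \<in> F1" "x0 \<in> F2"
    using vertex_exists[OF polygon] .
  have x0: "x0 \<in> P" using v facet_subset by blast
  have "\<exists>b. u d x0 = vb_scale L (sgn_bit b) (u 0 x0)" for d
  proof -
    have "\<forall>g. \<exists>b. u (g + d) x0 = vb_scale L (sgn_bit b) (u g x0)" if "d \<in> iso x0" for d
      using that unfolding iso_def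
    proof (induction rule: generated_induct)
      case (generator d)
      then show ?case using ue by blast
    next
      case zero
      show ?case by (intro allI exI[of _ 0]) (simp add: L.scale_one uin x0)
    next
      case (diff d e)
      show ?case
      proof
        fix g
        have eq: "g + (d - e) = g + d + e" by (metis add.assoc bit_vec_uminus diff_conv_add_uminus)
        obtain b where b: "u (g + d) x0 = vb_scale L (sgn_bit b) (u g x0)" using diff by blast
        obtain c where c: "u (g + d + e) x0 = vb_scale L (sgn_bit c) (u (g + d) x0)" using diff by blast
        show "\<exists>b. u (g + (d - e)) x0 = vb_scale L (sgn_bit b) (u g x0)"
          by (rule exI[of _ "c + b"]) (simp only: eq b c L.scale_scale[OF uin[OF x0]] sgn_bit_simps)
      qed
    qed
    from this[of d] have "\<exists>b. u (0 + d) x0 = vb_scale L (sgn_bit b) (u 0 x0)"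
      using iso_vertex[OF v] by blast
    then show ?thesis by simp
  qed
  then obtain \<delta> where \<delta>: "\<And>g. u g x0 = vb_scale L (sgn_bit (\<delta> g)) (u 0 x0)" by metis
  define s where "s g x = vb_scale L (sgn_bit (\<delta> g)) (u g x)" for g x
  define \<epsilon> where "\<epsilon> g F = e g F + \<delta> g + \<delta> (g + \<mu> F)" for g F
  have sn: "s g x \<in> nonzero_vectors L" and sp: "vb_proj L (s g x) = q (g, x)" if "x \<in> P" for g x
    using that by (simp_all add: s_def L.nonzero_scale un up uin)
  have sin: "s g x \<in> topspace (vb_total L)" if "x \<in> P" for g x using sn[OF that] L.nonzero_in by blast
  have sc: "continuous_map (top_of_set P) (vb_total L) (s g)" for g
    unfolding s_def by (intro L.continuous_scale uc) simp
  have s0: "s g x0 = u 0 x0" for g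
    unfolding s_def \<delta>[of g] by (simp only: L.scale_scale[OF uin[OF x0]] sgn_bit_simps L.scale_one[OF uin[OF x0]])
  have s\<epsilon>: "s (g + \<mu> F) x = vb_scale L (sgn_bit (\<epsilon> g F)) (s g x)" if F: "F \<in> facets P" "x \<in> F" for g F x
  proof -
    have x: "x \<in> P" using F facet_subset by blast
    have eq: "\<delta> (g + \<mu> F) + e g F = \<epsilon> g F + \<delta> g"
      by (cases "\<delta> g"; cases "\<delta> (g + \<mu> F)"; cases "e g F") (simp_all add: \<epsilon>_def)
    have "s (g + \<mu> F) x = vb_scale L (sgn_bit (\<delta> (g + \<mu> F) + e g F)) (u g x)"
      unfolding s_def ue[OF F] by (simp only: L.scale_scale[OF uin[OF x]] sgn_bit_simps)
    also have "\<dots> = vb_scale L (sgn_bit (\<epsilon> g F)) (s g x)"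
      unfolding eq s_def by (simp only: L.scale_scale[OF uin[OF x]] sgn_bit_simps)
    finally show ?thesis .
  qed
  have cancel: "b = c" if "vb_scale L (sgn_bit b) (s g x) = vb_scale L (sgn_bit c) (s g x)" "x \<in> P" for b c g x
    using that L.scale_cancel[OF sn[OF that(2)]] sgn_bit_inj by blast
  define A where "A = {F \<in> facets P. \<forall>g. \<epsilon> g F = \<epsilon> 0 F}"
  have "A = facets P"
  proof (rule facets_connected[OF polygon])
    have "\<epsilon> g F1 = 0" for g
    proof (rule cancel[of _ g x0, OF _ x0])
      show "vb_scale L (sgn_bit (\<epsilon> g F1)) (s g x0) = vb_scale L (sgn_bit 0) (s g x0)"
        unfolding s\<epsilon>[OF v(1,4), symmetric] by (simp add: s0 L.scale_one uin x0)
    qed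
    then show "A \<noteq> {}" using v(1) by (auto simp: A_def)
    fix F G assume F: "F \<in> A" and G: "G \<in> facets P" and FG: "F \<inter> G \<noteq> {}"
    show "G \<in> A"
    proof (cases "F = G")
      case False
      obtain x where x: "x \<in> F" "x \<in> G" using FG by blast
      have F': "F \<in> facets P" and F\<epsilon>: "\<epsilon> g F = \<epsilon> 0 F" for g using F by (auto simp: A_def)
      have xP: "x \<in> P" using x(1) facet_subset[OF F'] by blast
      have 1: "\<epsilon> (g + \<mu> F) G = \<epsilon> g G" for g
      proof -
        have "s (g + \<mu> F + \<mu> G) x = s (g + \<mu> G + \<mu> F) x" by (simp add: add_ac)
        then have "vb_scale L (sgn_bit (\<epsilon> (g + \<mu> F) G + \<epsilon> 0 F)) (s g x) = vb_scale L (sgn_bit (\<epsilon> 0 F + \<epsilon> g G)) (s g x)"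
          by (simp only: s\<epsilon>[OF G x(2)] s\<epsilon>[OF F' x(1)] F\<epsilon>[of g] F\<epsilon>[of "g + \<mu> G"] L.scale_scale[OF sin[OF xP]] sgn_bit_simps)
        then have "\<epsilon> (g + \<mu> F) G + \<epsilon> 0 F = \<epsilon> 0 F + \<epsilon> g G" by (rule cancel[OF _ xP])
        then show ?thesis by (metis add.commute add_left_cancel)
      qed
      have 2: "\<epsilon> (g + \<mu> G) G = \<epsilon> g G" for g
      proof -
        have "s (g + \<mu> G + \<mu> G) x = vb_scale L (sgn_bit 0) (s g x)"
          by (simp add: add.assoc L.scale_one sin xP)
        then have "vb_scale L (sgn_bit (\<epsilon> (g + \<mu> G) G + \<epsilon> g G)) (s g x) = vb_scale L (sgn_bit 0) (s g x)"
          by (simp only: s\<epsilon>[OF G x(2)] L.scale_scale[OF sin[OF xP]] sgn_bit_simps)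
        then have "\<epsilon> (g + \<mu> G) G + \<epsilon> g G = 0" by (rule cancel[OF _ xP])
        then show ?thesis by (cases "\<epsilon> g G") auto
      qed
      have "\<epsilon> g G = \<epsilon> 0 G" for g
        using base_group_cases[OF characteristic_meet[OF F' G False x], of g]
          1[of 0] 2[of 0] 2[of "\<mu> F"] by (elim disjE) simp_all
      then show ?thesis using G by (simp add: A_def)
    qed (use F in simp)
  qed (auto simp: A_def)
  then have const: "\<epsilon> g F = \<epsilon> 0 F" if "F \<in> facets P" for g F using that unfolding A_def by blast
  have "frame L s (\<epsilon> 0)"
    unfolding frame_def
  proof (intro conjI allI ballI)
    fix g F x assume F: "F \<in> facets P" "x \<in> F"
    show "s (g + \<mu> F) x = vb_scale L (sgn_bit (\<epsilon> 0 F)) (s g x)"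
      using s\<epsilon>[OF F, of g] const[OF F(1), of g] by simp
  qed (use sc sn sp in auto)
  then show ?thesis using that by blast
qed

end

section \<open>The projectivization of a framed sum of line bundles\<close>

lemma bundle_group_add: "z \<in> bundle_group k \<Longrightarrow> w \<in> bundle_group k \<Longrightarrow> z + w \<in> bundle_group k"
  by (auto simp: bundle_group_def)

lemma bundle_element_add_self [simp]: "(z :: base_group \<times> (nat \<Rightarrow> bit)) + z = 0"
  by (simp add: prod_eq_iff fun_eq_iff)

lemma bundle_element_uminus [simp]: "- (z :: base_group \<times> (nat \<Rightarrow> bit)) = z"
  by (metis add_eq_0_iff bundle_element_add_self)

lemma bundle_element_diff: "(z :: base_group \<times> (nat \<Rightarrow> bit)) - w = z + w"
  by (metis bundle_element_uminus diff_conv_add_uminus)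

lemma finite_bundle_group: "finite (bundle_group k)"
proof -
  have "finite {s :: nat \<Rightarrow> bit. \<forall>i. (i \<in> {..<k - 1} \<longrightarrow> s i \<in> UNIV) \<and> (i \<notin> {..<k - 1} \<longrightarrow> s i = 0)}"
    by (rule finite_set_of_finite_funs) auto
  then have "finite {s :: nat \<Rightarrow> bit. \<forall>i\<ge>k - 1. s i = 0}"
    by (rule rev_finite_subset) auto
  then have "finite ((UNIV :: base_group set) \<times> {s :: nat \<Rightarrow> bit. \<forall>i\<ge>k - 1. s i = 0})" by simp
  then show ?thesis by (rule rev_finite_subset) (auto simp: bundle_group_def)
qed

lemma glued_action_glue_class:
  assumes G: "\<And>x y. x \<in> G \<Longrightarrow> y \<in> G \<Longrightarrow> x + y \<in> G" "\<And>x. x \<in> G \<Longrightarrow> - x \<in> G" and g: "g \<in> G"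
  shows "glued_action g (glue_class G C (t, x)) = glue_class G C (g + t, x)"
proof (intro equalityI subsetI)
  fix z assume "z \<in> glued_action g (glue_class G C (t, x))"
  then obtain t' where t': "z = (g + t', x)" "t' \<in> G" "- t + t' \<in> isotropy_at C x"
    by (auto simp: glued_action_def glue_class_def)
  moreover have "- (g + t) + (g + t') = - t + t'"
    by (simp only: minus_add add.assoc minus_add_cancel)
  ultimately show "z \<in> glue_class G C (g + t, x)"
    using G(1)[OF g] t' by (simp add: glue_class_def)
next
  fix z assume "z \<in> glue_class G C (g + t, x)"
  then obtain t' where t': "z = (t', x)" "t' \<in> G" "- (g + t) + t' \<in> isotropy_at C x"
    by (auto simp: glue_class_def)
  moreover have "- (g + t) + t' = - t + (- g + t')" by (simp only: minus_add add.assoc)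
  ultimately have "(- g + t', x) \<in> glue_class G C (t, x)"
    using G(1)[OF G(2)[OF g]] t' by (simp add: glue_class_def)
  then have "(g + (- g + t'), x) \<in> glued_action g (glue_class G C (t, x))"
    unfolding glued_action_def by force
  then show "z \<in> glued_action g (glue_class G C (t, x))" using t' by (simp only: add_minus_cancel)
qed

locale framed_sum = surface_model P \<mu> M a \<psi> q
  for P \<mu> and M :: "'m topology" and a \<psi> q +
  fixes k :: nat and L :: "nat \<Rightarrow> ('e, 'm) vbundle"
    and s :: "nat \<Rightarrow> base_group \<Rightarrow> plane \<Rightarrow> 'e" and \<epsilon> :: "nat \<Rightarrow> plane set \<Rightarrow> bit"
  assumes k: "k \<ge> 1"
    and L: "\<And>i. i < k \<Longrightarrow> line_bundle_over M (L i)"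
    and s: "\<And>i. i < k \<Longrightarrow> frame (L i) (s i) (\<epsilon> i)"
begin

abbreviation "W \<equiv> whitney_sum M k L"
abbreviation "G \<equiv> bundle_group k"
abbreviation "\<Delta> \<equiv> standard_simplex (k - 1)"
abbreviation "Q \<equiv> prod_topology (top_of_set P) (subtopology (powertop_real UNIV) \<Delta>)"
abbreviation "Z \<equiv> prod_topology (discrete_topology G) Q"
abbreviation "N \<equiv> subtopology (vb_total W) (nonzero_vectors W)"

lemma lb: "i < k \<Longrightarrow> line_bundle (L i)" and base: "i < k \<Longrightarrow> vb_base (L i) = M"
  using L by (simp_all add: line_bundle_over_def line_bundle_def)

lemma sc: "i < k \<Longrightarrow> continuous_map (top_of_set P) (vb_total (L i)) (s i g)"
  and sn: "i < k \<Longrightarrow> x \<in> P \<Longrightarrow> s i g x \<in> nonzero_vectors (L i)"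
  and sp: "i < k \<Longrightarrow> x \<in> P \<Longrightarrow> vb_proj (L i) (s i g x) = q (g, x)"
  and s\<epsilon>: "i < k \<Longrightarrow> F \<in> facets P \<Longrightarrow> x \<in> F \<Longrightarrow>
      s i (g + \<mu> F) x = vb_scale (L i) (sgn_bit (\<epsilon> i F)) (s i g x)"
  using s unfolding frame_def by blast+

lemma sin: "i < k \<Longrightarrow> x \<in> P \<Longrightarrow> s i g x \<in> topspace (vb_total (L i))"
  using sn line_bundle.nonzero_in[OF lb] by blast

lemma topspace_W: "v \<in> topspace (vb_total W) \<longleftrightarrow>
    v \<in> (\<Pi>\<^sub>E i\<in>{..<k}. topspace (vb_total (L i))) \<and> (\<forall>i<k. \<forall>j<k. vb_proj (L i) (v i) = vb_proj (L j) (v j))"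
  by (simp add: whitney_sum_def)

lemma scale_W: "vb_scale W c v = (\<lambda>i\<in>{..<k}. vb_scale (L i) c (v i))"
  and proj_W: "vb_proj W v = vb_proj (L 0) (v 0)"
  by (simp_all add: whitney_sum_def)

lemma proj_W':
  assumes v: "v \<in> topspace (vb_total W)" and i: "i < k"
  shows "vb_proj (L i) (v i) = vb_proj W v"
proof -
  have "\<forall>i<k. \<forall>j<k. vb_proj (L i) (v i) = vb_proj (L j) (v j)"
    using v unfolding topspace_W by (rule conjunct2)
  moreover have "0 < k" using k by simp
  ultimately show ?thesis unfolding proj_W using i by blast
qed

lemma W_component:
  assumes v: "v \<in> topspace (vb_total W)" and i: "i < k"
  shows "v i \<in> topspace (vb_total (L i))"
proof -
  have "v \<in> (\<Pi>\<^sub>E i\<in>{..<k}. topspace (vb_total (L i)))"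
    using v unfolding topspace_W by (rule conjunct1)
  then show ?thesis by (rule PiE_mem) (use i in simp)
qed

lemma W_eqI:
  assumes "v \<in> topspace (vb_total W)" "w \<in> topspace (vb_total W)" "\<And>i. i < k \<Longrightarrow> v i = w i"
  shows "v = w"
proof -
  have "u \<in> (\<Pi>\<^sub>E i\<in>{..<k}. topspace (vb_total (L i)))" if "u \<in> topspace (vb_total W)" for u
    using that unfolding topspace_W by (rule conjunct1)
  from this[OF assms(1)] this[OF assms(2)] show ?thesis by (rule PiE_ext) (use assms(3) in simp)
qed

lemma scale_W_in: 
  assumes v: "v \<in> topspace (vb_total W)"
  shows "vb_scale W c v \<in> topspace (vb_total W)"
  unfolding topspace_W
proof (intro conjI allI impI)
  show "vb_scale W c v \<in> (\<Pi>\<^sub>E i\<in>{..<k}. topspace (vb_total (L i)))"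
    unfolding scale_W by (intro restrict_PiE_iff[THEN iffD2] ballI)
      (simp add: line_bundle.scale_in[OF lb] W_component[OF v])
  fix i j assume "i < k" "j < k"
  then show "vb_proj (L i) (vb_scale W c v i) = vb_proj (L j) (vb_scale W c v j)"
    by (simp add: scale_W line_bundle.proj_scale[OF lb] W_component[OF v] proj_W'[OF v])
qed

lemma proj_scale_W: "v \<in> topspace (vb_total W) \<Longrightarrow> vb_proj W (vb_scale W c v) = vb_proj W v"
  using k unfolding proj_W scale_W by (simp add: line_bundle.proj_scale[OF lb] W_component)

lemma scale_scale_W:
  assumes "v \<in> topspace (vb_total W)"
  shows "vb_scale W b (vb_scale W c v) = vb_scale W (b * c) v"
  unfolding scale_W by (auto simp: line_bundle.scale_scale[OF lb] W_component[OF assms])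

lemma scale_one_W:
  assumes "v \<in> topspace (vb_total W)"
  shows "vb_scale W 1 v = v"
  by (rule W_eqI[OF scale_W_in[OF assms] assms])
    (simp add: scale_W line_bundle.scale_one[OF lb] W_component[OF assms])

lemma nonzero_W: "v \<in> nonzero_vectors W \<longleftrightarrow> v \<in> topspace (vb_total W) \<and> (\<exists>i<k. v i \<in> nonzero_vectors (L i))"
proof (cases "v \<in> topspace (vb_total W)")
  case True
  have "v \<noteq> vb_scale W 0 v \<longleftrightarrow> (\<exists>i<k. v i \<noteq> vb_scale (L i) 0 (v i))"
  proof
    assume "v \<noteq> vb_scale W 0 v"
    then show "\<exists>i<k. v i \<noteq> vb_scale (L i) 0 (v i)"
      using W_eqI[OF True scale_W_in[OF True, of 0]] by (auto simp: scale_W)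
  next
    assume "\<exists>i<k. v i \<noteq> vb_scale (L i) 0 (v i)"
    then obtain i where "i < k" "v i \<noteq> vb_scale (L i) 0 (v i)" by blast
    moreover from this have "vb_scale W 0 v i = vb_scale (L i) 0 (v i)" by (simp add: scale_W)
    ultimately show "v \<noteq> vb_scale W 0 v" by metis
  qed
  then show ?thesis using True W_component[OF True] by (auto simp: nonzero_vectors_def)
qed (simp add: nonzero_vectors_def)

lemma line_through_eq_iff:
  assumes v: "v \<in> nonzero_vectors W" and w: "w \<in> nonzero_vectors W"
  shows "line_through W v = line_through W w \<longleftrightarrow> (\<exists>r. r \<noteq> 0 \<and> w = vb_scale W r v)"
proof
  assume eq: "line_through W v = line_through W w"
  have vt: "v \<in> topspace (vb_total W)" and wt: "w \<in> topspace (vb_total W)"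
    using v w by (simp_all add: nonzero_vectors_def)
  have "w \<in> line_through W w" unfolding line_through_def using scale_one_W[OF wt] by (metis rangeI)
  then have "w \<in> line_through W v" using eq by simp
  then obtain r where r: "w = vb_scale W r v" unfolding line_through_def by blast
  moreover have "r \<noteq> 0"
  proof
    assume "r = 0"
    then have "vb_scale W 0 w = w" using r by (simp add: scale_scale_W[OF vt])
    then show False using w by (simp add: nonzero_vectors_def)
  qed
  ultimately show "\<exists>r. r \<noteq> 0 \<and> w = vb_scale W r v" by blast
next
  assume "\<exists>r. r \<noteq> 0 \<and> w = vb_scale W r v"
  then obtain r where r: "r \<noteq> 0" "w = vb_scale W r v" by blast
  have vt: "v \<in> topspace (vb_total W)" using v by (simp add: nonzero_vectors_def)
  have 1: "vb_scale W c v = vb_scale W (c / r) w" and 2: "vb_scale W c w = vb_scale W (c * r) v" for c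
    using r by (simp_all add: scale_scale_W[OF vt])
  have "vb_scale W c v \<in> line_through W w" and "vb_scale W c w \<in> line_through W v" for c
    unfolding line_through_def by (subst 1, rule rangeI) (subst 2, rule rangeI)
  then show "line_through W v = line_through W w" unfolding line_through_def by blast
qed

lemma topspace_N: "topspace N = nonzero_vectors W"
  by (auto simp: nonzero_vectors_def)

lemma quotient_lines: "quotient_map N (projectivization W) (line_through W)"
  unfolding projectivization_def by (rule quotient_map_quotient_top)

lemma topspace_lines: "topspace (projectivization W) = line_through W ` nonzero_vectors W"
  using quotient_imp_surjective_map[OF quotient_lines] topspace_N by simp

lemma continuous_component: "i < k \<Longrightarrow> continuous_map (vb_total W) (vb_total (L i)) (\<lambda>v. v i)"
  unfolding whitney_sum_def
  by (auto intro: continuous_map_from_subtopology continuous_map_product_projection)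

lemma continuous_proj_W: "continuous_map (vb_total W) M (vb_proj W)"
proof -
  have 0: "0 < k" using k by simp
  have "vb_proj W = vb_proj (L 0) \<circ> (\<lambda>v. v 0)" by (simp add: fun_eq_iff proj_W)
  then show ?thesis
    using continuous_map_compose[OF continuous_component[OF 0] line_bundle.continuous_proj[OF lb[OF 0]]]
    by (simp only: base[OF 0])
qed

text \<open>
  Lines over different points are separated in \<open>M\<close>.  Over a common chart domain a line with
  coordinates \<open>c\<close> is determined by the numbers \<open>c\<^sub>i c\<^sub>j / \<bar>c\<bar>\<^sup>2\<close>, the entries of the orthogonal
  projection onto it.
\<close>

lemma Hausdorff_projectivization: "Hausdorff_space (projectivization W)"
  unfolding Hausdorff_space_def
proof (intro allI impI)
  let ?PW = "projectivization W"
  fix l l' assume "l \<in> topspace ?PW \<and> l' \<in> topspace ?PW \<and> l \<noteq> l'"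
  then obtain v v' where v: "v \<in> nonzero_vectors W" "l = line_through W v"
    and v': "v' \<in> nonzero_vectors W" "l' = line_through W v'" and ll: "l \<noteq> l'"
    unfolding topspace_lines by blast
  have vt: "v \<in> topspace (vb_total W)" and vt': "v' \<in> topspace (vb_total W)"
    using v v' by (simp_all add: nonzero_vectors_def)
  have "continuous_map N M (vb_proj W)"
    by (rule continuous_map_from_subtopology[OF continuous_proj_W])
  moreover have "vb_proj W u = vb_proj W w" if "u \<in> topspace N" "w \<in> topspace N" "line_through W u = line_through W w" for u w
    using that line_through_eq_iff[of u w] proj_scale_W[of u] unfolding topspace_N by (auto simp: nonzero_vectors_def)
  ultimately obtain pr where pr: "continuous_map ?PW M pr" "\<And>u. u \<in> topspace N \<Longrightarrow> pr (line_through W u) = vb_proj W u"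
    using quotient_map_lift_exists[OF quotient_lines, of M "vb_proj W"] by metis
  have prv: "pr l = vb_proj W v" "pr l' = vb_proj W v'" using pr(2) v v' topspace_N by auto
  have lin: "l \<in> topspace ?PW" "l' \<in> topspace ?PW" using v v' unfolding topspace_lines by auto
  show "\<exists>A B. openin ?PW A \<and> openin ?PW B \<and> l \<in> A \<and> l' \<in> B \<and> disjnt A B"
  proof (cases "pr l = pr l'")
    case False
    have "pr l \<in> topspace M" "pr l' \<in> topspace M"
      using continuous_map_image_subset_topspace[OF pr(1)] lin by auto
    then obtain A B where AB: "openin M A" "openin M B" "pr l \<in> A" "pr l' \<in> B" "disjnt A B"
      using Hausdorff_M False unfolding Hausdorff_space_def by metis
    show ?thesis
      by (intro exI[of _ "{x \<in> topspace ?PW. pr x \<in> A}"] exI[of _ "{x \<in> topspace ?PW. pr x \<in> B}"] conjI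
          openin_continuous_map_preimage[OF pr(1)] AB) (use AB lin in \<open>auto simp: disjnt_def\<close>)
  next
    case True
    have m: "pr l \<in> topspace M" using continuous_map_image_subset_topspace[OF pr(1)] lin by auto
    have "\<forall>i. \<exists>Uc. i < k \<longrightarrow> pr l \<in> fst Uc \<and> (\<exists>w. chart (L i) (fst Uc) (snd Uc) w)"
    proof
      fix i show "\<exists>Uc. i < k \<longrightarrow> pr l \<in> fst Uc \<and> (\<exists>w. chart (L i) (fst Uc) (snd Uc) w)"
      proof (cases "i < k")
        case True
        then obtain U c w where "pr l \<in> U" "chart (L i) U c w"
          using line_bundle.chart_exists[OF lb[OF True], of "pr l"] m base by metis
        then show ?thesis by (intro exI[of _ "(U, c)"]) auto
      qed simp
    qed
    then obtain Uc where Uc: "\<And>i. i < k \<Longrightarrow> pr l \<in> fst (Uc i) \<and> (\<exists>w. chart (L i) (fst (Uc i)) (snd (Uc i)) w)"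
      by metis
    define U where "U = (\<Inter>i<k. fst (Uc i))"
    define c where "c i u = snd (Uc i) (u i)" for i and u :: "nat \<Rightarrow> 'e"
    have prU: "pr l \<in> U" using Uc by (auto simp: U_def)
    have opU: "openin M U"
      unfolding U_def using Uc k base by (intro openin_INT2) (auto simp: chart_def lessThan_empty_iff)
    let ?O = "{x \<in> topspace ?PW. pr x \<in> U}"
    have opO: "openin ?PW ?O" by (rule openin_continuous_map_preimage[OF pr(1) opU])
    let ?NU = "{u \<in> topspace N. line_through W u \<in> ?O}"
    have NU: "u \<in> nonzero_vectors W" "u \<in> topspace (vb_total W)" "vb_proj W u \<in> U" if "u \<in> ?NU" for u
      using that pr(2) by (auto simp: nonzero_vectors_def)
    have topNU: "topspace (subtopology N ?NU) = ?NU"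
      by (rule topspace_subtopology_subset) blast
    have quo: "quotient_map (subtopology N ?NU) (subtopology ?PW ?O) (line_through W)"
      by (rule quotient_map_restriction[OF quotient_lines]) (use opO in auto)
    have cs: "c i (vb_scale W r u) = r * c i u" if i: "i < k" and u: "u \<in> ?NU" for i r u
    proof -
      obtain w where w: "chart (L i) (fst (Uc i)) (snd (Uc i)) w" using Uc i by blast
      have "vb_proj (L i) (u i) \<in> fst (Uc i)"
        using NU(3)[OF u] proj_W'[OF NU(2)[OF u] i] i by (simp add: U_def)
      then show ?thesis
        using line_bundle.chart_scale[OF lb[OF i] w W_component[OF NU(2)[OF u] i]] i by (simp add: c_def scale_W)
    qed
    have cn: "\<exists>i<k. c i u \<noteq> 0" if u: "u \<in> ?NU" for u
    proof -
      obtain i where i: "i < k" "u i \<in> nonzero_vectors (L i)" using NU(1)[OF u] unfolding nonzero_W by blast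
      obtain w where w: "chart (L i) (fst (Uc i)) (snd (Uc i)) w" using Uc i by blast
      have "vb_proj (L i) (u i) \<in> fst (Uc i)"
        using NU(3)[OF u] proj_W'[OF NU(2)[OF u] i(1)] i by (simp add: U_def)
      then have "c i u \<noteq> 0"
        using line_bundle.chart_nonzero[OF lb[OF i(1)] w W_component[OF NU(2)[OF u] i(1)]] i by (simp add: c_def)
      then show ?thesis using i by blast
    qed
    have cc: "continuous_map (subtopology N ?NU) euclideanreal (c i)" if i: "i < k" for i
    proof -
      obtain w where w: "chart (L i) (fst (Uc i)) (snd (Uc i)) w" using Uc i by blast
      have "continuous_map (subtopology N ?NU) (vb_total (L i)) (\<lambda>u. u i)"
        by (intro continuous_map_from_subtopology continuous_component i)
      moreover have "(\<lambda>u. u i) ` topspace (subtopology N ?NU) \<subseteq> {v. vb_proj (L i) v \<in> fst (Uc i)}"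
      proof (rule image_subsetI)
        fix u assume "u \<in> topspace (subtopology N ?NU)"
        then have u: "u \<in> ?NU" by (simp only: topNU)
        have "vb_proj (L i) (u i) \<in> U" using NU(3)[OF u] proj_W'[OF NU(2)[OF u] i] by simp
        then show "u i \<in> {v. vb_proj (L i) v \<in> fst (Uc i)}" using i by (auto simp: U_def)
      qed
      ultimately show ?thesis
        unfolding c_def by (rule line_bundle.chart_continuous[OF lb[OF i] w])
    qed
    define D where "D u = (\<Sum>i<k. c i u * c i u)" for u
    have Dpos: "D u > 0" if u: "u \<in> ?NU" for u
    proof -
      obtain i where "i < k" "c i u \<noteq> 0" using cn[OF u] by blast
      then show ?thesis unfolding D_def by (intro sum_pos2[of _ i]) (auto simp: zero_less_mult_iff)
    qed
    have Dc: "continuous_map (subtopology N ?NU) euclideanreal D"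
      unfolding D_def by (intro continuous_map_sum continuous_map_real_mult cc) auto
    define f where "f i j u = c i u * c j u / D u" for i j u
    have fc: "continuous_map (subtopology N ?NU) euclideanreal (f i j)" if ij: "i < k" "j < k" for i j
      unfolding f_def
    proof (intro continuous_map_real_divide continuous_map_real_mult cc Dc ij)
      fix u assume "u \<in> topspace (subtopology N ?NU)"
      then have "u \<in> ?NU" by (simp only: topNU)
      from Dpos[OF this] show "D u \<noteq> 0" by simp
    qed
    have fs: "f i j u = f i j w"
      if uw: "u \<in> ?NU" "w \<in> ?NU" "line_through W u = line_through W w" and ij: "i < k" "j < k" for i j u w
    proof -
      obtain r where r: "r \<noteq> 0" "w = vb_scale W r u"
        using uw line_through_eq_iff[OF NU(1) NU(1)] by blast
      have "D w = r * r * D u" unfolding D_def sum_distrib_left r(2) using cs uw(1) by (intro sum.cong) auto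
      then show ?thesis using r ij uw(1) by (simp add: f_def cs)
    qed
    have vNU: "v \<in> ?NU" "v' \<in> ?NU" using v v' lin prU True topspace_N by auto
    have "\<exists>i j. i < k \<and> j < k \<and> f i j v \<noteq> f i j v'"
    proof (rule ccontr)
      assume "\<not> (\<exists>i j. i < k \<and> j < k \<and> f i j v \<noteq> f i j v')"
      then have ff: "f i j v = f i j v'" if "i < k" "j < k" for i j using that by blast
      obtain j where j: "j < k" "c j v \<noteq> 0" using cn[OF vNU(1)] by blast
      have D0: "D v \<noteq> 0" "D v' \<noteq> 0" using Dpos[OF vNU(1)] Dpos[OF vNU(2)] by simp_all
      have "c j v' \<noteq> 0" using ff[OF j(1) j(1)] j D0 by (auto simp: f_def)
      define r where "r = D v' * c j v / (c j v' * D v)"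
      have cr: "c i v' = r * c i v" if "i < k" for i
        using ff[OF that j(1)] j D0 \<open>c j v' \<noteq> 0\<close> by (simp add: f_def r_def field_simps)
      have "v' = vb_scale W r v"
      proof (rule W_eqI[OF vt' scale_W_in[OF vt]])
        fix i assume i: "i < k"
        obtain w where w: "chart (L i) (fst (Uc i)) (snd (Uc i)) w" using Uc i by blast
        have pv: "vb_proj (L i) (v i) = pr l" "vb_proj (L i) (v' i) = pr l"
          using proj_W' vt vt' i prv True by auto
        have comp: "v i \<in> topspace (vb_total (L i))" "v' i \<in> topspace (vb_total (L i))"
          using W_component vt vt' i by auto
        have "v' i = vb_scale (L i) r (v i)"
        proof (rule line_bundle.chart_eqI[OF lb[OF i] w])
          show "snd (Uc i) (v' i) = snd (Uc i) (vb_scale (L i) r (v i))"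
            using cr[OF i] line_bundle.chart_scale[OF lb[OF i] w comp(1)] pv Uc[OF i] by (simp add: c_def)
        qed (use comp pv Uc[OF i] line_bundle.scale_in[OF lb[OF i]] line_bundle.proj_scale[OF lb[OF i]] in auto)
        then show "v' i = vb_scale W r v i" using i by (simp add: scale_W)
      qed
      moreover have "r \<noteq> 0" using j D0 \<open>c j v' \<noteq> 0\<close> by (simp add: r_def)
      ultimately show False using line_through_eq_iff[OF v(1) v'(1)] v v' ll by blast
    qed
    then obtain i j where ij: "i < k" "j < k" "f i j v \<noteq> f i j v'" by blast
    obtain F where F: "continuous_map (subtopology ?PW ?O) euclideanreal F" "\<And>u. u \<in> ?NU \<Longrightarrow> F (line_through W u) = f i j u"
    proof (rule quotient_map_lift_exists[OF quo fc[OF ij(1,2)]])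
      fix x y assume "x \<in> topspace (subtopology N ?NU)" "y \<in> topspace (subtopology N ?NU)" "line_through W x = line_through W y"
      then show "f i j x = f i j y" unfolding topNU by (intro fs ij(1,2))
    next
      fix F assume "continuous_map (subtopology ?PW ?O) euclideanreal F"
        "\<And>x. x \<in> topspace (subtopology N ?NU) \<Longrightarrow> F (line_through W x) = f i j x"
      then show thesis unfolding topNU by (rule that)
    qed
    have "F l \<noteq> F l'" using F(2)[OF vNU(1)] F(2)[OF vNU(2)] ij(3) v(2) v'(2) by simp
    then obtain A B where AB: "open A" "open B" "F l \<in> A" "F l' \<in> B" "A \<inter> B = {}"
      using hausdorff[of "F l" "F l'"] by blast
    have topO: "topspace (subtopology ?PW ?O) = ?O"
      by (rule topspace_subtopology_subset) blast
    have opn: "openin ?PW {x \<in> ?O. F x \<in> A}" if A: "open A" for A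
    proof -
      have "openin euclideanreal A" using A by simp
      from openin_trans_full[OF openin_continuous_map_preimage[OF F(1) this] opO]
      show ?thesis unfolding topO .
    qed
    have "l \<in> ?O" "l' \<in> ?O" using lin prU True by simp_all
    then show ?thesis
      by (intro exI[of _ "{x \<in> ?O. F x \<in> A}"] exI[of _ "{x \<in> ?O. F x \<in> B}"] conjI opn[OF AB(1)] opn[OF AB(2)])
        (use AB(3-5) in \<open>simp_all add: disjnt_iff disjoint_iff\<close>)
  qed
qed

end

context framed_sum
begin

text \<open>
  The point with coordinates \<open>y\<close> in the simplex and signs \<open>t\<close> corresponds to the line with
  homogeneous coordinates \<open>\<plusminus>y\<^sub>i\<close>.
\<close>

definition vec :: "(base_group \<times> (nat \<Rightarrow> bit)) \<times> plane \<times> (nat \<Rightarrow> real) \<Rightarrow> nat \<Rightarrow> 'e" where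
  "vec = (\<lambda>((g, t), (x, y)). \<lambda>i\<in>{..<k}. vb_scale (L i) (sgn_bit (t i) * y i) (s i g x))"

definition \<Phi> :: "(base_group \<times> (nat \<Rightarrow> bit)) \<times> plane \<times> (nat \<Rightarrow> real) \<Rightarrow> (nat \<Rightarrow> 'e) set" where
  "\<Phi> z = line_through W (vec z)"

text \<open>
  Lines do not change if all coordinates change their signs, so the sign of the last summand is
  divided out of the others.
\<close>

definition \<nu> :: pchar where
  "\<nu> F = (\<mu> F, \<lambda>i. if i < k - 1 then \<epsilon> i F + \<epsilon> (k - 1) F else 0)"

lemma simplex_sum: "y \<in> \<Delta> \<Longrightarrow> (\<Sum>i<k. y i) = 1"
  and simplex_nonneg: "y \<in> \<Delta> \<Longrightarrow> 0 \<le> y i"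
  and simplex_zero: "y \<in> \<Delta> \<Longrightarrow> k \<le> i \<Longrightarrow> y i = 0"
proof -
  have "{..<k} = {..k - 1}" using k by auto
  then show "y \<in> \<Delta> \<Longrightarrow> (\<Sum>i<k. y i) = 1" by (simp add: standard_simplex_def)
qed (use k in \<open>auto simp: standard_simplex_def\<close>)

lemma simplex_ex: assumes y: "y \<in> \<Delta>" shows "\<exists>i<k. y i \<noteq> 0"
proof (rule ccontr)
  assume "\<not> ?thesis"
  then have "(\<Sum>i<k. y i) = 0" by (intro sum.neutral) auto
  then show False using simplex_sum[OF y] by simp
qed

lemma vec_component: "i < k \<Longrightarrow> vec ((g, t), (x, y)) i = vb_scale (L i) (sgn_bit (t i) * y i) (s i g x)"
  by (simp add: vec_def)

lemma W_I:
  assumes "\<And>i. i < k \<Longrightarrow> v i \<in> topspace (vb_total (L i))" "\<And>i. i < k \<Longrightarrow> vb_proj (L i) (v i) = m"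
  shows "(\<lambda>i\<in>{..<k}. v i) \<in> topspace (vb_total W)" "vb_proj W (\<lambda>i\<in>{..<k}. v i) = m"
proof -
  have "(\<lambda>i\<in>{..<k}. v i) \<in> (\<Pi>\<^sub>E i\<in>{..<k}. topspace (vb_total (L i)))"
    by (rule restrict_PiE_iff[THEN iffD2]) (use assms in simp)
  moreover have "vb_proj (L i) ((\<lambda>i\<in>{..<k}. v i) i) = vb_proj (L j) ((\<lambda>i\<in>{..<k}. v i) j)" if "i < k" "j < k" for i j
    using that assms(2) by simp
  ultimately show "(\<lambda>i\<in>{..<k}. v i) \<in> topspace (vb_total W)" unfolding topspace_W by blast
  show "vb_proj W (\<lambda>i\<in>{..<k}. v i) = m" using k assms(2)[of 0] by (simp add: proj_W)
qed

lemma vec_in: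
  assumes "x \<in> P"
  shows "vec ((g, t), (x, y)) \<in> topspace (vb_total W)" "vb_proj W (vec ((g, t), (x, y))) = q (g, x)"
  unfolding vec_def split
  by (rule W_I; simp add: line_bundle.scale_in[OF lb] line_bundle.proj_scale[OF lb] sin[OF _ assms] sp[OF _ assms])+

lemma vec_nonzero:
  assumes x: "x \<in> P" and y: "y \<in> \<Delta>"
  shows "vec ((g, t), (x, y)) \<in> nonzero_vectors W"
proof -
  obtain i where i: "i < k" "y i \<noteq> 0" using simplex_ex[OF y] by blast
  then have "vec ((g, t), (x, y)) i \<in> nonzero_vectors (L i)"
    by (simp add: vec_component line_bundle.nonzero_scale[OF lb] sn x)
  then show ?thesis unfolding nonzero_W using vec_in(1)[OF x] i(1) by blast
qed

lemma topspace_Q: "topspace Q = P \<times> \<Delta>" and topspace_Z: "topspace Z = G \<times> (P \<times> \<Delta>)"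
  by simp_all

lemma continuous_vec: "continuous_map Z N vec"
  unfolding continuous_map_in_subtopology
proof (intro conjI)
  show "vec \<in> topspace Z \<rightarrow> nonzero_vectors W"
    unfolding topspace_Z using vec_nonzero by auto
  show "continuous_map Z (vb_total W) vec"
    unfolding continuous_map_from_discrete_prod
  proof
    fix gt assume "gt \<in> G"
    obtain g t where gt: "gt = (g, t)" by fastforce
    have fst: "continuous_map Q (top_of_set P) fst" by (rule continuous_map_fst)
    have snd: "continuous_map Q euclideanreal (\<lambda>z. snd z i)" for i
    proof -
      have "continuous_map (subtopology (powertop_real UNIV) \<Delta>) euclideanreal (\<lambda>y. y i)"
        by (intro continuous_map_from_subtopology continuous_map_product_projection) simp
      from continuous_map_compose[OF continuous_map_snd this] show ?thesis by (simp only: o_def)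
    qed
    have comp: "continuous_map Q (vb_total (L i)) (\<lambda>z. vec (gt, z) i)" if i: "i < k" for i
    proof -
      have "continuous_map Q (vb_total (L i)) (\<lambda>z. vb_scale (L i) (sgn_bit (t i) * snd z i) (s i g (fst z)))"
        using continuous_map_compose[OF fst sc[OF i, of g]] snd[of i]
        by (intro line_bundle.continuous_scale[OF lb[OF i]] continuous_map_real_mult) (simp_all add: o_def)
      moreover have "(\<lambda>z. vec (gt, z) i) = (\<lambda>z. vb_scale (L i) (sgn_bit (t i) * snd z i) (s i g (fst z)))"
        using i by (auto simp: gt vec_def split_def)
      ultimately show ?thesis by simp
    qed
    have "continuous_map Q (product_topology (\<lambda>i. vb_total (L i)) {..<k}) (\<lambda>z. vec (gt, z))"
      unfolding continuous_map_componentwise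
    proof (intro conjI ballI)
      show "(\<lambda>z. vec (gt, z)) ` topspace Q \<subseteq> extensional {..<k}" by (auto simp: vec_def gt)
      show "continuous_map Q (vb_total (L i)) (\<lambda>z. vec (gt, z) i)" if "i \<in> {..<k}" for i
        using comp that by simp
    qed
    moreover have "\<forall>i<k. \<forall>j<k. vb_proj (L i) (vec (gt, z) i) = vb_proj (L j) (vec (gt, z) j)" if z: "z \<in> topspace Q" for z
    proof -
      obtain x y where "z = (x, y)" "x \<in> P" using z unfolding topspace_Q by blast
      then have "vec (gt, z) \<in> topspace (vb_total W)" using vec_in(1) gt by simp
      then show ?thesis unfolding topspace_W by (rule conjunct2)
    qed
    then have "(\<lambda>z. vec (gt, z)) \<in> topspace Q \<rightarrow> {v. \<forall>i<k. \<forall>j<k. vb_proj (L i) (v i) = vb_proj (L j) (v j)}"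
      by (intro Pi_I CollectI)
    ultimately show "continuous_map Q (vb_total W) (\<lambda>z. vec (gt, z))"
      unfolding whitney_sum_def vbundle.simps continuous_map_in_subtopology by (rule conjI)
  qed
qed

lemma sgn_bit_abs: "\<exists>b. c = sgn_bit b * \<bar>c\<bar>"
proof (cases "c \<ge> 0")
  case True then show ?thesis by (intro exI[of _ 0]) simp
next
  case False then show ?thesis by (intro exI[of _ 1]) simp
qed

lemma line_eq_\<Phi>:
  assumes v: "v \<in> nonzero_vectors W"
  obtains g t x y where "(g, t) \<in> G" "x \<in> P" "y \<in> \<Delta>" "line_through W v = \<Phi> ((g, t), (x, y))" "vb_proj W v = q (g, x)"
proof -
  have vt: "v \<in> topspace (vb_total W)" using v by (simp add: nonzero_vectors_def)
  have "vb_proj W v \<in> topspace M"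
    using continuous_map_image_subset_topspace[OF continuous_proj_W] vt by blast
  then obtain g x where x: "x \<in> P" "q (g, x) = vb_proj W v" by (rule surjE)
  have "\<exists>c. v i = vb_scale (L i) c (s i g x)" if i: "i < k" for i
    by (rule line_bundle.ex_scale[OF lb[OF i] W_component[OF vt i] sn[OF i x(1)]])
      (simp add: proj_W'[OF vt i] sp[OF i x(1)] x(2))
  then obtain c where c: "\<And>i. i < k \<Longrightarrow> v i = vb_scale (L i) (c i) (s i g x)" by metis
  obtain j where j: "j < k" "v j \<in> nonzero_vectors (L j)" using v unfolding nonzero_W by blast
  then have cj: "c j \<noteq> 0"
    using c[OF j(1)] line_bundle.nonzero_scale[OF lb[OF j(1)] sn[OF j(1) x(1)]] by simp
  define n where "n = (\<Sum>i<k. \<bar>c i\<bar>)"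
  have n: "n > 0" unfolding n_def by (rule sum_pos2[of _ j]) (use j cj in auto)
  have "\<forall>i. \<exists>b. c i = sgn_bit b * \<bar>c i\<bar>" using sgn_bit_abs by blast
  from choice[OF this] obtain \<beta> where \<beta>: "\<And>i. c i = sgn_bit (\<beta> i) * \<bar>c i\<bar>" by blast
  define t where "t i = (if i < k - 1 then \<beta> i + \<beta> (k - 1) else 0)" for i
  define y where "y i = (if i < k then \<bar>c i\<bar> / n else 0)" for i
  have t: "(g, t) \<in> G" by (simp add: bundle_group_def t_def)
  have ysum: "(\<Sum>i<k. y i) = 1"
  proof -
    have "(\<Sum>i<k. y i) = (\<Sum>i<k. \<bar>c i\<bar> / n)" by (intro sum.cong) (auto simp: y_def)
    also have "\<dots> = 1" using n by (simp add: n_def sum_divide_distrib[symmetric])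
    finally show ?thesis .
  qed
  have y: "y \<in> \<Delta>"
  proof -
    have nn: "0 \<le> y i" for i using n by (simp add: y_def)
    have "y i \<le> 1" for i
    proof (cases "i < k")
      case True
      then have "y i \<le> (\<Sum>i<k. y i)" using nn by (intro member_le_sum) auto
      then show ?thesis using ysum by simp
    qed (simp add: y_def)
    moreover have "{..<k} = {..k - 1}" using k by auto
    ultimately show ?thesis using nn ysum k by (auto simp: standard_simplex_def y_def)
  qed
  have \<sigma>: "sgn_bit (t i) * y i = sgn_bit (\<beta> (k - 1)) / n * c i" if i: "i < k" for i
  proof -
    have tb: "sgn_bit (t i) = sgn_bit (\<beta> (k - 1)) * sgn_bit (\<beta> i)"
    proof (cases "i < k - 1")
      case False
      then have "i = k - 1" using i by simp
      then show ?thesis by (simp add: t_def)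
    next
      case True
      then have "t i = \<beta> i + \<beta> (k - 1)" by (simp add: t_def)
      then show ?thesis by (simp only: sgn_bit_simps mult.commute)
    qed
    have "sgn_bit (\<beta> i) * \<bar>c i\<bar> = c i" using \<beta>[of i] by simp
    then show ?thesis using i unfolding tb y_def by (simp add: field_simps)
  qed
  have "vec ((g, t), (x, y)) = vb_scale W (sgn_bit (\<beta> (k - 1)) / n) v"
  proof (rule W_eqI[OF vec_in(1)[OF x(1)] scale_W_in[OF vt]])
    fix i assume i: "i < k"
    show "vec ((g, t), (x, y)) i = vb_scale W (sgn_bit (\<beta> (k - 1)) / n) v i"
      using i by (simp add: vec_component scale_W c \<sigma> line_bundle.scale_scale[OF lb] sin x(1))
  qed
  moreover have "sgn_bit (\<beta> (k - 1)) / n \<noteq> 0" using n by simp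
  ultimately have "line_through W v = \<Phi> ((g, t), (x, y))"
    unfolding \<Phi>_def using line_through_eq_iff[OF v vec_nonzero[OF x(1) y]] by blast
  then show ?thesis using that t x y by simp
qed

text \<open>
  A continuous surjection from a compact space onto a Hausdorff space is a quotient map.
\<close>

lemma quotient_\<Phi>: "quotient_map Z (projectivization W) \<Phi>"
proof -
  have c: "continuous_map Z (projectivization W) \<Phi>"
    using continuous_map_compose[OF continuous_vec quotient_imp_continuous_map[OF quotient_lines]]
    by (simp add: \<Phi>_def[abs_def] o_def)
  have "compact_space (subtopology (powertop_real UNIV) \<Delta>)"
    by (rule compact_space_subtopology[OF compactin_standard_simplex])
  moreover have "compact_space (top_of_set P)"
    using polygon_compact[OF polygon] by (simp add: compact_space_subtopology)
  ultimately have "compact_space Z"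
    by (simp add: compact_space_prod_topology compact_space_discrete_topology finite_bundle_group)
  then have "closed_map Z (projectivization W) \<Phi>"
    by (rule continuous_imp_closed_map[OF c _ Hausdorff_projectivization])
  moreover have "\<Phi> ` topspace Z = topspace (projectivization W)"
  proof (intro equalityI subsetI)
    fix l assume "l \<in> topspace (projectivization W)"
    then obtain v where "v \<in> nonzero_vectors W" "l = line_through W v" unfolding topspace_lines by blast
    then obtain g t x y where "(g, t) \<in> G" "x \<in> P" "y \<in> \<Delta>" "l = \<Phi> ((g, t), (x, y))" using line_eq_\<Phi> by metis
    then show "l \<in> \<Phi> ` topspace Z" unfolding topspace_Z by blast
  next
    fix l assume "l \<in> \<Phi> ` topspace Z"
    then show "l \<in> topspace (projectivization W)"
      using continuous_map_image_subset_topspace[OF c] by blast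
  qed
  ultimately show ?thesis using continuous_closed_imp_quotient_map[OF c] by blast
qed

section \<open>The isotropy groups of the projectivization\<close>

definition facet_values :: "plane \<Rightarrow> (nat \<Rightarrow> real) \<Rightarrow> (base_group \<times> (nat \<Rightarrow> bit)) set" where
  "facet_values x y = {\<nu> F | F. F \<in> facets P \<and> x \<in> F} \<union> {(0, simplex_value k i) | i. i < k \<and> y i = 0}"

lemma isotropy_values:
  assumes "x \<in> P" "y \<in> \<Delta>"
  shows "isotropy_at (bundle_characteristic k P \<nu>) (x, y) = generated_subgroup (facet_values x y)"
proof -
  have "{v. \<exists>F. (F, v) \<in> bundle_characteristic k P \<nu> \<and> (x, y) \<in> F} = facet_values x y"
  proof (intro equalityI subsetI)
    fix v assume "v \<in> {v. \<exists>F. (F, v) \<in> bundle_characteristic k P \<nu> \<and> (x, y) \<in> F}"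
    then show "v \<in> facet_values x y" unfolding bundle_characteristic_def facet_values_def by blast
  next
    fix v assume "v \<in> facet_values x y"
    then consider F where "F \<in> facets P" "x \<in> F" "v = \<nu> F" | i where "i < k" "y i = 0" "v = (0, simplex_value k i)"
      unfolding facet_values_def by blast
    then show "v \<in> {v. \<exists>F. (F, v) \<in> bundle_characteristic k P \<nu> \<and> (x, y) \<in> F}"
    proof cases
      case 1
      then have "(F \<times> \<Delta>, v) \<in> bundle_characteristic k P \<nu> \<and> (x, y) \<in> F \<times> \<Delta>"
        using assms unfolding bundle_characteristic_def by blast
      then show ?thesis by blast
    next
      case 2
      then have "(P \<times> {y \<in> \<Delta>. y i = 0}, v) \<in> bundle_characteristic k P \<nu> \<and> (x, y) \<in> P \<times> {y \<in> \<Delta>. y i = 0}"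
        using assms unfolding bundle_characteristic_def by blast
      then show ?thesis by blast
    qed
  qed
  then show ?thesis by (simp add: isotropy_at_def)
qed

lemma \<nu>_in: "\<nu> F \<in> G" by (simp add: \<nu>_def bundle_group_def)

lemma simplex_value_in: "(0, simplex_value k i) \<in> G"
  by (auto simp: bundle_group_def simplex_value_def)

text \<open>
  Crossing the edge \<open>F\<close> multiplies the \<open>i\<close>-th vector of the framing by the sign \<open>\<epsilon> i F\<close>; together
  with the sign in \<open>\<nu> F\<close> this is the same factor for all \<open>i\<close>.  The sign of a vanishing coordinate is
  invisible, and if it is the last coordinate that vanishes, then the all-one vector multiplies all
  others by \<open>- 1\<close>.
\<close>

lemma isotropy_fixes:
  assumes x: "x \<in> P" and y: "y \<in> \<Delta>" and d: "d \<in> generated_subgroup (facet_values x y)"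
  shows "d \<in> G \<and> (\<forall>z. \<Phi> (z + d, (x, y)) = \<Phi> (z, (x, y)))"
  using d
proof (induction rule: generated_induct)
  case (generator d)
  have same: "\<Phi> (z + d, (x, y)) = \<Phi> (z, (x, y))"
    if "\<And>i. i < k \<Longrightarrow> vec (z + d, (x, y)) i = vb_scale (L i) (sgn_bit b) (vec (z, (x, y)) i)" for z b
  proof -
    have nz: "vec (w, (x, y)) \<in> nonzero_vectors W" for w
      using vec_nonzero[OF x y, of "fst w" "snd w"] by simp
    have wt: "vec (w, (x, y)) \<in> topspace (vb_total W)" for w
      using vec_in(1)[OF x, of "fst w" "snd w" y] by simp
    have "vec (z + d, (x, y)) = vb_scale W (sgn_bit b) (vec (z, (x, y)))"
      by (rule W_eqI[OF wt scale_W_in[OF wt]]) (simp add: that scale_W)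
    then show ?thesis
      unfolding \<Phi>_def using line_through_eq_iff[OF nz[of z] nz[of "z + d"]] sgn_bit_simps(5)[of b] by metis
  qed
  from generator consider F where "F \<in> facets P" "x \<in> F" "d = \<nu> F" | i where "i < k" "y i = 0" "d = (0, simplex_value k i)"
    unfolding facet_values_def by blast
  then show ?case
  proof cases
    case 1
    have "\<Phi> ((g, t) + d, (x, y)) = \<Phi> ((g, t), (x, y))" for g t
    proof (rule same[of _ "\<epsilon> (k - 1) F"])
      fix i assume i: "i < k"
      have "sgn_bit (if i < k - 1 then \<epsilon> i F + \<epsilon> (k - 1) F else 0) * sgn_bit (\<epsilon> i F) = sgn_bit (\<epsilon> (k - 1) F)"
      proof (cases "i < k - 1")
        case False
        then have "i = k - 1" using i by simp
        then show ?thesis by simp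
      next
        case True
        have "sgn_bit (a + b) * sgn_bit a = sgn_bit b" for a b by (cases a; cases b) simp_all
        then show ?thesis using True by simp
      qed
      then have e: "sgn_bit (t i + (if i < k - 1 then \<epsilon> i F + \<epsilon> (k - 1) F else 0)) * y i * sgn_bit (\<epsilon> i F)
          = sgn_bit (\<epsilon> (k - 1) F) * (sgn_bit (t i) * y i)"
        by (simp only: sgn_bit_simps mult_ac)
      show "vec ((g, t) + d, (x, y)) i = vb_scale (L i) (sgn_bit (\<epsilon> (k - 1) F)) (vec ((g, t), (x, y)) i)"
        unfolding 1(3) \<nu>_def plus_prod_def fst_conv snd_conv vec_component[OF i] plus_fun_apply s\<epsilon>[OF i 1(1,2)]
        by (simp only: line_bundle.scale_scale[OF lb[OF i] sin[OF i x]] e)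
    qed
    then show ?thesis using \<nu>_in 1(3) by auto
  next
    case 2
    have "\<Phi> ((g, t) + d, (x, y)) = \<Phi> ((g, t), (x, y))" for g t
    proof (rule same[of _ "of_bool (i = k - 1)"])
      fix j assume j: "j < k"
      have "sgn_bit (t j + simplex_value k i j) * y j = sgn_bit (of_bool (i = k - 1)) * (sgn_bit (t j) * y j)"
        using 2(1,2) j by (cases "i = j"; cases "i = k - 1"; cases "j = k - 1") (auto simp: simplex_value_def)
      then show "vec ((g, t) + d, (x, y)) j = vb_scale (L j) (sgn_bit (of_bool (i = k - 1))) (vec ((g, t), (x, y)) j)"
        unfolding 2(3) plus_prod_def fst_conv snd_conv vec_component[OF j] plus_fun_apply add_0_right
        by (simp only: line_bundle.scale_scale[OF lb[OF j] sin[OF j x]])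
    qed
    then show ?thesis using simplex_value_in 2(3) by auto
  qed
next
  case zero
  show ?case by (simp add: bundle_group_def zero_prod_def)
next
  case (diff d e)
  have "d - e \<in> G" using diff bundle_group_add by (simp add: bundle_element_diff)
  moreover have "\<Phi> (z + (d - e), (x, y)) = \<Phi> (z, (x, y))" for z
  proof -
    have "z + (d - e) = z + d + e" by (simp add: bundle_element_diff add.assoc)
    moreover have "\<Phi> (z + d + e, (x, y)) = \<Phi> (z + d, (x, y))" "\<Phi> (z + d, (x, y)) = \<Phi> (z, (x, y))"
      using diff by blast+
    ultimately show ?thesis by (simp only:)
  qed
  ultimately show ?case by blast
qed

lemma isotropy_fst:
  assumes "D \<in> generated_subgroup (facet_values x y)" shows "fst D \<in> iso x"
  using assms
proof (induction rule: generated_induct)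
  case (generator D)
  then consider F where "F \<in> facets P" "x \<in> F" "D = \<nu> F" | i where "D = (0, simplex_value k i)"
    unfolding facet_values_def by blast
  then show ?case
  proof cases
    case 1 then show ?thesis using facet_iso by (simp add: \<nu>_def)
  next
    case 2 then show ?thesis unfolding iso_def by (simp add: subgroup_generated(1))
  qed
next
  case zero show ?case unfolding iso_def by (simp add: subgroup_generated(1))
next
  case (diff D E)
  then show ?case unfolding iso_def by (simp only: fst_diff subgroup_generated(2))
qed

lemma isotropy_lift:
  assumes "d \<in> iso x" shows "\<exists>D\<in>generated_subgroup (facet_values x y). fst D = d"
  using assms unfolding iso_def
proof (induction rule: generated_induct)
  case (generator d)
  then obtain F where "F \<in> facets P" "x \<in> F" "d = \<mu> F" by blast
  then show ?case by (intro bexI[of _ "\<nu> F"] generated_inc) (auto simp: facet_values_def \<nu>_def)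
next
  case zero show ?case by (rule bexI[of _ 0]) (auto simp: subgroup_generated(1))
next
  case (diff d e)
  then obtain D E where "D \<in> generated_subgroup (facet_values x y)" "fst D = d" "E \<in> generated_subgroup (facet_values x y)" "fst E = e" by blast
  then show ?case by (intro bexI[of _ "D - E"] subgroup_generated(2)) auto
qed

lemma zero_support_isotropy:
  assumes "finite A" "\<And>i. i \<in> A \<Longrightarrow> i < k - 1 \<and> y i = 0"
  shows "(0, \<lambda>i. of_bool (i \<in> A)) \<in> generated_subgroup (facet_values x y)"
  using assms
proof (induction A rule: finite_induct)
  case empty
  have "(0, \<lambda>i. of_bool (i \<in> {})) = (0 :: base_group \<times> (nat \<Rightarrow> bit))" by (simp add: zero_prod_def zero_fun_def)
  then show ?case using subgroup_generated(1) by metis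
next
  case (insert j A)
  then have j: "j < k - 1" "y j = 0" by auto
  then have "(0, simplex_value k j) \<in> generated_subgroup (facet_values x y)"
    by (intro generated_inc) (auto simp: facet_values_def)
  moreover have "(0, \<lambda>i. of_bool (i \<in> A)) \<in> generated_subgroup (facet_values x y)" using insert by blast
  ultimately have "(0, simplex_value k j) + (0, \<lambda>i. of_bool (i \<in> A)) \<in> generated_subgroup (facet_values x y)"
    by (rule generated_add)
  moreover have "(0, simplex_value k j) + (0, \<lambda>i. of_bool (i \<in> A)) = (0 :: base_group, \<lambda>i. of_bool (i \<in> insert j A))"
    using j insert(2) by (auto simp: prod_eq_iff fun_eq_iff simplex_value_def)
  ultimately show ?case by metis
qed

lemma zero_support_isotropy':
  assumes "\<And>i. \<tau> i \<noteq> 0 \<Longrightarrow> i < k - 1 \<and> y i = 0"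
  shows "(0, \<tau>) \<in> generated_subgroup (facet_values x y)"
proof -
  have "{i. \<tau> i \<noteq> 0} \<subseteq> {..<k - 1}" using assms by blast
  then have "finite {i. \<tau> i \<noteq> 0}" by (rule finite_subset) simp
  then have "(0, \<lambda>i. of_bool (i \<in> {i. \<tau> i \<noteq> 0})) \<in> generated_subgroup (facet_values x y)"
    by (rule zero_support_isotropy) (use assms in blast)
  moreover have "(\<lambda>i. of_bool (i \<in> {i. \<tau> i \<noteq> 0})) = \<tau>" by (auto simp: fun_eq_iff)
  ultimately show ?thesis by metis
qed

text \<open>
  The two vectors are proportional, by a factor \<open>r\<close> of absolute value one since the coordinates have
  sum one.  If \<open>r = 1\<close>, then the signs differ only at vanishing coordinates.  If \<open>r = - 1\<close>, then they
  agree only at vanishing coordinates; the last one is among these because its sign is fixed, and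
  adding the all-one vector leads back to the first case.
\<close>

lemma same_sheet:
  assumes x: "x \<in> P" and y: "y \<in> \<Delta>" "y' \<in> \<Delta>" and t: "(g, t) \<in> G" "(g, t') \<in> G"
    and eq: "\<Phi> ((g, t), (x, y)) = \<Phi> ((g, t'), (x, y'))"
  shows "y = y' \<and> (0, t + t') \<in> generated_subgroup (facet_values x y)"
proof -
  obtain r where r: "r \<noteq> 0" "vec ((g, t'), (x, y')) = vb_scale W r (vec ((g, t), (x, y)))"
    using eq line_through_eq_iff[OF vec_nonzero[OF x y(1)] vec_nonzero[OF x y(2)]] unfolding \<Phi>_def by blast
  have co: "sgn_bit (t' i) * y' i = r * (sgn_bit (t i) * y i)" if i: "i < k" for i
  proof -
    have "vec ((g, t'), (x, y')) i = vb_scale (L i) r (vec ((g, t), (x, y)) i)"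
      unfolding r(2) using i by (simp add: scale_W)
    then have "vb_scale (L i) (sgn_bit (t' i) * y' i) (s i g x) = vb_scale (L i) (r * (sgn_bit (t i) * y i)) (s i g x)"
      using i by (simp add: vec_component line_bundle.scale_scale[OF lb] sin x)
    then show ?thesis using line_bundle.scale_cancel[OF lb[OF i] sn[OF i x]] by blast
  qed
  have ab: "y' i = \<bar>r\<bar> * y i" if "i < k" for i
    using arg_cong[OF co[OF that], of abs] simplex_nonneg[OF y(1), of i] simplex_nonneg[OF y(2), of i]
    by (simp add: abs_mult)
  have "(\<Sum>i<k. y' i) = \<bar>r\<bar> * (\<Sum>i<k. y i)" unfolding sum_distrib_left using ab by (intro sum.cong) auto
  then have r1: "\<bar>r\<bar> = 1" using simplex_sum y by simp
  have yy: "y = y'"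
  proof
    fix i show "y i = y' i"
      using ab[of i] r1 simplex_zero[OF y(1), of i] simplex_zero[OF y(2), of i] by (cases "i < k") simp_all
  qed
  have tk: "t i = 0" "t' i = 0" if "\<not> i < k - 1" for i using t that by (auto simp: bundle_group_def)
  have "(0, t + t') \<in> generated_subgroup (facet_values x y)"
  proof (cases "r = 1")
    case True
    show ?thesis
    proof (rule zero_support_isotropy')
      fix i assume i: "(t + t') i \<noteq> 0"
      then have ik: "i < k - 1" using tk by (metis add.right_neutral plus_fun_apply)
      moreover have "y i = 0"
      proof (rule ccontr)
        assume "y i \<noteq> 0"
        then have "sgn_bit (t' i) = sgn_bit (t i)" using co[of i] ik True yy by auto
        then show False using i by (simp add: sgn_bit_inj)
      qed
      ultimately show "i < k - 1 \<and> y i = 0" by blast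
    qed
  next
    case False
    then have r: "r = - 1" using r1 by (auto simp: abs_if split: if_splits)
    have k1: "k - 1 < k" using k by simp
    have yk: "y (k - 1) = 0" using co[OF k1] tk[of "k - 1"] r yy by simp
    then have "(0, simplex_value k (k - 1)) \<in> generated_subgroup (facet_values x y)"
      using k1 by (intro generated_inc) (auto simp: facet_values_def)
    moreover have "(0, t + t' + simplex_value k (k - 1)) \<in> generated_subgroup (facet_values x y)"
    proof (rule zero_support_isotropy')
      fix i assume i: "(t + t' + simplex_value k (k - 1)) i \<noteq> 0"
      then have ik: "i < k - 1" using tk[of i] by (cases "i < k - 1") (auto simp: simplex_value_def)
      moreover have "y i = 0"
      proof (rule ccontr)
        assume yi: "y i \<noteq> 0"
        have "i < k" using ik by simp
        then have "sgn_bit (t' i) * y i = sgn_bit (t i + 1) * y i" using co[of i] r yy by simp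
        then have "sgn_bit (t' i) = sgn_bit (t i + 1)" using mult_right_cancel[OF yi] by blast
        then have "t' i = t i + 1" using sgn_bit_inj by blast
        then show False using i ik by (simp add: simplex_value_def)
      qed
      ultimately show "i < k - 1 \<and> y i = 0" by blast
    qed
    ultimately have "(0, t + t' + simplex_value k (k - 1)) + (0, simplex_value k (k - 1)) \<in> generated_subgroup (facet_values x y)"
      using generated_add by blast
    moreover have "(0, t + t' + simplex_value k (k - 1)) + (0, simplex_value k (k - 1)) = (0 :: base_group, t + t')"
      by (simp add: prod_eq_iff fun_eq_iff add.assoc)
    ultimately show ?thesis by simp
  qed
  with yy show ?thesis by blast
qed

text \<open>
  An element of the isotropy group moves the second point to the sheet \<open>{g} \<times> P\<close> of the first one.
\<close>

lemma \<Phi>_eq_iff: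
  assumes z: "z \<in> G" "z' \<in> G" and x: "x \<in> P" "x' \<in> P" and y: "y \<in> \<Delta>" "y' \<in> \<Delta>"
  shows "\<Phi> (z, (x, y)) = \<Phi> (z', (x', y')) \<longleftrightarrow> x = x' \<and> y = y' \<and> z + z' \<in> generated_subgroup (facet_values x y)"
proof
  assume eq: "\<Phi> (z, (x, y)) = \<Phi> (z', (x', y'))"
  obtain g t where z1: "z = (g, t)" by fastforce
  obtain g' t' where z2: "z' = (g', t')" by fastforce
  obtain r where r: "r \<noteq> 0" "vec (z', (x', y')) = vb_scale W r (vec (z, (x, y)))"
    using eq line_through_eq_iff[OF vec_nonzero[OF x(1) y(1)] vec_nonzero[OF x(2) y(2)]] unfolding \<Phi>_def z1 z2 by blast
  have "q (g', x') = q (g, x)"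
    using arg_cong[OF r(2), of "vb_proj W"] vec_in[OF x(1)] vec_in[OF x(2)] proj_scale_W by (simp add: z1 z2)
  then have xx: "x' = x" and d: "g + g' \<in> iso x" using kernel[OF x(2,1)] by (auto simp: iso_def add.commute)
  obtain D where D: "D \<in> generated_subgroup (facet_values x y)" "fst D = g + g'" using isotropy_lift[OF d] by blast
  have DG: "D \<in> G" and D\<Phi>: "\<Phi> (z + D, (x, y)) = \<Phi> (z, (x, y))"
    using isotropy_fixes[OF x(1) y(1) D(1)] by blast+
  have zD: "z + D = (g', t + snd D)" using D(2) by (simp add: z1 prod_eq_iff)
  have "\<Phi> ((g', t + snd D), (x, y)) = \<Phi> ((g', t'), (x, y'))"
    using D\<Phi> eq unfolding zD z2 xx by simp
  moreover have "(g', t + snd D) \<in> G" using bundle_group_add[OF z(1) DG] unfolding zD .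
  ultimately have "y = y'" and e: "(0, t + snd D + t') \<in> generated_subgroup (facet_values x y)"
    using same_sheet[OF x(1) y] z(2) unfolding z2 by blast+
  have "z + z' = D + (0, t + snd D + t')"
    using D(2) by (auto simp: z1 z2 prod_eq_iff fun_eq_iff add_ac)
  then show "x = x' \<and> y = y' \<and> z + z' \<in> generated_subgroup (facet_values x y)"
    using xx \<open>y = y'\<close> generated_add[OF D(1) e] by simp
next
  assume *: "x = x' \<and> y = y' \<and> z + z' \<in> generated_subgroup (facet_values x y)"
  then have "\<Phi> (z + (z + z'), (x, y)) = \<Phi> (z, (x, y))" using isotropy_fixes[OF x(1) y(1)] by blast
  moreover have "z + (z + z') = z'" by (simp add: add.assoc[symmetric])
  ultimately show "\<Phi> (z, (x, y)) = \<Phi> (z', (x', y'))" using * by simp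
qed

end

lemma bundle_group_zero: "(0 :: base_group \<times> (nat \<Rightarrow> bit)) \<in> bundle_group k"
  by (simp add: bundle_group_def zero_prod_def)

context framed_sum
begin

lemma projective_characteristic_\<nu>: "projective_characteristic k P \<nu>"
  unfolding projective_characteristic_def
  using polygon characteristic \<nu>_in by (simp add: \<nu>_def)

lemma lift_automorphism: "group_automorphism G (\<lambda>(g, t). (\<psi> g, t))"
proof -
  have "bij_betw (\<lambda>(g, t). (\<psi> g, t)) G G"
    by (rule bij_betwI[where g = "\<lambda>(g, t). (\<psi>' g, t)"]) (auto simp: bundle_group_def inv_\<psi>)
  then show ?thesis unfolding group_automorphism_def by (auto simp: \<psi>_add)
qed

lemma surface_isotropy: "isotropy_at {(F, \<mu> F) | F. F \<in> facets P} x = iso x"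
proof -
  have "{v. \<exists>F. (F, v) \<in> {(F, \<mu> F) | F. F \<in> facets P} \<and> x \<in> F} = {\<mu> F | F. F \<in> facets P \<and> x \<in> F}"
    by blast
  then show ?thesis by (simp only: isotropy_at_def iso_def)
qed

lemma base_homeomorphism:
  obtains h where "weak_equivariant_map UNIV \<psi> M a (surface_cover P \<mu>) glued_action h"
    "\<And>g x. x \<in> P \<Longrightarrow> h (q (g, x)) = glue_class UNIV {(F, \<mu> F) | F. F \<in> facets P} (g, x)"
proof -
  let ?C = "{(F, \<mu> F) | F. F \<in> facets P}"
  have quo: "quotient_map X (surface_cover P \<mu>) (glue_class UNIV ?C)"
    unfolding surface_cover_def glued_space_def by (rule quotient_map_quotient_top)
  have eq: "q z = q w \<longleftrightarrow> glue_class UNIV ?C z = glue_class UNIV ?C w"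
    if zt: "z \<in> topspace X" and wt: "w \<in> topspace X" for z w
  proof -
    obtain g x where z: "z = (g, x)" "x \<in> P" using zt by auto
    obtain g' x' where w: "w = (g', x')" "x' \<in> P" using wt by auto
    have "q z = q w \<longleftrightarrow> x = x' \<and> g + g' \<in> iso x"
      unfolding z w using kernel[OF z(2) w(2)] by (simp add: iso_def)
    also have "\<dots> \<longleftrightarrow> glue_class UNIV ?C z = glue_class UNIV ?C w"
      unfolding z(1) w(1) glue_class_eq_iff[OF UNIV_I UNIV_I] surface_isotropy by simp
    finally show ?thesis .
  qed
  obtain h where h: "homeomorphic_map M (surface_cover P \<mu>) h"
    "\<And>z. z \<in> topspace X \<Longrightarrow> h (q z) = glue_class UNIV ?C z"
    using quotient_homeomorphism[OF quotient quo eq] by blast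
  have hq: "h (q (g, x)) = glue_class UNIV ?C (g, x)" if "x \<in> P" for g x
    using h(2)[of "(g, x)"] that by simp
  have "h (a g m) = glued_action (\<psi> g) (h m)" if m: "m \<in> topspace M" for g m
  proof -
    obtain g' x where x: "x \<in> P" "q (g', x) = m" using m by (rule surjE)
    have "h (a g m) = glue_class UNIV ?C (\<psi> g + g', x)"
      using x hq action by (simp add: x(2)[symmetric])
    also have "\<dots> = glued_action (\<psi> g) (glue_class UNIV ?C (g', x))"
      by (rule glued_action_glue_class[symmetric]) auto
    finally show ?thesis unfolding x(2)[symmetric] hq[OF x(1)] .
  qed
  then have "weak_equivariant_map UNIV \<psi> M a (surface_cover P \<mu>) glued_action h"
    unfolding weak_equivariant_map_def using h(1) automorphism by blast
  then show ?thesis using that hq by blast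
qed

text \<open>
  The small cover of \<open>(P, \<nu>)\<close> and the projectivization are quotients of the same space \<open>G \<times> P \<times> \<Delta>\<close>
  with the same fibres.
\<close>

theorem encoded:
  assumes A: "\<And>i. i < k \<Longrightarrow> lifts_action a (L i) (A i)" "\<And>i. i < k \<Longrightarrow> equivariant_frame (A i) (s i)"
  shows "encoded_by k M a L A (P, \<nu>)"
proof -
  let ?\<phi> = "\<lambda>(g, t). (\<psi> g, t)"
  let ?C = "bundle_characteristic k P \<nu>"
  let ?CS = "{(F, \<mu> F) | F. F \<in> facets P}"
  have quo: "quotient_map Z (bundle_cover k P \<nu>) (glue_class G ?C)"
    unfolding bundle_cover_def glued_space_def by (rule quotient_map_quotient_top)
  have eq: "\<Phi> z = \<Phi> w \<longleftrightarrow> glue_class G ?C z = glue_class G ?C w"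
    if z: "z \<in> topspace Z" and w: "w \<in> topspace Z" for z w
  proof -
    obtain g x y where z: "z = (g, (x, y))" "g \<in> G" "x \<in> P" "y \<in> \<Delta>"
      using z unfolding topspace_Z by blast
    obtain g' x' y' where w: "w = (g', (x', y'))" "g' \<in> G" "x' \<in> P" "y' \<in> \<Delta>"
      using w unfolding topspace_Z by blast
    have "\<Phi> z = \<Phi> w \<longleftrightarrow> x = x' \<and> y = y' \<and> g + g' \<in> generated_subgroup (facet_values x y)"
      unfolding z(1) w(1) by (rule \<Phi>_eq_iff[OF z(2) w(2) z(3) w(3) z(4) w(4)])
    also have "\<dots> \<longleftrightarrow> glue_class G ?C z = glue_class G ?C w"
      unfolding z(1) w(1) glue_class_eq_iff[OF z(2) w(2)] isotropy_values[OF z(3,4)] by simp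
    finally show ?thesis .
  qed
  obtain f where f: "homeomorphic_map (projectivization W) (bundle_cover k P \<nu>) f"
    "\<And>z. z \<in> topspace Z \<Longrightarrow> f (\<Phi> z) = glue_class G ?C z"
    using quotient_homeomorphism[OF quotient_\<Phi> quo eq] by blast
  have f\<Phi>: "f (\<Phi> (g, (x, y))) = glue_class G ?C (g, (x, y))" if "g \<in> G" "x \<in> P" "y \<in> \<Delta>" for g x y
    using f(2)[of "(g, (x, y))"] that by simp
  obtain h where h: "weak_equivariant_map UNIV \<psi> M a (surface_cover P \<mu>) glued_action h"
    "\<And>g x. x \<in> P \<Longrightarrow> h (q (g, x)) = glue_class UNIV ?CS (g, x)"
    using base_homeomorphism by blast
  have act: "projective_action k L A (b, r) (\<Phi> ((g, t), (x, y))) = \<Phi> (?\<phi> (b, r) + (g, t), (x, y))"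
    if br: "(b, r) \<in> G" and gt: "(g, t) \<in> G" and x: "x \<in> P" for b r g t x y
  proof -
    let ?m = "\<lambda>v. \<lambda>i\<in>{..<k}. vb_scale (L i) (if r i = 1 then - 1 else 1) (A i b (v i))"
    have "?m (vb_scale W c (vec ((g, t), (x, y)))) = vb_scale W c (vec ((\<psi> b + g, r + t), (x, y)))" for c
    proof (rule ext)
      fix i
      show "?m (vb_scale W c (vec ((g, t), (x, y)))) i = vb_scale W c (vec ((\<psi> b + g, r + t), (x, y))) i"
      proof (cases "i < k")
        case i: True
        have As: "A i b (vb_scale (L i) d v) = vb_scale (L i) d (A i b v)" if "v \<in> topspace (vb_total (L i))" for d v
          using A(1)[OF i] that unfolding lifts_action_def fibrewise_linear_def by blast
        have Ae: "A i b (s i g x) = s i (\<psi> b + g) x" using A(2)[OF i] x unfolding equivariant_frame_def by blast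
        have "(if r i = 1 then - 1 else 1) = sgn_bit (r i)" by (simp add: sgn_bit_def)
        then have "?m (vb_scale W c (vec ((g, t), (x, y)))) i
            = vb_scale (L i) (sgn_bit (r i) * (c * (sgn_bit (t i) * y i))) (s i (\<psi> b + g) x)"
          using i by (simp add: scale_W vec_component As Ae sin[OF i x] line_bundle.scale_scale[OF lb[OF i]])
        also have "sgn_bit (r i) * (c * (sgn_bit (t i) * y i)) = c * (sgn_bit (r i + t i) * y i)"
          by (simp only: sgn_bit_simps mult_ac)
        finally show ?thesis
          using i by (simp add: scale_W vec_component sin[OF i x] line_bundle.scale_scale[OF lb[OF i]])
      next
        case False
        then show ?thesis by (simp add: scale_W)
      qed
    qed
    then show ?thesis
      unfolding \<Phi>_def line_through_def projective_action_def split image_image by (simp add: plus_prod_def)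
  qed
  have "f (projective_action k L A gr l) = glued_action (?\<phi> gr) (f l)"
    if gr: "gr \<in> G" and l: "l \<in> topspace (projectivization W)" for gr l
  proof -
    obtain v where "v \<in> nonzero_vectors W" "l = line_through W v" using l unfolding topspace_lines by blast
    then obtain g t x y where z: "(g, t) \<in> G" "x \<in> P" "y \<in> \<Delta>" "l = \<Phi> ((g, t), (x, y))" using line_eq_\<Phi> by metis
    obtain b r where br: "gr = (b, r)" by fastforce
    have \<phi>G: "?\<phi> gr \<in> G" using gr by (auto simp: br bundle_group_def)
    have "f (projective_action k L A gr l) = glue_class G ?C (?\<phi> gr + (g, t), (x, y))"
      unfolding z(4) br act[OF gr[unfolded br] z(1,2)]
      by (rule f\<Phi>[OF bundle_group_add[OF \<phi>G[unfolded br] z(1)] z(2,3)])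
    also have "\<dots> = glued_action (?\<phi> gr) (glue_class G ?C ((g, t), (x, y)))"
      by (rule glued_action_glue_class[symmetric]) (use \<phi>G bundle_group_add in auto)
    finally show ?thesis using f\<Phi>[OF z(1-3)] z(4) by simp
  qed
  then have f': "weak_equivariant_map G ?\<phi> (projectivization W) (projective_action k L A) (bundle_cover k P \<nu>) glued_action f"
    unfolding weak_equivariant_map_def using f(1) lift_automorphism by blast
  have proj: "(\<lambda>((g, t), (x, y)). (g, x)) ` f (line_through W v) = h (vb_proj W v)" if v: "v \<in> nonzero_vectors W" for v
  proof -
    obtain g t x y where z: "(g, t) \<in> G" "x \<in> P" "y \<in> \<Delta>" "line_through W v = \<Phi> ((g, t), (x, y))" "vb_proj W v = q (g, x)"
      by (rule line_eq_\<Phi>[OF v])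
    have 1: "f (line_through W v) = {(t', (x, y)) | t'. t' \<in> G \<and> (g, t) + t' \<in> generated_subgroup (facet_values x y)}"
      unfolding z(4) f\<Phi>[OF z(1-3)] by (simp add: glue_class_def isotropy_values[OF z(2,3)])
    have 2: "h (vb_proj W v) = {(g', x) | g'. g + g' \<in> iso x}"
      unfolding z(5) h(2)[OF z(2)] by (simp add: glue_class_def surface_isotropy)
    show ?thesis
      unfolding 1 2
    proof (intro equalityI subsetI)
      fix m assume "m \<in> (\<lambda>((g, t), (x, y)). (g, x)) ` {(t', (x, y)) | t'. t' \<in> G \<and> (g, t) + t' \<in> generated_subgroup (facet_values x y)}"
      then obtain g' t' where m: "m = (g', x)" "(g, t) + (g', t') \<in> generated_subgroup (facet_values x y)" by auto
      from isotropy_fst[OF m(2)] show "m \<in> {(g', x) | g'. g + g' \<in> iso x}" using m(1) by simp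
    next
      fix m assume "m \<in> {(g', x) | g'. g + g' \<in> iso x}"
      then obtain g' where m: "m = (g', x)" "g + g' \<in> iso x" by blast
      obtain D where D: "D \<in> generated_subgroup (facet_values x y)" "fst D = g + g'" using isotropy_lift[OF m(2)] by blast
      have DG: "D \<in> G" using isotropy_fixes[OF z(2,3) D(1)] by blast
      have "(g, t) + ((g, t) + D) = D" by (simp add: add.assoc[symmetric])
      then have "(g, t) + ((g, t) + D) \<in> generated_subgroup (facet_values x y)" using D(1) by (simp only:)
      then have "((g, t) + D, (x, y)) \<in> {(t', (x, y)) | t'. t' \<in> G \<and> (g, t) + t' \<in> generated_subgroup (facet_values x y)}"
        using bundle_group_add[OF z(1) DG] by blast
      moreover have "(\<lambda>((g, t), (x, y)). (g, x)) ((g, t) + D, (x, y)) = m"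
        using D(2) m(1) by (simp add: split_def)
      ultimately show "m \<in> (\<lambda>((g, t), (x, y)). (g, x)) ` {(t', (x, y)) | t'. t' \<in> G \<and> (g, t) + t' \<in> generated_subgroup (facet_values x y)}"
        by (metis (no_types, lifting) imageI)
    qed
  qed
  have \<mu>: "(\<lambda>F. fst (\<nu> F)) = \<mu>" by (simp add: \<nu>_def)
  have \<phi>\<psi>: "\<forall>g\<in>G. fst (?\<phi> g) = \<psi> (fst g)" by auto
  show ?thesis
    unfolding encoded_by_def split \<mu>
    using projective_characteristic_\<nu> f' h(1) \<phi>\<psi> proj by blast
qed

end

section \<open>Line bundles with prescribed signs\<close>

definition character :: "(base_group \<Rightarrow> bit) \<Rightarrow> bool" where
  "character \<theta> \<longleftrightarrow> (\<forall>v w. \<theta> (v + w) = \<theta> v + \<theta> w)"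

lemma character_exists:
  fixes a b :: base_group
  assumes "a \<noteq> 0" "b \<noteq> 0" "a \<noteq> b"
  obtains \<theta> where "character \<theta>" "\<theta> a = \<alpha>" "\<theta> b = \<beta>"
proof -
  have add: "character (\<lambda>v. c * v $ 1 + d * v $ 2)" for c d :: bit
    unfolding character_def by (intro allI) (simp only: vector_add_component distrib_left add_ac)
  have "\<exists>c d :: bit. c * a $ 1 + d * a $ 2 = \<alpha> \<and> c * b $ 1 + d * b $ 2 = \<beta>"
  proof -
    define D where "D = a $ 1 * b $ 2 + a $ 2 * b $ 1"
    have D: "D = 1"
      using assms unfolding D_def
      by (cases "a $ 1"; cases "a $ 2"; cases "b $ 1"; cases "b $ 2") (auto simp: vec_eq_iff forall_2)
    show ?thesis
      using D unfolding D_def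
      by (intro exI[of _ "\<alpha> * b $ 2 + \<beta> * a $ 2"] exI[of _ "\<alpha> * b $ 1 + \<beta> * a $ 1"])
        (cases "a $ 1"; cases "a $ 2"; cases "b $ 1"; cases "b $ 2"; simp)
  qed
  then show ?thesis using that add by blast
qed

lemma character_zero: "character \<theta> \<Longrightarrow> \<theta> 0 = 0"
  unfolding character_def by (metis add_cancel_right_right)

lemma homeomorphic_maps_imp_quotient_map:
  assumes "homeomorphic_maps A B f g"
  shows "quotient_map A B f"
proof -
  have "homeomorphic_map A B f" using assms unfolding homeomorphic_maps_map by (elim conjE)
  then show ?thesis unfolding homeomorphic_map_def by (rule conjunct1)
qed

context surface_model
begin

lemma facet_neighbour:
  assumes F: "F \<in> facets P"
  obtains G x where "G \<in> facets P" "F \<noteq> G" "x \<in> F" "x \<in> G"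
proof -
  obtain G H where "{K \<in> facets P. K \<noteq> F \<and> F \<inter> K \<noteq> {}} = {G, H}"
    using facet_two_neighbours[OF polygon F] .
  then have "G \<in> {K \<in> facets P. K \<noteq> F \<and> F \<inter> K \<noteq> {}}" by simp
  then have "G \<in> facets P" "F \<noteq> G" "F \<inter> G \<noteq> {}" by auto
  then show ?thesis using that by (metis disjoint_iff)
qed

text \<open>
  If the fibre coordinate is to change by the sign of \<open>F\<close> upon crossing each edge \<open>F\<close> through \<open>x\<close>, then
  its changes between all copies of \<open>P\<close> that meet at \<open>x\<close> are given by such a character.
\<close>

definition matching :: "(plane set \<Rightarrow> bit) \<Rightarrow> plane \<Rightarrow> (base_group \<Rightarrow> bit) \<Rightarrow> bool" where
  "matching \<epsilon> x \<theta> \<longleftrightarrow> character \<theta> \<and> (\<forall>F\<in>facets P. x \<in> F \<longrightarrow> \<theta> (\<mu> F) = \<epsilon> F)"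

text \<open>At most two edges meet in a point, and their values are independent.\<close>

lemma matching_exists: "\<exists>\<theta>. matching \<epsilon> x \<theta>"
proof -
  have two: "\<exists>\<theta>. matching \<epsilon> x \<theta>"
    if FG: "F \<in> facets P" "G \<in> facets P" "F \<noteq> G" "F \<inter> G \<noteq> {}"
      and only: "\<And>H. H \<in> facets P \<Longrightarrow> x \<in> H \<Longrightarrow> H = F \<or> H = G" for F G
  proof -
    obtain y where y: "y \<in> F" "y \<in> G" using FG(4) by blast
    obtain \<theta> where \<theta>: "character \<theta>" "\<theta> (\<mu> F) = \<epsilon> F" "\<theta> (\<mu> G) = \<epsilon> G"
      using character_exists[OF characteristic_meet[OF FG(1-3) y]] .
    have "\<theta> (\<mu> H) = \<epsilon> H" if "H \<in> facets P" "x \<in> H" for H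
      using only[OF that] \<theta>(2,3) by (elim disjE) simp_all
    then show ?thesis using \<theta>(1) unfolding matching_def by blast
  qed
  show ?thesis
  proof (cases "\<exists>F\<in>facets P. x \<in> F")
    case False
    moreover have "character (\<lambda>_. 0)" by (simp add: character_def)
    ultimately show ?thesis unfolding matching_def by blast
  next
    case True
    then obtain F where F: "F \<in> facets P" "x \<in> F" by blast
    show ?thesis
    proof (cases "\<exists>G\<in>facets P. x \<in> G \<and> G \<noteq> F")
      case True
      then obtain G where G: "G \<in> facets P" "x \<in> G" "G \<noteq> F" by blast
      show ?thesis
      proof (rule two[OF F(1) G(1) G(3)[symmetric]])
        show "F \<inter> G \<noteq> {}" using F G by blast
        show "H = F \<or> H = G" if "H \<in> facets P" "x \<in> H" for H
          using at_most_two_facets[OF polygon F(1) G(1) that(1) G(3)[symmetric] _ _ F(2) G(2) that(2)] by metis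
      qed
    next
      case False
      obtain G y where G: "G \<in> facets P" "F \<noteq> G" "y \<in> F" "y \<in> G" using facet_neighbour[OF F(1)] .
      show ?thesis
        by (rule two[OF F(1) G(1,2)]) (use G False in blast)+
    qed
  qed
qed

lemma matching_agree:
  assumes "matching \<epsilon> x \<theta>" "matching \<epsilon> x \<theta>'" "d \<in> iso x"
  shows "\<theta> d = \<theta>' d"
  using assms(3) unfolding iso_def
proof (induction rule: generated_induct)
  case (generator d)
  then show ?case using assms(1,2) unfolding matching_def by auto
next
  case zero
  have "\<theta> 0 = 0" "\<theta>' 0 = 0" using assms(1,2) character_zero unfolding matching_def by blast+
  then show ?case by simp
next
  case (diff d e)
  have eq: "d - e = d + e" by (metis bit_vec_uminus diff_conv_add_uminus)
  have "\<theta> (d + e) = \<theta> d + \<theta> e" "\<theta>' (d + e) = \<theta>' d + \<theta>' e"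
    using assms(1,2) unfolding matching_def character_def by blast+
  then show ?case unfolding eq using diff by (simp only:)
qed

context
  fixes \<epsilon> :: "plane set \<Rightarrow> bit"
begin

text \<open>
  The bundle depends only on the restriction of \<open>\<theta> x\<close> to the isotropy group of \<open>x\<close>, on which all
  matching characters agree.
\<close>

definition \<theta> :: "plane \<Rightarrow> base_group \<Rightarrow> bit" where
  "\<theta> x = (SOME \<theta>. matching \<epsilon> x \<theta>)"

lemma matching_\<theta>: "matching \<epsilon> x (\<theta> x)"
  unfolding \<theta>_def by (rule someI_ex[OF matching_exists])

lemma character_\<theta>: "\<theta> x (v + w) = \<theta> x v + \<theta> x w"
  using matching_\<theta> unfolding matching_def character_def by blast

text \<open>
  The class of \<open>(g, x, r)\<close> under the identifications of \<open>(g, x, r)\<close> with \<open>(g + d, x, \<plusminus>r)\<close> for \<open>d\<close> in the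
  isotropy group of \<open>x\<close>.
\<close>

definition cl :: "(base_group \<times> plane) \<times> real \<Rightarrow> line_carrier" where
  "cl = (\<lambda>((g, x), r). {(g', x, r') | g' r'. g + g' \<in> iso x \<and> r' = sgn_bit (\<theta> x (g + g')) * r})"

lemma iso_zero: "0 \<in> iso x" and iso_add: "d \<in> iso x \<Longrightarrow> e \<in> iso x \<Longrightarrow> d + e \<in> iso x"
  unfolding iso_def by (rule subgroup_generated(1)) (rule generated_add)

lemma mem_cl: "(g', x', r') \<in> cl ((g, x), r) \<longleftrightarrow> x' = x \<and> g + g' \<in> iso x \<and> r' = sgn_bit (\<theta> x (g + g')) * r"
  by (auto simp: cl_def)

lemma cl_refl: "(g, x, r) \<in> cl ((g, x), r)"
  using character_\<theta>[of x 0 0] by (simp add: mem_cl iso_zero)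

lemma cl_eq_iff: "cl ((g, x), r) = cl ((g', x'), r') \<longleftrightarrow> x' = x \<and> g + g' \<in> iso x \<and> r' = sgn_bit (\<theta> x (g + g')) * r"
proof
  assume "cl ((g, x), r) = cl ((g', x'), r')"
  then have "(g', x', r') \<in> cl ((g, x), r)" using cl_refl by simp
  then show "x' = x \<and> g + g' \<in> iso x \<and> r' = sgn_bit (\<theta> x (g + g')) * r" by (simp add: mem_cl)
next
  assume *: "x' = x \<and> g + g' \<in> iso x \<and> r' = sgn_bit (\<theta> x (g + g')) * r"
  have "(h, y, t) \<in> cl ((g, x), r) \<longleftrightarrow> (h, y, t) \<in> cl ((g', x'), r')" for h y t
  proof -
    have e: "g' + h = (g + g') + (g + h)" by (simp add: add_ac)
    have e': "g + h = (g + g') + (g' + h)" by (simp add: add_ac)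
    have i: "g' + h \<in> iso x \<longleftrightarrow> g + h \<in> iso x" using * iso_add e e' by metis
    have "\<theta> x (g' + h) = \<theta> x (g + g') + \<theta> x (g + h)" by (subst e) (rule character_\<theta>)
    then have "sgn_bit (\<theta> x (g' + h)) = sgn_bit (\<theta> x (g + g')) * sgn_bit (\<theta> x (g + h))"
      by (simp only: sgn_bit_simps(3))
    then have "sgn_bit (\<theta> x (g' + h)) * r' = (sgn_bit (\<theta> x (g + g')) * sgn_bit (\<theta> x (g + g'))) * (sgn_bit (\<theta> x (g + h)) * r)"
      using * by (simp only: mult_ac)
    then have eq: "sgn_bit (\<theta> x (g' + h)) * r' = sgn_bit (\<theta> x (g + h)) * r" by simp
    have "x' = x" using * by blast
    then show ?thesis by (simp only: mem_cl i eq)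
  qed
  then show "cl ((g, x), r) = cl ((g', x'), r')"
    by (simp only: Set.set_eq_iff split_paired_All) blast
qed

abbreviation "Y \<equiv> prod_topology X euclideanreal"

definition sign_bundle :: "(line_carrier, 'm) vbundle" where
  "sign_bundle =
     \<lparr> vb_total = quotient_top Y cl, vb_base = M,
       vb_proj = (\<lambda>c. the_elem ((\<lambda>(g, x, r). q (g, x)) ` c)),
       vb_add = (\<lambda>c c'. {(g, x, r + r') | g x r r'. (g, x, r) \<in> c \<and> (g, x, r') \<in> c'}),
       vb_scale = (\<lambda>t c. (\<lambda>(g, x, r). (g, x, t * r)) ` c) \<rparr>"

abbreviation "E \<equiv> vb_total sign_bundle"

lemma base_sign: "vb_base sign_bundle = M" by (simp add: sign_bundle_def)

lemma quotient_cl: "quotient_map Y E cl"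
  unfolding sign_bundle_def vbundle.simps by (rule quotient_map_quotient_top)

lemma topspace_Y: "topspace Y = (UNIV \<times> P) \<times> UNIV" by simp

lemma in_E: "x \<in> P \<Longrightarrow> cl ((g, x), r) \<in> topspace E"
  using quotient_imp_surjective_map[OF quotient_cl] unfolding topspace_Y by blast

lemma E_cases:
  assumes "c \<in> topspace E"
  obtains g x r where "x \<in> P" "c = cl ((g, x), r)"
  using assms quotient_imp_surjective_map[OF quotient_cl] unfolding topspace_Y by blast

lemma proj_cl:
  assumes x: "x \<in> P" shows "vb_proj sign_bundle (cl ((g, x), r)) = q (g, x)"
proof -
  have "(\<lambda>(g, x, r). q (g, x)) ` cl ((g, x), r) = {q (g, x)}"
  proof (intro equalityI subsetI)
    fix m assume "m \<in> (\<lambda>(g, x, r). q (g, x)) ` cl ((g, x), r)"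
    then obtain g' where "m = q (g', x)" "g + g' \<in> iso x" by (auto simp: cl_def)
    then show "m \<in> {q (g, x)}" using kernel'[OF x, of g "g + g'"] by simp
  next
    fix m assume "m \<in> {q (g, x)}"
    then show "m \<in> (\<lambda>(g, x, r). q (g, x)) ` cl ((g, x), r)" using cl_refl[of g x r] by force
  qed
  then show ?thesis by (simp add: sign_bundle_def)
qed

lemma add_cl: "vb_add sign_bundle (cl ((g, x), r)) (cl ((g, x), r')) = cl ((g, x), r + r')"
  by (auto simp: sign_bundle_def cl_def algebra_simps)

lemma scale_cl: "vb_scale sign_bundle t (cl ((g, x), r)) = cl ((g, x), t * r)"
proof -
  have "(\<lambda>(g, x, r). (g, x, t * r)) ` cl ((g, x), r) = cl ((g, x), t * r)"
  proof (intro equalityI subsetI)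
    fix c assume "c \<in> cl ((g, x), t * r)"
    then obtain g' where g': "c = (g', x, sgn_bit (\<theta> x (g + g')) * (t * r))" "g + g' \<in> iso x"
      by (auto simp: cl_def)
    then have "(g', x, sgn_bit (\<theta> x (g + g')) * r) \<in> cl ((g, x), r)" by (simp only: mem_cl)
    moreover have "c = (\<lambda>(g, x, r). (g, x, t * r)) (g', x, sgn_bit (\<theta> x (g + g')) * r)"
      unfolding g'(1) split by (simp only: mult.left_commute)
    ultimately show "c \<in> (\<lambda>(g, x, r). (g, x, t * r)) ` cl ((g, x), r)" by (rule rev_image_eqI)
  qed (auto simp: cl_def)
  then show ?thesis by (simp add: sign_bundle_def)
qed

lemma same_fibre:
  assumes "x \<in> P" "x' \<in> P" "q (g, x) = q (g', x')"
  obtains r'' where "cl ((g', x'), r') = cl ((g, x), r'')"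
proof -
  have "x = x'" "g' + g \<in> iso x" using kernel[OF assms(1,2)] assms(3) by (auto simp: iso_def add.commute)
  then have "cl ((g', x'), r') = cl ((g, x), sgn_bit (\<theta> x (g' + g)) * r')" by (simp add: cl_eq_iff)
  then show ?thesis by (rule that)
qed

text \<open>
  Near \<open>x0\<close> only the edges through \<open>x0\<close> matter, so that a single character trivializes the bundle
  over the image of this neighbourhood.
\<close>

lemma sign_bundle_trivial:
  assumes x0: "x0 \<in> P"
  defines "V \<equiv> {x \<in> P. \<forall>F\<in>facets P. x \<in> F \<longrightarrow> x0 \<in> F}"
  defines "U \<equiv> q ` (UNIV \<times> V)"
  defines "EU \<equiv> {c \<in> topspace E. vb_proj sign_bundle c \<in> U}"
  obtains T where "openin M U"
    "homeomorphic_map (subtopology E EU) (prod_topology (subtopology M U) (Euclidean_space 1)) T"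
    "\<And>g x r. x \<in> V \<Longrightarrow> T (cl ((g, x), r)) = (q (g, x), \<lambda>i. if i < 1 then sgn_bit (\<theta> x0 g) * r else 0)"
    "EU = cl ` ((UNIV \<times> V) \<times> UNIV)"
proof -
  have VP: "V \<subseteq> P" unfolding V_def by blast
  define K where "K = \<Union>{F \<in> facets P. x0 \<notin> F}"
  have "closed K"
    unfolding K_def using finite_facets[OF polygon] facet_closed[OF polygon] by (intro closed_Union) auto
  moreover have "V = P \<inter> - K" unfolding V_def K_def by blast
  ultimately have opV: "openin (top_of_set P) V" by (metis open_Compl openin_open_Int)
  have sat: "{z \<in> topspace X. q z \<in> U} = UNIV \<times> V"
  proof (intro equalityI subsetI)
    fix z assume "z \<in> {z \<in> topspace X. q z \<in> U}"
    then obtain g x g' x' where z: "z = (g, x)" "x \<in> P" "x' \<in> V" "q (g, x) = q (g', x')" unfolding U_def by auto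
    then have "x = x'" using kernel[OF z(2), of x' g g'] VP by auto
    then show "z \<in> UNIV \<times> V" using z by simp
  next
    fix z :: "base_group \<times> plane" assume "z \<in> UNIV \<times> V"
    then show "z \<in> {z \<in> topspace X. q z \<in> U}" unfolding U_def using VP by auto
  qed
  have UM: "U \<subseteq> topspace M" unfolding U_def topspace_M using VP by blast
  have opX: "openin X (UNIV \<times> V)" using opV by (simp add: openin_prod_Times_iff)
  have opU: "openin M U"
  proof -
    have "\<forall>U. U \<subseteq> topspace M \<longrightarrow> openin X {z \<in> topspace X. q z \<in> U} = openin M U"
      using quotient unfolding quotient_map_def by (rule conjunct2)
    from this[rule_format, OF UM] show ?thesis unfolding sat using opX by (rule iffD1)
  qed
  have qU: "quotient_map (subtopology X (UNIV \<times> V)) (subtopology M U) q"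
    by (rule quotient_map_restriction[OF quotient sat]) (use opU in blast)
  have pre: "{z \<in> topspace Y. cl z \<in> EU} = (UNIV \<times> V) \<times> UNIV"
  proof (intro equalityI subsetI)
    fix z assume "z \<in> {z \<in> topspace Y. cl z \<in> EU}"
    then obtain g x r where z: "z = ((g, x), r)" "x \<in> P" "q (g, x) \<in> U"
      unfolding EU_def topspace_Y by (auto simp: proj_cl)
    then have "(g, x) \<in> {z \<in> topspace X. q z \<in> U}" by simp
    then show "z \<in> (UNIV \<times> V) \<times> UNIV" unfolding sat z(1) by simp
  next
    fix z assume "z \<in> ((UNIV :: base_group set) \<times> V) \<times> (UNIV :: real set)"
    then obtain g x r where z: "z = ((g, x), r)" "x \<in> V" by auto
    then have "x \<in> P" using VP by blast
    then have "cl z \<in> EU" using z in_E by (auto simp: EU_def proj_cl U_def)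
    then show "z \<in> {z \<in> topspace Y. cl z \<in> EU}" using z(1) \<open>x \<in> P\<close> by simp
  qed
  have img: "EU = cl ` ((UNIV \<times> V) \<times> UNIV)"
  proof -
    have "EU \<subseteq> topspace E" unfolding EU_def by blast
    then have "EU \<subseteq> cl ` topspace Y" using quotient_imp_surjective_map[OF quotient_cl] by simp
    then have "EU = cl ` {z \<in> topspace Y. cl z \<in> EU}" by blast
    then show ?thesis unfolding pre .
  qed
  have opY: "openin Y ((UNIV \<times> V) \<times> UNIV)"
    using opX by (simp only: openin_prod_Times_iff) simp
  have opE: "openin E EU"
  proof -
    have "\<forall>U. U \<subseteq> topspace E \<longrightarrow> openin Y {z \<in> topspace Y. cl z \<in> U} = openin E U"
      using quotient_cl unfolding quotient_map_def by (rule conjunct2)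
    moreover have "EU \<subseteq> topspace E" unfolding EU_def by blast
    ultimately have "openin Y {z \<in> topspace Y. cl z \<in> EU} = openin E EU" by blast
    then show ?thesis unfolding pre using opY by (rule iffD1)
  qed
  have sub: "subtopology Y ((UNIV \<times> V) \<times> UNIV) = prod_topology (subtopology X (UNIV \<times> V)) euclideanreal"
    using prod_topology_subtopology(1)[of X "UNIV \<times> V" euclideanreal] by simp
  let ?YV = "prod_topology (subtopology X (UNIV \<times> V)) euclideanreal"
  have q1: "quotient_map ?YV (subtopology E EU) cl"
    unfolding sub[symmetric] by (rule quotient_map_restriction[OF quotient_cl pre]) (use opE in blast)
  let ?e = "\<lambda>r i. if i < (1::nat) then r else (0::real)"
  define \<sigma> where "\<sigma> z = sgn_bit (\<theta> x0 (fst z))" for z :: "base_group \<times> plane"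
  have c\<sigma>: "continuous_map X euclideanreal \<sigma>"
    by (simp add: continuous_map_from_discrete_prod \<sigma>_def)
  have "continuous_map ?YV euclideanreal (\<lambda>w. \<sigma> (fst w))"
    using continuous_map_compose[OF continuous_map_fst continuous_map_from_subtopology[OF c\<sigma>], of "UNIV \<times> V" euclideanreal]
    by (simp add: o_def)
  then have twist: "continuous_map ?YV ?YV (\<lambda>w. (fst w, \<sigma> (fst w) * snd w))"
    by (intro continuous_map_pairedI continuous_map_fst continuous_map_real_mult continuous_map_snd)
  have "homeomorphic_maps ?YV ?YV (\<lambda>w. (fst w, \<sigma> (fst w) * snd w)) (\<lambda>w. (fst w, \<sigma> (fst w) * snd w))"
    unfolding homeomorphic_maps_def using twist by (auto simp: \<sigma>_def mult.assoc[symmetric])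
  then have 1: "quotient_map ?YV ?YV (\<lambda>w. (fst w, \<sigma> (fst w) * snd w))"
    by (rule homeomorphic_maps_imp_quotient_map)
  have 2: "quotient_map ?YV (prod_topology (subtopology M U) euclideanreal) (\<lambda>(z, r). (q z, r))"
    by (rule quotient_map_prod_left[OF _ _ qU]) (simp_all add: locally_compact_space_euclidean Hausdorff_space_euclidean)
  obtain e' where "homeomorphic_maps euclideanreal (Euclidean_space 1) ?e e'"
    using homeomorphic_map_real_Euclidean_space_1 unfolding homeomorphic_map_maps by blast
  moreover have "homeomorphic_maps (subtopology M U) (subtopology M U) (\<lambda>m. m) (\<lambda>m. m)"
    by (simp add: homeomorphic_maps_def)
  ultimately have "homeomorphic_maps (prod_topology (subtopology M U) euclideanreal)
      (prod_topology (subtopology M U) (Euclidean_space 1)) (\<lambda>(m, r). (m, ?e r)) (\<lambda>(m, r). (m, e' r))"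
    unfolding homeomorphic_maps_prod by blast
  then have 3: "quotient_map (prod_topology (subtopology M U) euclideanreal)
      (prod_topology (subtopology M U) (Euclidean_space 1)) (\<lambda>(m, r). (m, ?e r))"
    by (rule homeomorphic_maps_imp_quotient_map)
  define f where "f = (\<lambda>(m, r). (m, ?e r)) \<circ> ((\<lambda>(z, r). (q z, r)) \<circ> (\<lambda>w. (fst w, \<sigma> (fst w) * snd w)))"
  have q2: "quotient_map ?YV (prod_topology (subtopology M U) (Euclidean_space 1)) f"
    unfolding f_def by (rule quotient_map_compose[OF quotient_map_compose[OF 1 2] 3])
  have f: "f ((g, x), r) = (q (g, x), ?e (sgn_bit (\<theta> x0 g) * r))" for g x r
    by (simp add: f_def \<sigma>_def)
  have eq: "cl z = cl w \<longleftrightarrow> f z = f w" if z: "z \<in> topspace ?YV" and w: "w \<in> topspace ?YV" for z w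
  proof -
    obtain g x r where z: "z = ((g, x), r)" "x \<in> V" using z by auto
    obtain g' x' r' where w: "w = ((g', x'), r')" "x' \<in> V" using w by auto
    have xP: "x \<in> P" "x' \<in> P" using z w VP by auto
    have e: "?e s = ?e t \<longleftrightarrow> s = t" for s t
    proof
      assume "?e s = ?e t"
      then have "?e s 0 = ?e t 0" by (rule fun_cong)
      then show "s = t" by simp
    next
      assume "s = t"
      then show "?e s = ?e t" by (rule arg_cong)
    qed
    have "f z = f w \<longleftrightarrow> (x' = x \<and> g + g' \<in> iso x) \<and> sgn_bit (\<theta> x0 g) * r = sgn_bit (\<theta> x0 g') * r'"
      unfolding z(1) w(1) f prod.inject e kernel[OF xP] iso_def by auto
    also have "\<dots> \<longleftrightarrow> (x' = x \<and> g + g' \<in> iso x) \<and> r' = sgn_bit (\<theta> x0 (g + g')) * r"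
    proof -
      have s: "sgn_bit (\<theta> x0 (g + g')) = sgn_bit (\<theta> x0 g') * sgn_bit (\<theta> x0 g)"
        by (simp only: character_\<theta> sgn_bit_simps mult.commute)
      have "sgn_bit b * t = u \<longleftrightarrow> t = sgn_bit b * u" for b t u by (cases b) auto
      from this[of "\<theta> x0 g'" r' "sgn_bit (\<theta> x0 g) * r"] show ?thesis unfolding s mult.assoc by metis
    qed
    also have "\<dots> \<longleftrightarrow> (x' = x \<and> g + g' \<in> iso x) \<and> r' = sgn_bit (\<theta> x (g + g')) * r"
    proof -
      have "matching \<epsilon> x (\<theta> x0)" using matching_\<theta>[of x0] z(2) unfolding matching_def V_def by blast
      then have "g + g' \<in> iso x \<Longrightarrow> \<theta> x0 (g + g') = \<theta> x (g + g')" using matching_agree matching_\<theta> by blast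
      then show ?thesis by auto
    qed
    also have "\<dots> \<longleftrightarrow> cl z = cl w" unfolding z(1) w(1) cl_eq_iff by blast
    finally show ?thesis by blast
  qed
  obtain T where T: "homeomorphic_map (subtopology E EU) (prod_topology (subtopology M U) (Euclidean_space 1)) T"
    "\<And>z. z \<in> topspace ?YV \<Longrightarrow> T (cl z) = f z"
    using quotient_homeomorphism[OF q1 q2 eq] by blast
  have "T (cl ((g, x), r)) = (q (g, x), ?e (sgn_bit (\<theta> x0 g) * r))" if "x \<in> V" for g x r
  proof -
    have "((g, x), r) \<in> topspace ?YV" using that VP by auto
    from T(2)[OF this] show ?thesis unfolding f .
  qed
  then show ?thesis by (intro that[OF opU T(1) _ img])
qed

lemma vector_bundle_sign_bundle: "vector_bundle 1 sign_bundle"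
  unfolding vector_bundle_def base_sign
proof (intro conjI ballI allI impI)
  have "continuous_map Y M (\<lambda>z. q (fst z))"
    using continuous_map_compose[OF continuous_map_fst quotient_imp_continuous_map[OF quotient]] by (simp add: o_def)
  then have "continuous_map Y M (vb_proj sign_bundle \<circ> cl)"
    by (rule continuous_map_eq) (auto simp: proj_cl)
  then show "continuous_map E M (vb_proj sign_bundle)" by (rule continuous_compose_quotient_map[OF quotient_cl])
next
  fix v w assume v: "v \<in> topspace E" and w: "w \<in> topspace E" and vw: "vb_proj sign_bundle v = vb_proj sign_bundle w"
  obtain g x r where v': "x \<in> P" "v = cl ((g, x), r)" using v by (rule E_cases)
  obtain g' x' r' where w': "x' \<in> P" "w = cl ((g', x'), r')" using w by (rule E_cases)
  have "q (g, x) = q (g', x')" using vw v' w' by (simp add: proj_cl)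
  then obtain r'' where "w = cl ((g, x), r'')" using same_fibre[OF v'(1) w'(1)] w'(2) by metis
  then show "vb_add sign_bundle v w \<in> topspace E" "vb_proj sign_bundle (vb_add sign_bundle v w) = vb_proj sign_bundle v"
    using v' by (simp_all add: add_cl in_E proj_cl)
next
  fix c v assume "v \<in> topspace E"
  then obtain g x r where "x \<in> P" "v = cl ((g, x), r)" by (rule E_cases)
  then show "vb_scale sign_bundle c v \<in> topspace E" "vb_proj sign_bundle (vb_scale sign_bundle c v) = vb_proj sign_bundle v"
    by (simp_all add: scale_cl in_E proj_cl)
next
  fix b assume "b \<in> topspace M"
  then obtain g0 x0 where x0: "x0 \<in> P" "q (g0, x0) = b" by (rule surjE)
  define V where "V = {x \<in> P. \<forall>F\<in>facets P. x \<in> F \<longrightarrow> x0 \<in> F}"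
  define U where "U = q ` (UNIV \<times> V)"
  define EU where "EU = {c \<in> topspace E. vb_proj sign_bundle c \<in> U}"
  obtain T where opU: "openin M U"
    and T: "homeomorphic_map (subtopology E EU) (prod_topology (subtopology M U) (Euclidean_space 1)) T"
    and Tcl: "\<And>g x r. x \<in> V \<Longrightarrow> T (cl ((g, x), r)) = (q (g, x), \<lambda>i. if i < 1 then sgn_bit (\<theta> x0 g) * r else 0)"
    and img: "EU = cl ` ((UNIV \<times> V) \<times> UNIV)"
    using sign_bundle_trivial[OF x0(1)] unfolding V_def U_def EU_def by blast
  have VP: "V \<subseteq> P" unfolding V_def by blast
  have "x0 \<in> V" using x0 unfolding V_def by blast
  then have "b \<in> U" unfolding U_def x0(2)[symmetric] by blast
  have rep: "\<exists>g x r. x \<in> V \<and> v = cl ((g, x), r)" if "v \<in> EU" for v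
    using that unfolding img by auto
  have fst: "fst (T v) = vb_proj sign_bundle v" if vE: "v \<in> EU" for v
  proof -
    obtain g x r where x: "x \<in> V" "v = cl ((g, x), r)" using rep[OF vE] by blast
    then have "x \<in> P" using VP by blast
    then show ?thesis using x by (simp add: Tcl proj_cl)
  qed
  have "fibrewise_linear sign_bundle EU (\<lambda>x y i. x i + y i) (\<lambda>c x i. c * x i) (\<lambda>v. snd (T v))"
    unfolding fibrewise_linear_def
  proof (intro conjI ballI allI impI)
    fix v w assume v: "v \<in> EU" and w: "w \<in> EU" and vw: "vb_proj sign_bundle v = vb_proj sign_bundle w"
    obtain g x r where v': "x \<in> V" "v = cl ((g, x), r)" using rep[OF v] by blast
    obtain g' x' r' where w': "x' \<in> V" "w = cl ((g', x'), r')" using rep[OF w] by blast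
    have xP: "x \<in> P" "x' \<in> P" using v' w' VP by auto
    have "q (g, x) = q (g', x')" using vw v' w' xP by (simp add: proj_cl)
    then obtain r'' where w'': "w = cl ((g, x), r'')" using same_fibre[OF xP] w'(2) by metis
    show "snd (T (vb_add sign_bundle v w)) = (\<lambda>i. snd (T v) i + snd (T w) i)"
      unfolding v'(2) w'' add_cl Tcl[OF v'(1)] by (auto simp: fun_eq_iff algebra_simps)
  next
    fix c v assume v: "v \<in> EU"
    obtain g x r where v': "x \<in> V" "v = cl ((g, x), r)" using rep[OF v] by blast
    show "snd (T (vb_scale sign_bundle c v)) = (\<lambda>i. c * snd (T v) i)"
      unfolding v'(2) scale_cl Tcl[OF v'(1)] by (auto simp: fun_eq_iff)
  qed
  then show "\<exists>U T. let EU = {v \<in> topspace E. vb_proj sign_bundle v \<in> U} in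
        openin M U \<and> b \<in> U \<and>
        homeomorphic_map (subtopology E EU) (prod_topology (subtopology M U) (Euclidean_space 1)) T \<and>
        (\<forall>v\<in>EU. fst (T v) = vb_proj sign_bundle v) \<and>
        fibrewise_linear sign_bundle EU (\<lambda>x y i. x i + y i) (\<lambda>c x i. c * x i) (\<lambda>v. snd (T v))"
    using opU \<open>b \<in> U\<close> T fst unfolding Let_def EU_def by blast
qed

lemma frame_sign_bundle: "frame sign_bundle (\<lambda>g x. cl ((g, x), 1)) \<epsilon>"
  unfolding frame_def
proof (intro conjI allI ballI)
  fix g
  have "continuous_map (top_of_set P) Y (\<lambda>x. ((g, x), 1))"
    by (intro continuous_map_pairedI) auto
  from continuous_map_compose[OF this quotient_imp_continuous_map[OF quotient_cl]]
  show "continuous_map (top_of_set P) E (\<lambda>x. cl ((g, x), 1))" by (simp add: o_def)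
  fix x
  show "cl ((g, x), 1) \<in> nonzero_vectors sign_bundle" if "x \<in> P"
    using in_E[OF that] by (simp add: nonzero_vectors_def scale_cl cl_eq_iff)
  show "vb_proj sign_bundle (cl ((g, x), 1)) = q (g, x)" if "x \<in> P"
    by (rule proj_cl[OF that])
  fix F assume F: "F \<in> facets P" "x \<in> F"
  have "\<theta> x (\<mu> F) = \<epsilon> F" using matching_\<theta> F unfolding matching_def by blast
  moreover have "g + \<mu> F + g = \<mu> F" by (simp add: add_ac)
  ultimately show "cl ((g + \<mu> F, x), 1) = vb_scale sign_bundle (sgn_bit (\<epsilon> F)) (cl ((g, x), 1))"
    unfolding scale_cl cl_eq_iff using facet_iso[OF F] by simp
qed

end

text \<open>
  The components of \<open>\<nu>\<close> prescribe the signs of the first \<open>k - 1\<close> line bundles and the last one is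
  trivial, so that dividing out its sign returns \<open>\<nu>\<close>.
\<close>

theorem projective_bundle_pair_model:
  assumes k: "k \<ge> 1" and \<nu>: "\<And>F. \<nu> F \<in> bundle_group k" and \<mu>: "\<And>F. fst (\<nu> F) = \<mu> F"
  shows "projective_bundle_pair TYPE(line_carrier) k M a (P, \<nu>)"
proof -
  define \<epsilon> where "\<epsilon> i F = (if i < k - 1 then snd (\<nu> F) i else 0)" for i F
  define L where "L i = sign_bundle (\<epsilon> i)" for i :: nat
  define s where "s i g x = cl (\<epsilon> i) ((g, x), 1)" for i :: nat and g x
  have L: "line_bundle_over M (L i)" for i
    unfolding line_bundle_over_def L_def using vector_bundle_sign_bundle base_sign by blast
  have s: "frame (L i) (s i) (\<epsilon> i)" for i
    unfolding L_def s_def[abs_def] by (rule frame_sign_bundle)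
  have "\<exists>A. lifts_action a (L i) A \<and> equivariant_frame A (s i)" for i
    using lift_of_frame[OF L s] by metis
  then obtain A where A: "\<And>i. lifts_action a (L i) (A i)" "\<And>i. equivariant_frame (A i) (s i)" by metis
  interpret framed_sum P \<mu> M a \<psi> q k L s \<epsilon>
    by unfold_locales (use k L s in auto)
  have "framed_sum.\<nu> \<mu> k \<epsilon> F = \<nu> F" for F
  proof -
    obtain g t where gt: "\<nu> F = (g, t)" by fastforce
    then have "\<forall>i\<ge>k - 1. t i = 0" using \<nu>[of F] by (simp add: bundle_group_def)
    then show ?thesis using \<mu>[of F] gt by (auto simp: \<nu>_def \<epsilon>_def fun_eq_iff)
  qed
  then have "framed_sum.\<nu> \<mu> k \<epsilon> = \<nu>" by blast
  then have "encoded_by k M a L A (P, \<nu>)" using encoded[of A] A by simp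
  then show ?thesis unfolding projective_bundle_pair_def using L A(1) by blast
qed

end

section \<open>Models over polygons of the same combinatorial type\<close>

lemma generated_image:
  fixes \<psi> :: "'g::group_add \<Rightarrow> 'h::group_add"
  assumes add: "\<And>g h. \<psi> (g + h) = \<psi> g + \<psi> h" and d: "d \<in> generated_subgroup S"
  shows "\<psi> d \<in> generated_subgroup (\<psi> ` S)"
  using d
proof (induction rule: generated_induct)
  case (generator d) then show ?case by (intro generated_inc) blast
next
  case zero
  have "\<psi> 0 + \<psi> 0 = \<psi> 0 + 0" using add[of 0 0] by simp
  then have "\<psi> 0 = 0" by (rule add_left_imp_eq)
  then show ?case by (simp add: subgroup_generated(1))
next
  case (diff d e)
  have "\<psi> (d - e) + \<psi> e = \<psi> d" using add[of "d - e" e] by simp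
  then have "\<psi> (d - e) = \<psi> d - \<psi> e" by (metis add_diff_cancel)
  then show ?case using diff subgroup_generated(2) by metis
qed

text \<open>
  The gluing of the copies of a polygon depends only on which edges contain a given point and on
  their values; an edge preserving homeomorphism and an automorphism of the group transport both.
\<close>

lemma surface_model_transport:
  fixes P P' :: "plane set"
  assumes P': "polygon P'" "characteristic_function P' \<mu>'"
    and f: "continuous_on P f" "bij_betw f P P'" "compact P"
    and \<psi>: "group_automorphism UNIV \<psi>"
    and I: "facets P = S ` I" "facets P' = S' ` I"
    and faces: "\<And>i x. i \<in> I \<Longrightarrow> x \<in> P \<Longrightarrow> x \<in> S i \<longleftrightarrow> f x \<in> S' i"
    and matching: "\<And>i. i \<in> I \<Longrightarrow> \<psi> (\<mu> (S i)) = \<mu>' (S' i)"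
  obtains q where "surface_model P' \<mu>' (surface_cover P \<mu>) glued_action \<psi> q"
proof -
  let ?C = "{(F, \<mu> F) | F. F \<in> facets P}"
  let ?X = "\<lambda>P. prod_topology (discrete_topology (UNIV :: base_group set)) (top_of_set P)"
  define \<phi> where "\<phi> = inv_into UNIV \<psi>"
  have \<psi>b: "bij \<psi>" and \<psi>add: "\<psi> (g + h) = \<psi> g + \<psi> h" for g h
    using \<psi> unfolding group_automorphism_def by auto
  have \<phi>\<psi>: "\<phi> (\<psi> g) = g" "\<psi> (\<phi> g) = g" for g
    unfolding \<phi>_def using \<psi>b by (simp_all add: bij_is_inj bij_is_surj surj_f_inv_f)
  have \<phi>add: "\<phi> (g + h) = \<phi> g + \<phi> h" for g h by (metis \<psi>add \<phi>\<psi>)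
  define \<theta> where "\<theta> = the_inv_into P f"
  have fP: "f ` P = P'" and inj: "inj_on f P" using f(2) by (auto simp: bij_betw_def)
  have \<theta>f: "\<theta> (f x) = x" if "x \<in> P" for x unfolding \<theta>_def by (rule the_inv_into_f_f[OF inj that])
  have f\<theta>: "f (\<theta> x) = x" and \<theta>P: "\<theta> x \<in> P" if "x \<in> P'" for x
    using that fP f_the_inv_into_f[OF inj] the_inv_into_into[OF inj] unfolding \<theta>_def by auto
  have c\<theta>: "continuous_on P' \<theta>"
    unfolding \<theta>_def using continuous_on_inv_into[OF f(1,3) inj] fP by simp
  have "homeomorphic_maps (top_of_set P') (top_of_set P) \<theta> f"
    unfolding homeomorphic_maps_def using c\<theta> f(1) \<theta>f f\<theta> \<theta>P fP by auto
  moreover have "homeomorphic_maps (discrete_topology UNIV) (discrete_topology UNIV) \<phi> \<psi>"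
    unfolding homeomorphic_maps_def using \<phi>\<psi> by simp
  ultimately have "homeomorphic_maps (?X P') (?X P) (\<lambda>(g, x). (\<phi> g, \<theta> x)) (\<lambda>(g, x). (\<psi> g, f x))"
    unfolding homeomorphic_maps_prod by blast
  then have q1: "quotient_map (?X P') (?X P) (\<lambda>(g, x). (\<phi> g, \<theta> x))"
    by (rule homeomorphic_maps_imp_quotient_map)
  have q2: "quotient_map (?X P) (surface_cover P \<mu>) (glue_class UNIV ?C)"
    unfolding surface_cover_def glued_space_def by (rule quotient_map_quotient_top)
  define q where "q = glue_class UNIV ?C \<circ> (\<lambda>(g, x). (\<phi> g, \<theta> x))"
  have iso: "isotropy_at ?C y = generated_subgroup (\<mu> ` {F \<in> facets P. y \<in> F})" for y
  proof -
    have "{v. \<exists>F. (F, v) \<in> ?C \<and> y \<in> F} = \<mu> ` {F \<in> facets P. y \<in> F}" by blast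
    then show ?thesis by (simp add: isotropy_at_def)
  qed
  have img: "\<psi> ` \<mu> ` {F \<in> facets P. \<theta> x \<in> F} = {\<mu>' F | F. F \<in> facets P' \<and> x \<in> F}" if x: "x \<in> P'" for x
  proof -
    have "\<psi> ` \<mu> ` {F \<in> facets P. \<theta> x \<in> F} = (\<lambda>i. \<psi> (\<mu> (S i))) ` {i \<in> I. \<theta> x \<in> S i}"
      unfolding I(1) by blast
    also have "\<dots> = (\<lambda>i. \<mu>' (S' i)) ` {i \<in> I. x \<in> S' i}"
      using faces[OF _ \<theta>P[OF x]] matching f\<theta>[OF x] by (intro image_cong) auto
    also have "\<dots> = {\<mu>' F | F. F \<in> facets P' \<and> x \<in> F}" unfolding I(2) by blast
    finally show ?thesis .
  qed
  have "surface_model P' \<mu>' (surface_cover P \<mu>) glued_action \<psi> q"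
  proof
    show "polygon P'" "characteristic_function P' \<mu>'" by (rule P')+
    show "quotient_map (?X P') (surface_cover P \<mu>) q"
      unfolding q_def by (rule quotient_map_compose[OF q1 q2])
    show "group_automorphism UNIV \<psi>" by (rule \<psi>)
  next
    fix g h x y assume x: "x \<in> P'" and y: "y \<in> P'"
    have "q (g, x) = q (h, y) \<longleftrightarrow> \<theta> x = \<theta> y \<and> \<phi> g + \<phi> h \<in> generated_subgroup (\<mu> ` {F \<in> facets P. \<theta> x \<in> F})"
      unfolding q_def o_def split glue_class_eq_iff[OF UNIV_I UNIV_I] iso by simp
    also have "\<theta> x = \<theta> y \<longleftrightarrow> x = y" using f\<theta> x y by metis
    also have "\<phi> g + \<phi> h \<in> generated_subgroup (\<mu> ` {F \<in> facets P. \<theta> x \<in> F}) \<longleftrightarrow>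
        g + h \<in> generated_subgroup {\<mu>' F | F. F \<in> facets P' \<and> x \<in> F}"
    proof
      assume "\<phi> g + \<phi> h \<in> generated_subgroup (\<mu> ` {F \<in> facets P. \<theta> x \<in> F})"
      from generated_image[OF \<psi>add this] show "g + h \<in> generated_subgroup {\<mu>' F | F. F \<in> facets P' \<and> x \<in> F}"
        unfolding img[OF x] by (simp only: \<psi>add \<phi>\<psi>)
    next
      assume "g + h \<in> generated_subgroup {\<mu>' F | F. F \<in> facets P' \<and> x \<in> F}"
      from generated_image[of \<phi>, OF \<phi>add this] have "\<phi> (g + h) \<in> generated_subgroup (\<phi> ` \<psi> ` \<mu> ` {F \<in> facets P. \<theta> x \<in> F})"
        unfolding img[OF x] .
      moreover have "\<phi> ` \<psi> ` A = A" for A unfolding image_image by (simp add: \<phi>\<psi>)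
      ultimately show "\<phi> g + \<phi> h \<in> generated_subgroup (\<mu> ` {F \<in> facets P. \<theta> x \<in> F})" by (simp only: \<phi>add)
    qed
    finally show "q (g, x) = q (h, y) \<longleftrightarrow> x = y \<and> g + h \<in> generated_subgroup {\<mu>' F | F. F \<in> facets P' \<and> x \<in> F}" .
  next
    fix g h x assume "x \<in> P'"
    have "glued_action h (glue_class UNIV ?C (\<phi> g, \<theta> x)) = glue_class UNIV ?C (h + \<phi> g, \<theta> x)"
      by (rule glued_action_glue_class) auto
    moreover have "h + \<phi> g = \<phi> (\<psi> h + g)" by (simp add: \<phi>add \<phi>\<psi>)
    ultimately show "glued_action h (q (g, x)) = q (\<psi> h + g, x)"
      unfolding q_def o_def split by simp
  qed
  then show ?thesis by (rule that)
qed

lemma surface_model_homeomorphic: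
  assumes "surface_model P \<mu> M a \<psi> q" and f: "weak_equivariant_map UNIV id N b M a f"
    and b: "group_action_on UNIV N b"
  obtains q' where "surface_model P \<mu> N b \<psi> q'"
proof -
  interpret surface_model P \<mu> M a \<psi> q by fact
  have fh: "homeomorphic_map N M f" and fa: "\<And>g x. x \<in> topspace N \<Longrightarrow> f (b g x) = a g (f x)"
    using f unfolding weak_equivariant_map_def by auto
  obtain h where h: "homeomorphic_maps M N h f"
    using fh homeomorphic_map_maps homeomorphic_maps_sym by blast
  have hf: "\<And>x. x \<in> topspace N \<Longrightarrow> h (f x) = x" and fm: "\<And>m. m \<in> topspace M \<Longrightarrow> f (h m) = m"
    and hc: "continuous_map M N h"
    using h unfolding homeomorphic_maps_def by auto
  have hN: "h m \<in> topspace N" if "m \<in> topspace M" for m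
    using continuous_map_image_subset_topspace[OF hc] that by blast
  have "surface_model P \<mu> N b \<psi> (h \<circ> q)"
  proof
    show "polygon P" "characteristic_function P \<mu>" "group_automorphism UNIV \<psi>"
      by (rule polygon characteristic automorphism)+
    show "quotient_map X N (h \<circ> q)"
      by (rule quotient_map_compose[OF quotient homeomorphic_maps_imp_quotient_map[OF h]])
  next
    fix g g' x y assume xy: "x \<in> P" "y \<in> P"
    have "(h \<circ> q) (g, x) = (h \<circ> q) (g', y) \<longleftrightarrow> q (g, x) = q (g', y)"
      using fm[OF sheet_in[OF xy(1), of g]] fm[OF sheet_in[OF xy(2), of g']] by (metis o_apply)
    then show "(h \<circ> q) (g, x) = (h \<circ> q) (g', y) \<longleftrightarrow> x = y \<and> g + g' \<in> generated_subgroup {\<mu> F | F. F \<in> facets P \<and> x \<in> F}"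
      using kernel[OF xy] by simp
  next
    fix g g' x assume x: "x \<in> P"
    let ?n = "h (q (g, x))"
    have n: "?n \<in> topspace N" by (rule hN[OF sheet_in[OF x]])
    have fn: "f (b g' ?n) = q (\<psi> g' + g, x)" using fa[OF n] fm[OF sheet_in[OF x]] action[OF x] by simp
    have "b g' ?n \<in> topspace N"
      using b n continuous_map_image_subset_topspace[of N N "b g'"] unfolding group_action_on_def by blast
    then show "b g' ((h \<circ> q) (g, x)) = (h \<circ> q) (\<psi> g' + g, x)" using hf fn by (metis o_apply)
  qed
  then show ?thesis by (rule that)
qed

lemma small_cover_model:
  assumes "small_cover_over P M a"
  obtains \<mu> q where "surface_model P \<mu> M a id q"
proof -
  obtain \<mu> f where P: "polygon P" and act: "group_action_on UNIV M a" and \<mu>: "characteristic_function P \<mu>"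
    and f: "weak_equivariant_map UNIV id M a (surface_cover P \<mu>) glued_action f"
    using assms unfolding small_cover_over_def equivariantly_homeomorphic_def by blast
  obtain q where "surface_model P \<mu> (surface_cover P \<mu>) glued_action id q"
  proof (rule surface_model_transport[OF P \<mu>, of P id id id "facets P" id])
    show "group_automorphism UNIV (id :: base_group \<Rightarrow> base_group)" by (simp add: group_automorphism_def)
  qed (use polygon_compact[OF P] in auto)
  then show ?thesis using surface_model_homeomorphic[OF _ f act] that by blast
qed

section \<open>The projective plane and the torus\<close>

lemma facet_functional:
  assumes P: "polygon P" and F: "F \<in> facets P"
  obtains l :: "plane \<Rightarrow> real" where "\<And>x. x \<in> P \<Longrightarrow> 0 \<le> l x" "\<And>x. x \<in> P \<Longrightarrow> x \<in> F \<longleftrightarrow> l x = 0"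
    "\<And>x u v w c d e. l (x + c *\<^sub>R (u - x) + d *\<^sub>R (v - x) + e *\<^sub>R (w - x)) =
        l x + c * (l u - l x) + d * (l v - l x) + e * (l w - l x)"
proof -
  obtain a b where ab: "P \<subseteq> {x. a \<bullet> x \<le> b}" "F = P \<inter> {x. a \<bullet> x = b}"
    using facet_of_polyhedron[OF polygon_polyhedron[OF P]] F unfolding facets_def by blast
  show ?thesis
    by (rule that[of "\<lambda>x. b - a \<bullet> x"]) (use ab in \<open>auto simp: inner_add_right inner_diff_right algebra_simps\<close>)
qed

lemma plane_basis:
  fixes u v x :: plane
  assumes l: "\<And>c d. l (c *\<^sub>R u + d *\<^sub>R v) = c * p" "p \<noteq> 0"
    and l': "\<And>c d. l' (c *\<^sub>R u + d *\<^sub>R v) = d * p'" "p' \<noteq> (0::real)"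
  shows "\<exists>c d. x = c *\<^sub>R u + d *\<^sub>R v"
proof -
  have "u $ 1 * v $ 2 - u $ 2 * v $ 1 \<noteq> 0"
  proof
    assume D: "u $ 1 * v $ 2 - u $ 2 * v $ 1 = 0"
    have z: "c = 0 \<and> d = 0" if "c *\<^sub>R u + d *\<^sub>R v = 0" for c d
    proof -
      have "c * p = 0" using l(1)[of c d] l(1)[of 0 0] unfolding that by simp
      moreover have "d * p' = 0" using l'(1)[of c d] l'(1)[of 0 0] unfolding that by simp
      ultimately show ?thesis using l(2) l'(2) by simp
    qed
    have "v $ 1 *\<^sub>R u + (- (u $ 1)) *\<^sub>R v = 0" "v $ 2 *\<^sub>R u + (- (u $ 2)) *\<^sub>R v = 0"
      using D by (simp_all add: vec_eq_iff forall_2 algebra_simps)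
    from z[OF this(1)] z[OF this(2)] have "u = 0" by (simp add: vec_eq_iff forall_2)
    then show False using z[of 1 0] by simp
  qed
  moreover define D where "D = u $ 1 * v $ 2 - u $ 2 * v $ 1"
  ultimately have D: "D \<noteq> 0" by simp
  define \<alpha> \<beta> where "\<alpha> = x $ 1 * v $ 2 - x $ 2 * v $ 1" and "\<beta> = u $ 1 * x $ 2 - u $ 2 * x $ 1"
  have "D * x $ 1 = \<alpha> * u $ 1 + \<beta> * v $ 1" "D * x $ 2 = \<alpha> * u $ 2 + \<beta> * v $ 2"
    unfolding D_def \<alpha>_def \<beta>_def by algebra+
  then have "x $ 1 = \<alpha> / D * u $ 1 + \<beta> / D * v $ 1" "x $ 2 = \<alpha> / D * u $ 2 + \<beta> / D * v $ 2"
    using D by (simp_all add: field_simps)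
  then have "x = (\<alpha> / D) *\<^sub>R u + (\<beta> / D) *\<^sub>R v" by (simp add: vec_eq_iff forall_2)
  then show ?thesis by blast
qed

text \<open>
  A point in the relative interior of a further edge would lie on an edge in \<open>S\<close>, which would contain the further edge.
\<close>

lemma facets_eqI:
  assumes P: "polygon P" and S: "S \<subseteq> facets P" and int: "P - \<Union>S \<subseteq> interior P"
  shows "facets P = S"
proof (intro equalityI subsetI)
  fix F assume F: "F \<in> facets P"
  have "rel_interior F \<noteq> {}"
    using rel_interior_eq_empty[OF facet_convex[OF P F]] facet_nonempty[OF F] by simp
  then obtain x where x: "x \<in> rel_interior F" by blast
  have xF: "x \<in> F" using x rel_interior_subset by blast
  have "F \<noteq> P" using facet_aff_dim[OF P F] P by (auto simp: polygon_def)
  then have "F \<inter> interior P = {}" by (rule face_of_disjoint_interior[OF facet_face[OF F]])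
  then have "x \<in> \<Union>S" using xF facet_subset[OF F] int by blast
  then obtain G where G: "G \<in> S" "x \<in> G" by blast
  have GP: "G \<in> facets P" using G S by blast
  have "F \<subseteq> G"
    by (rule subset_of_face_of[OF facet_face[OF GP] facet_subset[OF F]]) (use x G in \<open>auto simp: disjnt_def\<close>)
  then have "F = G" by (rule facets_inclusion[OF P F GP])
  then show "F \<in> S" using G by simp
qed (use S in blast)

lemma hyperplane_facet:
  assumes P: "polygon P" and le: "\<And>x. x \<in> P \<Longrightarrow> a \<bullet> x \<le> b" and F: "F = P \<inter> {x. a \<bullet> x = b}"
    and uv: "u \<in> F" "v \<in> F" "u \<noteq> v" and w: "w \<in> P" "w \<notin> F"
  shows "F \<in> facets P"
proof -
  have face: "F face_of P" unfolding F by (rule face_of_Int_supporting_hyperplane_le[OF polygon_convex[OF P] le])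
  have "aff_dim F < aff_dim P"
    by (rule face_of_aff_dim_lt[OF polygon_convex[OF P] face]) (use w in blast)
  moreover have "aff_dim {u, v} \<le> aff_dim F" using uv by (intro aff_dim_subset) auto
  ultimately have "aff_dim F = aff_dim P - 1" using uv(3) P by (simp add: polygon_def)
  then show ?thesis using face uv(1) by (auto simp: facets_def facet_of_def)
qed

lemma convex_combination_3:
  fixes A B C :: "'a::real_vector"
  assumes "convex P" "A \<in> P" "B \<in> P" "C \<in> P" "0 \<le> c" "0 \<le> d" "c + d \<le> 1"
  shows "A + c *\<^sub>R (B - A) + d *\<^sub>R (C - A) \<in> P"
proof -
  have "A + c *\<^sub>R (B - A) + d *\<^sub>R (C - A) = (1 - c - d) *\<^sub>R A + c *\<^sub>R B + d *\<^sub>R C"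
    by (simp add: algebra_simps)
  also have "\<dots> \<in> convex hull {A, B, C}"
    unfolding convex_hull_3 using assms
    by (intro CollectI exI[of _ "1 - c - d"] exI[of _ c] exI[of _ d]) auto
  also have "\<dots> \<subseteq> P" by (rule hull_minimal) (use assms in auto)
  finally show ?thesis .
qed

lemma base_group_automorphism:
  fixes c d :: base_group
  assumes "c \<noteq> 0" "d \<noteq> 0" "c \<noteq> d"
    and \<psi>_def: "\<psi> = (\<lambda>v :: base_group. v $ 1 *s c + v $ 2 *s d)"
  shows "group_automorphism UNIV \<psi>" "\<psi> (axis 1 1) = c" "\<psi> (axis 2 1) = d" "\<psi> (axis 1 1 + axis 2 1) = c + d"
proof -
  have add: "\<psi> (v + w) = \<psi> v + \<psi> w" for v w
    unfolding \<psi>_def by (simp only: vector_add_component vec.scale_left_distrib add_ac)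
  have "c + d \<noteq> 0" using assms(3) by (metis add.right_neutral bit_vec_add_self_left)
  then have "v = 0" if "\<psi> v = 0" for v
    using that assms(1-3) unfolding \<psi>_def by (cases "v $ 1"; cases "v $ 2") (auto simp: vec_eq_iff forall_2)
  moreover have "v + w = 0 \<longleftrightarrow> v = w" for v w :: base_group
    by (metis add_right_cancel bit_vec_add_self)
  ultimately have inj: "inj \<psi>" using add by (intro injI) metis
  have "surj \<psi>" by (rule finite_UNIV_inj_surj[OF finite inj])
  then have "bij \<psi>" by (rule bijI[OF inj])
  then show "group_automorphism UNIV \<psi>" using add unfolding group_automorphism_def by blast
  show "\<psi> (axis 1 1) = c" "\<psi> (axis 2 1) = d" by (simp_all add: \<psi>_def axis_def)
  then show "\<psi> (axis 1 1 + axis 2 1) = c + d" unfolding add by simp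
qed

lemma coordinate_inner: "axis 1 1 \<bullet> (x :: plane) = x $ 1" "axis 2 1 \<bullet> (x :: plane) = x $ 2"
  by (simp_all add: inner_axis')

lemma plane_axis [simp]: "(axis 1 1 :: plane) $ 1 = 1" "(axis 1 1 :: plane) $ 2 = 0"
  "(axis 2 1 :: plane) $ 1 = 0" "(axis 2 1 :: plane) $ 2 = 1"
  by (simp_all add: axis_def)

lemma polygonI:
  assumes "polytope P" "open S" "S \<subseteq> P" "x \<in> S" shows "polygon P"
proof -
  have "interior P \<noteq> {}" using assms interior_maximal by blast
  then show ?thesis using aff_dim_nonempty_interior[of P] assms(1) by (simp add: polygon_def)
qed

abbreviation "standard_triangle \<equiv> convex hull {0, axis 1 1, axis 2 1 :: plane}"
abbreviation "standard_square \<equiv> {x :: plane. \<forall>i. 0 \<le> x $ i \<and> x $ i \<le> 1}"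

lemma standard_triangle: "standard_triangle = {x. 0 \<le> x $ 1 \<and> 0 \<le> x $ 2 \<and> x $ 1 + x $ 2 \<le> 1}"
proof (intro equalityI subsetI)
  fix x :: plane assume "x \<in> standard_triangle"
  then show "x \<in> {x. 0 \<le> x $ 1 \<and> 0 \<le> x $ 2 \<and> x $ 1 + x $ 2 \<le> 1}"
    unfolding convex_hull_3 by auto
next
  fix x :: plane assume x: "x \<in> {x. 0 \<le> x $ 1 \<and> 0 \<le> x $ 2 \<and> x $ 1 + x $ 2 \<le> 1}"
  have "0 + (x $ 1) *\<^sub>R (axis 1 1 - 0) + (x $ 2) *\<^sub>R (axis 2 1 - 0) \<in> standard_triangle"
    by (rule convex_combination_3) (use x in \<open>auto intro: hull_inc\<close>)
  moreover have "x = 0 + (x $ 1) *\<^sub>R (axis 1 1 - 0) + (x $ 2) *\<^sub>R (axis 2 1 - 0)"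
    by (simp add: vec_eq_iff forall_2)
  ultimately show "x \<in> standard_triangle" by metis
qed

definition triangle_edge :: "nat \<Rightarrow> plane set" where
  "triangle_edge i = standard_triangle \<inter>
     (if i = 0 then {x. x $ 1 = 0} else if i = 1 then {x. x $ 2 = 0} else {x. x $ 1 + x $ 2 = 1})"

lemma triangle_facets: "facets standard_triangle = triangle_edge ` {..<3}"
proof -
  note T = standard_triangle
  have op: "open {x :: plane. 0 < x $ 1 \<and> 0 < x $ 2 \<and> x $ 1 + x $ 2 < 1}"
    by (intro open_Collect_conj open_Collect_less continuous_intros)
  have P: "polygon standard_triangle"
    by (rule polygonI[OF polytope_convex_hull op, of _ "(1/4) *\<^sub>R axis 1 1 + (1/4) *\<^sub>R axis 2 1"])
      (auto simp: T)
  have "triangle_edge 0 \<in> facets standard_triangle"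
    by (rule hyperplane_facet[OF P, of "- axis 1 1" 0 _ 0 "axis 2 1" "axis 1 1"])
      (auto simp: triangle_edge_def T coordinate_inner axis_eq_0_iff)
  moreover have "triangle_edge 1 \<in> facets standard_triangle"
    by (rule hyperplane_facet[OF P, of "- axis 2 1" 0 _ 0 "axis 1 1" "axis 2 1"])
      (auto simp: triangle_edge_def T coordinate_inner axis_eq_0_iff)
  moreover have "triangle_edge 2 \<in> facets standard_triangle"
    by (rule hyperplane_facet[OF P, of "axis 1 1 + axis 2 1" 1 _ "axis 1 1" "axis 2 1" 0])
      (auto simp: triangle_edge_def T coordinate_inner inner_add_left axis_eq_axis)
  moreover have E: "triangle_edge ` {..<3} = {triangle_edge 0, triangle_edge 1, triangle_edge 2}"
    by (auto simp: eval_nat_numeral lessThan_Suc)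
  moreover have "standard_triangle - \<Union>{triangle_edge 0, triangle_edge 1, triangle_edge 2} \<subseteq> interior standard_triangle"
  proof (rule order_trans[OF _ interior_maximal[OF _ op]])
    show "{x. 0 < x $ 1 \<and> 0 < x $ 2 \<and> x $ 1 + x $ 2 < 1} \<subseteq> standard_triangle" by (auto simp: T)
  qed (auto simp: triangle_edge_def T)
  ultimately show ?thesis unfolding E by (intro facets_eqI[OF P]) auto
qed

definition square_edge :: "nat \<Rightarrow> plane set" where
  "square_edge i = standard_square \<inter>
     (if i = 0 then {x. x $ 1 = 0} else if i = 1 then {x. x $ 2 = 0}
      else if i = 2 then {x. x $ 1 = 1} else {x. x $ 2 = 1})"

lemma square_facets: "facets standard_square = square_edge ` {..<4}"
proof -
  have op: "open {x :: plane. 0 < x $ 1 \<and> 0 < x $ 2 \<and> x $ 1 < 1 \<and> x $ 2 < 1}"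
    by (intro open_Collect_conj open_Collect_less continuous_intros)
  have "standard_square = cbox 0 1" by (auto simp: mem_box_cart)
  then have "polytope standard_square" using polytope_interval[of "0 :: plane" 1] by simp
  then have P: "polygon standard_square"
    by (rule polygonI[OF _ op, of _ "(1/4) *\<^sub>R axis 1 1 + (1/4) *\<^sub>R axis 2 1"]) (auto simp: forall_2)
  have "square_edge 0 \<in> facets standard_square"
    by (rule hyperplane_facet[OF P, of "- axis 1 1" 0 _ 0 "axis 2 1" "axis 1 1"])
      (auto simp: square_edge_def forall_2 coordinate_inner axis_eq_0_iff)
  moreover have "square_edge 1 \<in> facets standard_square"
    by (rule hyperplane_facet[OF P, of "- axis 2 1" 0 _ 0 "axis 1 1" "axis 2 1"])
      (auto simp: square_edge_def forall_2 coordinate_inner axis_eq_0_iff)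
  moreover have "square_edge 2 \<in> facets standard_square"
    by (rule hyperplane_facet[OF P, of "axis 1 1" 1 _ "axis 1 1" "axis 1 1 + axis 2 1" 0])
      (auto simp: square_edge_def forall_2 coordinate_inner axis_eq_0_iff)
  moreover have "square_edge 3 \<in> facets standard_square"
    by (rule hyperplane_facet[OF P, of "axis 2 1" 1 _ "axis 2 1" "axis 1 1 + axis 2 1" 0])
      (auto simp: square_edge_def forall_2 coordinate_inner axis_eq_0_iff)
  moreover have E: "square_edge ` {..<4} = {square_edge 0, square_edge 1, square_edge 2, square_edge 3}"
    by (auto simp: eval_nat_numeral lessThan_Suc)
  moreover have "standard_square - \<Union>{square_edge 0, square_edge 1, square_edge 2, square_edge 3} \<subseteq> interior standard_square"
  proof (rule order_trans[OF _ interior_maximal[OF _ op]])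
    show "{x. 0 < x $ 1 \<and> 0 < x $ 2 \<and> x $ 1 < 1 \<and> x $ 2 < 1} \<subseteq> standard_square" by (auto simp: forall_2)
  qed (auto simp: square_edge_def forall_2)
  ultimately show ?thesis unfolding E by (intro facets_eqI[OF P]) auto
qed

lemma edge_cycle_meet:
  assumes "edge_cycle P m e" "i < m" "j < m" "i \<noteq> j"
  shows "e i \<in> facets P" "e i \<noteq> e j" "e i \<inter> e j \<noteq> {} \<longleftrightarrow> cyclic_neighbours m i j"
proof -
  have bij: "bij_betw e {..<m} (facets P)" using assms(1) unfolding edge_cycle_def by blast
  show "e i \<in> facets P" using bij_betwE[OF bij] assms(2) by blast
  show "e i \<noteq> e j" using inj_on_eq_iff[OF bij_betw_imp_inj_on[OF bij]] assms(2-4) by simp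
  show "e i \<inter> e j \<noteq> {} \<longleftrightarrow> cyclic_neighbours m i j" using assms unfolding edge_cycle_def by blast
qed

text \<open>
  Points of a triangle or of a convex quadrilateral are described by the signs of the affine
  functionals that vanish on the edges; this identifies them with the points of the standard
  triangle by an affine map, and with those of the standard square by a map that is affine on the
  two halves cut out by a diagonal.
\<close>

lemma triangle_parametrization:
  assumes T: "edge_cycle T 3 t"
  obtains f where "continuous_on standard_triangle f" "bij_betw f standard_triangle T"
    "\<And>i x. i < 3 \<Longrightarrow> x \<in> standard_triangle \<Longrightarrow> x \<in> triangle_edge i \<longleftrightarrow> f x \<in> t i"
proof -
  have P: "polygon T" using T unfolding edge_cycle_def by blast
  note ec = edge_cycle_meet[OF T]
  have F: "t 0 \<in> facets T" "t 1 \<in> facets T" "t 2 \<in> facets T"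
    using ec(1)[of 0 1] ec(1)[of 1 0] ec(1)[of 2 0] by simp_all
  have ne: "t 0 \<noteq> t 1" "t 0 \<noteq> t 2" "t 1 \<noteq> t 2"
    using ec(2)[of 0 1] ec(2)[of 0 2] ec(2)[of 1 2] by simp_all
  have "t 0 \<inter> t 1 \<noteq> {}" "t 1 \<inter> t 2 \<noteq> {}" "t 2 \<inter> t 0 \<noteq> {}"
    using ec(3)[of 0 1] ec(3)[of 1 2] ec(3)[of 2 0] by (simp_all add: cyclic_neighbours_def)
  then obtain A B C where A: "A \<in> t 0" "A \<in> t 1" and B: "B \<in> t 1" "B \<in> t 2" and C: "C \<in> t 2" "C \<in> t 0"
    by blast
  have no: "\<not> (x \<in> t 0 \<and> x \<in> t 1 \<and> x \<in> t 2)" for x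
    using at_most_two_facets[OF P F ne] by blast
  have in_T: "A \<in> T" "B \<in> T" "C \<in> T" using A B C F facet_subset by blast+
  obtain l0 where l0: "\<And>x. x \<in> T \<Longrightarrow> 0 \<le> l0 x" "\<And>x. x \<in> T \<Longrightarrow> x \<in> t 0 \<longleftrightarrow> l0 x = 0"
    "\<And>x u v w c d e. l0 (x + c *\<^sub>R (u - x) + d *\<^sub>R (v - x) + e *\<^sub>R (w - x)) = l0 x + c * (l0 u - l0 x) + d * (l0 v - l0 x) + e * (l0 w - l0 x)"
    using facet_functional[OF P F(1)] by blast
  obtain l1 where l1: "\<And>x. x \<in> T \<Longrightarrow> 0 \<le> l1 x" "\<And>x. x \<in> T \<Longrightarrow> x \<in> t 1 \<longleftrightarrow> l1 x = 0"
    "\<And>x u v w c d e. l1 (x + c *\<^sub>R (u - x) + d *\<^sub>R (v - x) + e *\<^sub>R (w - x)) = l1 x + c * (l1 u - l1 x) + d * (l1 v - l1 x) + e * (l1 w - l1 x)"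
    using facet_functional[OF P F(2)] by blast
  obtain l2 where l2: "\<And>x. x \<in> T \<Longrightarrow> 0 \<le> l2 x" "\<And>x. x \<in> T \<Longrightarrow> x \<in> t 2 \<longleftrightarrow> l2 x = 0"
    "\<And>x u v w c d e. l2 (x + c *\<^sub>R (u - x) + d *\<^sub>R (v - x) + e *\<^sub>R (w - x)) = l2 x + c * (l2 u - l2 x) + d * (l2 v - l2 x) + e * (l2 w - l2 x)"
    using facet_functional[OF P F(3)] by blast
  have z0: "l0 A = 0" "l0 C = 0" "l0 B > 0"
    using l0(1)[of B] l0(2)[of A] l0(2)[of B] l0(2)[of C] A B C no[of B] in_T by (auto simp: less_le)
  have z1: "l1 A = 0" "l1 B = 0" "l1 C > 0"
    using l1(1)[of C] l1(2)[of A] l1(2)[of B] l1(2)[of C] A B C no[of C] in_T by (auto simp: less_le)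
  have z2: "l2 B = 0" "l2 C = 0" "l2 A > 0"
    using l2(1)[of A] l2(2)[of A] l2(2)[of B] l2(2)[of C] A B C no[of A] in_T by (auto simp: less_le)
  define p where "p c d = A + c *\<^sub>R (B - A) + d *\<^sub>R (C - A)" for c d
  have p0: "l0 (p c d) = c * l0 B" and p1: "l1 (p c d) = d * l1 C" and p2: "l2 (p c d) = l2 A * (1 - c - d)" for c d
    using l0(3)[of A c B d C 0 A] l1(3)[of A c B d C 0 A] l2(3)[of A c B d C 0 A] z0 z1 z2
    unfolding p_def by (simp_all add: algebra_simps)
  define f where "f y = p (y $ 1) (y $ 2)" for y :: plane
  have fT: "f y \<in> T" if "y \<in> standard_triangle" for y
    unfolding f_def p_def by (rule convex_combination_3[OF polygon_convex[OF P] in_T])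
      (use that in \<open>auto simp: standard_triangle\<close>)
  have cont: "continuous_on standard_triangle f"
    unfolding f_def p_def by (intro continuous_intros)
  have inj: "inj_on f standard_triangle"
  proof (rule inj_onI)
    fix x y assume "f x = f y"
    then have "l0 (f x) = l0 (f y)" "l1 (f x) = l1 (f y)" by simp_all
    then show "x = y" using z0(3) z1(3) by (simp add: f_def p0 p1 vec_eq_iff forall_2)
  qed
  have "T \<subseteq> f ` standard_triangle"
  proof
    fix x assume x: "x \<in> T"
    have "\<exists>c d. x - A = c *\<^sub>R (B - A) + d *\<^sub>R (C - A)"
    proof (rule plane_basis[of "\<lambda>w. l0 (A + w)" _ _ "l0 B" "\<lambda>w. l1 (A + w)" "l1 C"])
      show "l0 (A + (c *\<^sub>R (B - A) + d *\<^sub>R (C - A))) = c * l0 B"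
        "l1 (A + (c *\<^sub>R (B - A) + d *\<^sub>R (C - A))) = d * l1 C" for c d
        using p0[of c d] p1[of c d] by (simp_all add: p_def add.assoc)
    qed (use z0 z1 in auto)
    then obtain c d where "x = p c d" unfolding p_def by (metis add.assoc add_diff_cancel_left' diff_add_cancel add.commute)
    moreover from this have "0 \<le> c" "0 \<le> d" "c + d \<le> 1"
      using l0(1)[OF x] l1(1)[OF x] l2(1)[OF x] z0(3) z1(3) z2(3) by (auto simp: p0 p1 p2 zero_le_mult_iff)
    ultimately have "x = f (c *\<^sub>R axis 1 1 + d *\<^sub>R axis 2 1)" "c *\<^sub>R axis 1 1 + d *\<^sub>R axis 2 1 \<in> standard_triangle"
      by (simp_all add: f_def standard_triangle)
    then show "x \<in> f ` standard_triangle" by (rule image_eqI)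
  qed
  then have "f ` standard_triangle = T" using fT by blast
  then have bij: "bij_betw f standard_triangle T" using inj by (simp add: bij_betw_def)
  have "x \<in> triangle_edge i \<longleftrightarrow> f x \<in> t i" if "i < 3" "x \<in> standard_triangle" for i x
  proof -
    have "i = 0 \<or> i = 1 \<or> i = 2" using that(1) by auto
    then show ?thesis
      using that(2) fT[OF that(2)] l0(2) l1(2) l2(2) z0(3) z1(3) z2(3)
      by (elim disjE) (auto simp: triangle_edge_def f_def p0 p1 p2)
  qed
  with cont bij show ?thesis by (rule that)
qed

lemma square_parametrization:
  assumes T: "edge_cycle T 4 t"
  obtains f where "continuous_on standard_square f" "bij_betw f standard_square T"
    "\<And>i x. i < 4 \<Longrightarrow> x \<in> standard_square \<Longrightarrow> x \<in> square_edge i \<longleftrightarrow> f x \<in> t i"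
proof -
  have P: "polygon T" using T unfolding edge_cycle_def by blast
  note ec = edge_cycle_meet[OF T]
  have F: "t 0 \<in> facets T" "t 1 \<in> facets T" "t 2 \<in> facets T" "t 3 \<in> facets T"
    using ec(1)[of 0 1] ec(1)[of 1 0] ec(1)[of 2 0] ec(1)[of 3 0] by simp_all
  have "t 0 \<inter> t 1 \<noteq> {}" "t 1 \<inter> t 2 \<noteq> {}" "t 2 \<inter> t 3 \<noteq> {}" "t 3 \<inter> t 0 \<noteq> {}"
    using ec(3)[of 0 1] ec(3)[of 1 2] ec(3)[of 2 3] ec(3)[of 3 0] by (simp_all add: cyclic_neighbours_def)
  then obtain A B C D where A: "A \<in> t 0" "A \<in> t 1" and B: "B \<in> t 1" "B \<in> t 2"
    and C: "C \<in> t 2" "C \<in> t 3" and D: "D \<in> t 3" "D \<in> t 0"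
    by blast
  have opp: "t 0 \<inter> t 2 = {}" "t 1 \<inter> t 3 = {}"
    using ec(3)[of 0 2] ec(3)[of 1 3] by (simp_all add: cyclic_neighbours_def)
  have in_T: "A \<in> T" "B \<in> T" "C \<in> T" "D \<in> T" using A B C D F facet_subset by blast+
  obtain l0 where l0: "\<And>x. x \<in> T \<Longrightarrow> 0 \<le> l0 x" "\<And>x. x \<in> T \<Longrightarrow> x \<in> t 0 \<longleftrightarrow> l0 x = 0"
    "\<And>x u v w c d e. l0 (x + c *\<^sub>R (u - x) + d *\<^sub>R (v - x) + e *\<^sub>R (w - x)) = l0 x + c * (l0 u - l0 x) + d * (l0 v - l0 x) + e * (l0 w - l0 x)"
    using facet_functional[OF P F(1)] by blast
  obtain l1 where l1: "\<And>x. x \<in> T \<Longrightarrow> 0 \<le> l1 x" "\<And>x. x \<in> T \<Longrightarrow> x \<in> t 1 \<longleftrightarrow> l1 x = 0"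
    "\<And>x u v w c d e. l1 (x + c *\<^sub>R (u - x) + d *\<^sub>R (v - x) + e *\<^sub>R (w - x)) = l1 x + c * (l1 u - l1 x) + d * (l1 v - l1 x) + e * (l1 w - l1 x)"
    using facet_functional[OF P F(2)] by blast
  obtain l2 where l2: "\<And>x. x \<in> T \<Longrightarrow> 0 \<le> l2 x" "\<And>x. x \<in> T \<Longrightarrow> x \<in> t 2 \<longleftrightarrow> l2 x = 0"
    "\<And>x u v w c d e. l2 (x + c *\<^sub>R (u - x) + d *\<^sub>R (v - x) + e *\<^sub>R (w - x)) = l2 x + c * (l2 u - l2 x) + d * (l2 v - l2 x) + e * (l2 w - l2 x)"
    using facet_functional[OF P F(3)] by blast
  obtain l3 where l3: "\<And>x. x \<in> T \<Longrightarrow> 0 \<le> l3 x" "\<And>x. x \<in> T \<Longrightarrow> x \<in> t 3 \<longleftrightarrow> l3 x = 0"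
    "\<And>x u v w c d e. l3 (x + c *\<^sub>R (u - x) + d *\<^sub>R (v - x) + e *\<^sub>R (w - x)) = l3 x + c * (l3 u - l3 x) + d * (l3 v - l3 x) + e * (l3 w - l3 x)"
    using facet_functional[OF P F(4)] by blast
  have out: "B \<notin> t 0" "C \<notin> t 0" "C \<notin> t 1" "D \<notin> t 1" "A \<notin> t 2" "D \<notin> t 2" "A \<notin> t 3" "B \<notin> t 3"
    using A B C D opp by blast+
  have z0: "l0 A = 0" "l0 D = 0" "l0 B > 0" "l0 C > 0"
    using l0(1)[of B] l0(1)[of C] l0(2)[of A] l0(2)[of B] l0(2)[of C] l0(2)[of D] A D out in_T by (auto simp: less_le)
  have z1: "l1 A = 0" "l1 B = 0" "l1 C > 0" "l1 D > 0"
    using l1(1)[of C] l1(1)[of D] l1(2)[of A] l1(2)[of B] l1(2)[of C] l1(2)[of D] A B out in_T by (auto simp: less_le)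
  have z2: "l2 B = 0" "l2 C = 0" "l2 A > 0" "l2 D > 0"
    using l2(1)[of A] l2(1)[of D] l2(2)[of A] l2(2)[of B] l2(2)[of C] l2(2)[of D] B C out in_T by (auto simp: less_le)
  have z3: "l3 C = 0" "l3 D = 0" "l3 A > 0" "l3 B > 0"
    using l3(1)[of A] l3(1)[of B] l3(2)[of A] l3(2)[of B] l3(2)[of C] l3(2)[of D] C D out in_T by (auto simp: less_le)
  define p where "p b d c = A + b *\<^sub>R (B - A) + d *\<^sub>R (D - A) + c *\<^sub>R (C - A)" for b d c
  have p0: "l0 (p b d c) = b * l0 B + c * l0 C" and p1: "l1 (p b d c) = d * l1 D + c * l1 C"
    and p2: "l2 (p b d c) = (1 - b - d - c) * l2 A + d * l2 D"
    and p3: "l3 (p b d c) = (1 - b - d - c) * l3 A + b * l3 B" for b d c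
    using l0(3)[of A b B d D c C] l1(3)[of A b B d D c C] l2(3)[of A b B d D c C] l3(3)[of A b B d D c C] z0 z1 z2 z3
    unfolding p_def by (simp_all add: algebra_simps)
  define \<beta> \<delta> \<gamma> where "\<beta> y = max (y $ 1 - y $ 2) 0" and "\<delta> y = max (y $ 2 - y $ 1) 0"
    and "\<gamma> y = min (y $ 1) (y $ 2)" for y :: plane
  define f where "f y = p (\<beta> y) (\<delta> y) (\<gamma> y)" for y
  have sq: "0 \<le> y $ 1 \<and> y $ 1 \<le> 1 \<and> 0 \<le> y $ 2 \<and> y $ 2 \<le> 1 \<longleftrightarrow> y \<in> standard_square" for y
    by (auto simp: forall_2)
  have fT: "f y \<in> T" if "y \<in> standard_square" for y
  proof (cases "y $ 2 \<le> y $ 1")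
    case True
    then have "f y = A + (y $ 1 - y $ 2) *\<^sub>R (B - A) + (y $ 2) *\<^sub>R (C - A)"
      by (simp add: f_def p_def \<beta>_def \<delta>_def \<gamma>_def max_def min_def)
    also have "\<dots> \<in> T"
      by (rule convex_combination_3[OF polygon_convex[OF P] in_T(1-3)]) (use that True in \<open>auto simp: forall_2\<close>)
    finally show ?thesis .
  next
    case False
    then have "f y = A + (y $ 2 - y $ 1) *\<^sub>R (D - A) + (y $ 1) *\<^sub>R (C - A)"
      by (simp add: f_def p_def \<beta>_def \<delta>_def \<gamma>_def max_def min_def)
    also have "\<dots> \<in> T"
      by (rule convex_combination_3[OF polygon_convex[OF P] in_T(1,4,3)]) (use that False in \<open>auto simp: forall_2\<close>)
    finally show ?thesis .
  qed
  have cont: "continuous_on standard_square f"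
    unfolding f_def p_def \<beta>_def \<delta>_def \<gamma>_def by (intro continuous_intros)
  \<comment> \<open>If the coefficient of \<open>C\<close> decreases, those of \<open>B\<close> and \<open>D\<close> increase, but one of them is zero.\<close>
  have less: "\<not> \<gamma> x < \<gamma> y" if xy: "f x = f y" for x y
  proof
    assume lt: "\<gamma> x < \<gamma> y"
    have nn: "0 \<le> \<beta> y" "0 \<le> \<delta> y" by (simp_all add: \<beta>_def \<delta>_def)
    have "\<beta> x * l0 B + \<gamma> x * l0 C = \<beta> y * l0 B + \<gamma> y * l0 C" "\<delta> x * l1 D + \<gamma> x * l1 C = \<delta> y * l1 D + \<gamma> y * l1 C"
      using arg_cong[OF xy, of l0] arg_cong[OF xy, of l1] by (simp_all add: f_def p0 p1)
    moreover have "\<gamma> x * l0 C < \<gamma> y * l0 C" "\<gamma> x * l1 C < \<gamma> y * l1 C" using lt z0(4) z1(3) by simp_all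
    ultimately have "\<beta> y * l0 B < \<beta> x * l0 B" "\<delta> y * l1 D < \<delta> x * l1 D" by linarith+
    then have "\<beta> y < \<beta> x" "\<delta> y < \<delta> x" using z0(3) z1(4) by simp_all
    then have "0 < \<beta> x" "0 < \<delta> x" using nn by linarith+
    then show False by (auto simp: \<beta>_def \<delta>_def)
  qed
  have inj: "inj_on f standard_square"
  proof (rule inj_onI)
    fix x y assume xy: "f x = f y"
    have \<gamma>: "\<gamma> x = \<gamma> y" using less[OF xy] less[OF xy[symmetric]] by linarith
    have "\<beta> x = \<beta> y" "\<delta> x = \<delta> y"
      using arg_cong[OF xy, of l0] arg_cong[OF xy, of l1] \<gamma> z0(3) z1(4) by (simp_all add: f_def p0 p1)
    then have "x $ 1 = y $ 1 \<and> x $ 2 = y $ 2" using \<gamma> unfolding \<beta>_def \<delta>_def \<gamma>_def by linarith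
    then show "x = y" by (simp add: vec_eq_iff forall_2)
  qed
  have basis: "\<exists>b c. x = p b 0 c" for x
  proof -
    have "\<exists>b c. x - A = b *\<^sub>R (B - A) + c *\<^sub>R (C - A) "
    proof -
      define l where "l w = l0 (A + w) * l1 C - l1 (A + w) * l0 C" for w
      show ?thesis
      proof (rule plane_basis[of l _ _ "l0 B * l1 C" "\<lambda>w. l1 (A + w)" "l1 C"])
        show "l (b *\<^sub>R (B - A) + c *\<^sub>R (C - A)) = b * (l0 B * l1 C)"
          "l1 (A + (b *\<^sub>R (B - A) + c *\<^sub>R (C - A))) = c * l1 C" for b c
          using p0[of b 0 c] p1[of b 0 c] by (simp_all add: l_def p_def add.assoc algebra_simps)
      qed (use z0 z1 in auto)
    qed
    then obtain b c where "x - A = b *\<^sub>R (B - A) + c *\<^sub>R (C - A)" by blast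
    then have "x = p b 0 c" by (simp add: p_def algebra_simps)
    then show ?thesis by blast
  qed
  have fI: "x \<in> f ` standard_square"
    if "x = p (\<beta> y) (\<delta> y) (\<gamma> y)" "0 \<le> y $ 1 \<and> y $ 1 \<le> 1 \<and> 0 \<le> y $ 2 \<and> y $ 2 \<le> 1" for x y
    using that unfolding sq f_def by blast
  have "T \<subseteq> f ` standard_square"
  proof
    fix x assume x: "x \<in> T"
    obtain b c where bc: "x = p b 0 c" using basis by blast
    obtain b' c' where D': "D = p b' 0 c'" using basis by blast
    have eD: "b' * l0 B + c' * l0 C = 0" "0 < c' * l1 C"
      using z0(2) z1(4) p0[of b' 0 c'] p1[of b' 0 c'] unfolding D'[symmetric] by simp_all
    then have c': "c' > 0" using z1(3) by (simp add: zero_less_mult_iff)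
    then have "b' * l0 B < 0" using eD(1) z0(4) by (metis add_less_same_cancel1 mult_pos_pos add_eq_0_iff neg_less_0_iff_less add.commute)
    then have b': "b' < 0" using z0(3) by (simp add: mult_less_0_iff)
    show "x \<in> f ` standard_square"
    proof (cases "0 \<le> b")
      case True
      have c: "0 \<le> c" using l1(1)[OF x] z1(3) by (simp add: bc p1 zero_le_mult_iff)
      have "b + c \<le> 1" using l2(1)[OF x] z2(3) by (simp add: bc p2 zero_le_mult_iff)
      then show ?thesis
        using True c bc by (intro fI[of _ "(b + c) *\<^sub>R axis 1 1 + c *\<^sub>R axis 2 1"]) (auto simp: \<beta>_def \<delta>_def \<gamma>_def)
    next
      case False
      define d where "d = b / b'"
      define e where "e = c - c' * d"
      have d: "d > 0" "b = d * b'" using False b' by (simp_all add: d_def zero_less_divide_iff)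
      have xe: "x = p 0 d e"
      proof -
        have "D - A = b' *\<^sub>R (B - A) + c' *\<^sub>R (C - A)" using D' by (simp add: p_def)
        then show ?thesis unfolding bc p_def e_def d(2)
          by (simp only:) (simp add: algebra_simps)
      qed
      have e: "0 \<le> e" using l0(1)[OF x] z0(4) by (simp add: xe p0 zero_le_mult_iff)
      have "d + e \<le> 1" using l3(1)[OF x] z3(3) by (simp add: xe p3 zero_le_mult_iff)
      then show ?thesis
        using d(1) e xe by (intro fI[of _ "e *\<^sub>R axis 1 1 + (e + d) *\<^sub>R axis 2 1"]) (auto simp: \<beta>_def \<delta>_def \<gamma>_def)
    qed
  qed
  then have "f ` standard_square = T" using fT by blast
  then have bij: "bij_betw f standard_square T" using inj by (simp add: bij_betw_def)
  have "x \<in> square_edge i \<longleftrightarrow> f x \<in> t i" if i: "i < 4" and x: "x \<in> standard_square" for i x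
  proof -
    have s: "0 \<le> x $ 1" "x $ 1 \<le> 1" "0 \<le> x $ 2" "x $ 2 \<le> 1" using sq[of x] x by blast+
    have nn: "0 \<le> \<beta> x" "0 \<le> \<delta> x" "0 \<le> \<gamma> x" "0 \<le> 1 - \<beta> x - \<delta> x - \<gamma> x"
      using s unfolding \<beta>_def \<delta>_def \<gamma>_def by linarith+
    have sum0: "u * a + w * b = 0 \<longleftrightarrow> u = 0 \<and> w = 0" if "0 \<le> u" "0 \<le> w" "0 < a" "0 < b" for u w a b :: real
      using that by (simp add: add_nonneg_eq_0_iff)
    have e: "f x \<in> t 0 \<longleftrightarrow> \<beta> x = 0 \<and> \<gamma> x = 0" "f x \<in> t 1 \<longleftrightarrow> \<delta> x = 0 \<and> \<gamma> x = 0"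
      "f x \<in> t 2 \<longleftrightarrow> 1 - \<beta> x - \<delta> x - \<gamma> x = 0 \<and> \<delta> x = 0" "f x \<in> t 3 \<longleftrightarrow> 1 - \<beta> x - \<delta> x - \<gamma> x = 0 \<and> \<beta> x = 0"
      unfolding l0(2)[OF fT[OF x]] l1(2)[OF fT[OF x]] l2(2)[OF fT[OF x]] l3(2)[OF fT[OF x]]
      unfolding f_def p0 p1 p2 p3
      by (rule sum0[OF nn(1,3) z0(3,4)] sum0[OF nn(2,3) z1(4,3)] sum0[OF nn(4,2) z2(3,4)] sum0[OF nn(4,1) z3(3,4)])+
    have e': "\<beta> x = 0 \<and> \<gamma> x = 0 \<longleftrightarrow> x $ 1 = 0" "\<delta> x = 0 \<and> \<gamma> x = 0 \<longleftrightarrow> x $ 2 = 0"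
      "1 - \<beta> x - \<delta> x - \<gamma> x = 0 \<and> \<delta> x = 0 \<longleftrightarrow> x $ 1 = 1" "1 - \<beta> x - \<delta> x - \<gamma> x = 0 \<and> \<beta> x = 0 \<longleftrightarrow> x $ 2 = 1"
      using s unfolding \<beta>_def \<delta>_def \<gamma>_def by linarith+
    have "i = 0 \<or> i = 1 \<or> i = 2 \<or> i = 3" using i by auto
    then show ?thesis
      using x by (elim disjE; hypsubst; simp only: e[unfolded e']; simp add: square_edge_def)
  qed
  with cont bij show ?thesis by (rule that)
qed

lemma cyclic_characteristic:
  assumes T: "edge_cycle T m t" and c: "\<And>i. i < m \<Longrightarrow> \<mu> (t i) \<noteq> 0"
    and adj: "\<And>i. i < m \<Longrightarrow> \<mu> (t i) \<noteq> \<mu> (t (Suc i mod m))"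
  shows "characteristic_function T \<mu>"
  unfolding characteristic_function_def span_base_group
proof (intro ballI impI)
  fix F G assume F: "F \<in> facets T" and G: "G \<in> facets T" and FG: "F \<noteq> G \<and> F \<inter> G \<noteq> {}"
  have fac: "facets T = t ` {..<m}" using T unfolding edge_cycle_def bij_betw_def by blast
  obtain i where i: "i < m" "F = t i" using F unfolding fac by blast
  obtain j where j: "j < m" "G = t j" using G unfolding fac by blast
  have "i \<noteq> j" using FG i j by blast
  then have "cyclic_neighbours m i j" using edge_cycle_meet(3)[OF T i(1) j(1)] FG i j by blast
  then show "\<mu> F \<noteq> 0 \<and> \<mu> G \<noteq> 0 \<and> \<mu> F \<noteq> \<mu> G"
    using c[OF i(1)] c[OF j(1)] adj[OF i(1)] adj[OF j(1)] i j unfolding cyclic_neighbours_def by metis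
qed

text \<open>
  Two vectors of \<open>(Z/2)\<^sup>2\<close> form a basis as soon as they are nonzero and different.  Thus
  \<open>\<nu>\<close> is a projective characteristic function, and its first components colour the edges, listed in
  cyclic order, with the three nonzero vectors.
\<close>

definition coloured :: "nat \<Rightarrow> plane set \<Rightarrow> pchar \<Rightarrow> nat \<Rightarrow> (nat \<Rightarrow> plane set) \<Rightarrow> bool" where
  "coloured k P \<nu> m e \<longleftrightarrow> edge_cycle P m e \<and> (\<forall>F. \<nu> F \<in> bundle_group k) \<and>
     (\<forall>i<m. fst (\<nu> (e i)) \<noteq> 0 \<and> fst (\<nu> (e i)) \<noteq> fst (\<nu> (e (Suc i mod m))))"

lemma coloured_characteristic:
  assumes "coloured k P \<nu> m e" shows "characteristic_function P (\<lambda>F. fst (\<nu> F))"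
  by (rule cyclic_characteristic[of P m e]) (use assms in \<open>auto simp: coloured_def\<close>)

text \<open>
  The three edges have the three different colours, so an automorphism of \<open>(Z/2)\<^sup>2\<close> turns the
  standard values \<open>e\<^sub>1, e\<^sub>2, e\<^sub>1 + e\<^sub>2\<close> into them.
\<close>

lemma triangle_pair:
  assumes k: "k \<ge> 1" and T: "coloured k T \<nu> 3 t"
  shows "projective_bundle_pair TYPE(line_carrier) k RP2 glued_action (T, \<nu>)"
proof -
  let ?\<mu> = "\<lambda>F. fst (\<nu> F)"
  have ec: "edge_cycle T 3 t" and \<nu>: "\<And>F. \<nu> F \<in> bundle_group k" using T unfolding coloured_def by blast+
  have c: "?\<mu> (t i) \<noteq> 0" "?\<mu> (t i) \<noteq> ?\<mu> (t (Suc i mod 3))" if "i < 3" for i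
    using T that unfolding coloured_def by blast+
  have ne: "?\<mu> (t 0) \<noteq> 0" "?\<mu> (t 1) \<noteq> 0" "?\<mu> (t 2) \<noteq> 0" "?\<mu> (t 0) \<noteq> ?\<mu> (t 1)" "?\<mu> (t 1) \<noteq> ?\<mu> (t 2)" "?\<mu> (t 2) \<noteq> ?\<mu> (t 0)"
    using c[of 0] c[of 1] c[of 2] by (simp_all add: numeral_2_eq_2)
  have sum: "?\<mu> (t 2) = ?\<mu> (t 0) + ?\<mu> (t 1)"
    using base_group_cases[OF ne(1,2,4), of "?\<mu> (t 2)"] ne by metis
  define \<psi> where "\<psi> = (\<lambda>v :: base_group. v $ 1 *s ?\<mu> (t 0) + v $ 2 *s ?\<mu> (t 1))"
  note \<psi> = base_group_automorphism[OF ne(1,2,4) \<psi>_def]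
  obtain f where f: "continuous_on standard_triangle f" "bij_betw f standard_triangle T"
    "\<And>i x. i < 3 \<Longrightarrow> x \<in> standard_triangle \<Longrightarrow> x \<in> triangle_edge i \<longleftrightarrow> f x \<in> t i"
    using triangle_parametrization[OF ec] by blast
  let ?std = "\<lambda>F :: plane set. if F \<subseteq> {x. x $ 1 = 0} then axis 1 1
          else if F \<subseteq> {x. x $ 2 = 0} then axis 2 1 else axis 1 1 + axis 2 1 :: base_group"
  have e: "axis 1 1 \<in> triangle_edge 1" "axis 1 1 \<in> triangle_edge 2" "axis 2 1 \<in> triangle_edge 2"
    by (auto simp: triangle_edge_def standard_triangle)
  have std: "?std (triangle_edge 0) = axis 1 1" "?std (triangle_edge 1) = axis 2 1" "?std (triangle_edge 2) = axis 1 1 + axis 2 1"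
  proof -
    have "triangle_edge 0 \<subseteq> {x. x $ 1 = 0}" "triangle_edge 1 \<subseteq> {x. x $ 2 = 0}" by (auto simp: triangle_edge_def)
    moreover have "\<not> triangle_edge 1 \<subseteq> {x. x $ 1 = 0}" "\<not> triangle_edge 2 \<subseteq> {x. x $ 1 = 0}" using e(1,2) by auto
    moreover have "\<not> triangle_edge 2 \<subseteq> {x. x $ 2 = 0}" using e(3) by auto
    ultimately show "?std (triangle_edge 0) = axis 1 1" "?std (triangle_edge 1) = axis 2 1" "?std (triangle_edge 2) = axis 1 1 + axis 2 1"
      by (simp_all only: if_True if_False)
  qed
  have fac: "facets T = t ` {..<3}" using ec unfolding edge_cycle_def bij_betw_def by blast
  have pT: "polygon T" using ec unfolding edge_cycle_def by blast
  have cpt: "compact standard_triangle" by (rule finite_imp_compact_convex_hull) simp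
  have match: "\<psi> (?std (triangle_edge i)) = ?\<mu> (t i)" if "i \<in> {..<3}" for i
  proof -
    have "i = 0 \<or> i = 1 \<or> i = 2" using that by auto
    then show ?thesis by (elim disjE; hypsubst; simp only: std \<psi> sum)
  qed
  obtain q where "surface_model T ?\<mu> (surface_cover standard_triangle ?std) glued_action \<psi> q"
    by (rule surface_model_transport[OF pT coloured_characteristic[OF T] f(1,2) cpt \<psi>(1) triangle_facets fac _ match])
      (use f(3) in auto)
  then show ?thesis
    unfolding RP2_def by (rule surface_model.projective_bundle_pair_model[OF _ k \<nu> refl])
qed

text \<open>
  The colouring with equal values on opposite edges is the standard one up to an automorphism of
  \<open>(Z/2)\<^sup>2\<close>.
\<close>

lemma square_pair:
  assumes k: "k \<ge> 1" and T: "coloured k T \<nu> 4 t"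
    and two: "fst (\<nu> (t 2)) = fst (\<nu> (t 0))" "fst (\<nu> (t 3)) = fst (\<nu> (t 1))"
  shows "projective_bundle_pair TYPE(line_carrier) k T2 glued_action (T, \<nu>)"
proof -
  let ?\<mu> = "\<lambda>F. fst (\<nu> F)"
  have ec: "edge_cycle T 4 t" and \<nu>: "\<And>F. \<nu> F \<in> bundle_group k" using T unfolding coloured_def by blast+
  have c: "?\<mu> (t i) \<noteq> 0" "?\<mu> (t i) \<noteq> ?\<mu> (t (Suc i mod 4))" if "i < 4" for i
    using T that unfolding coloured_def by blast+
  have ne: "?\<mu> (t 0) \<noteq> 0" "?\<mu> (t 1) \<noteq> 0" "?\<mu> (t 0) \<noteq> ?\<mu> (t 1)"
    using c[of 0] c[of 1] by simp_all
  define \<psi> where "\<psi> = (\<lambda>v :: base_group. v $ 1 *s ?\<mu> (t 0) + v $ 2 *s ?\<mu> (t 1))"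
  note \<psi> = base_group_automorphism[OF ne \<psi>_def]
  obtain f where f: "continuous_on standard_square f" "bij_betw f standard_square T"
    "\<And>i x. i < 4 \<Longrightarrow> x \<in> standard_square \<Longrightarrow> x \<in> square_edge i \<longleftrightarrow> f x \<in> t i"
    using square_parametrization[OF ec] by blast
  let ?std = "\<lambda>F :: plane set. if F \<subseteq> {x. x $ 1 = 0} \<or> F \<subseteq> {x. x $ 1 = 1} then axis 1 1 else axis 2 1 :: base_group"
  have e: "axis 1 1 \<in> square_edge 1" "0 \<in> square_edge 1" "axis 1 1 + axis 2 1 \<in> square_edge 3" "axis 2 1 \<in> square_edge 3"
    by (auto simp: square_edge_def forall_2)
  have std: "?std (square_edge 0) = axis 1 1" "?std (square_edge 1) = axis 2 1" "?std (square_edge 2) = axis 1 1" "?std (square_edge 3) = axis 2 1"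
  proof -
    have "square_edge 0 \<subseteq> {x. x $ 1 = 0}" "square_edge 2 \<subseteq> {x. x $ 1 = 1}" by (auto simp: square_edge_def)
    moreover have "\<not> square_edge 1 \<subseteq> {x. x $ 1 = 0}" using e(1) by auto
    moreover have "\<not> square_edge 1 \<subseteq> {x. x $ 1 = 1}" using e(2) by auto
    moreover have "\<not> square_edge 3 \<subseteq> {x. x $ 1 = 0}" using e(3) by auto
    moreover have "\<not> square_edge 3 \<subseteq> {x. x $ 1 = 1}" using e(4) by auto
    ultimately show "?std (square_edge 0) = axis 1 1" "?std (square_edge 1) = axis 2 1" "?std (square_edge 2) = axis 1 1" "?std (square_edge 3) = axis 2 1"
      by (simp_all only: if_True if_False simp_thms)
  qed
  have fac: "facets T = t ` {..<4}" using ec unfolding edge_cycle_def bij_betw_def by blast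
  have pT: "polygon T" using ec unfolding edge_cycle_def by blast
  have "standard_square = cbox 0 1" by (auto simp: mem_box_cart)
  then have cpt: "compact standard_square" using compact_cbox[of "0 :: plane" 1] by simp
  have match: "\<psi> (?std (square_edge i)) = ?\<mu> (t i)" if "i \<in> {..<4}" for i
  proof -
    have "i = 0 \<or> i = 1 \<or> i = 2 \<or> i = 3" using that by auto
    then show ?thesis by (elim disjE; hypsubst; simp only: std \<psi> two)
  qed
  obtain q where "surface_model T ?\<mu> (surface_cover standard_square ?std) glued_action \<psi> q"
    by (rule surface_model_transport[OF pT coloured_characteristic[OF T] f(1,2) cpt \<psi>(1) square_facets fac _ match])
      (use f(3) in auto)
  then show ?thesis
    unfolding T2_def by (rule surface_model.projective_bundle_pair_model[OF _ k \<nu> refl])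
qed

section \<open>Cutting coloured polygons\<close>

lemma cyclic_neighbours_iff:
  assumes "3 \<le> m" "a < m" "b < m" "a \<noteq> b"
  shows "cyclic_neighbours m a b \<longleftrightarrow> b = Suc a \<or> a = Suc b \<or> a = 0 \<and> b = m - 1 \<or> b = 0 \<and> a = m - 1"
proof -
  have s: "Suc c mod m = (if c = m - 1 then 0 else Suc c)" if "c < m" for c
    using that by (cases "Suc c = m") auto
  show ?thesis
    unfolding cyclic_neighbours_def s[OF assms(2)] s[OF assms(3)] using assms by auto
qed

lemma coloured_cong:
  assumes "\<And>i. i < m \<Longrightarrow> e i = e' i" "coloured k P \<nu> m e"
  shows "coloured k P \<nu> m e'"
proof -
  have m: "3 \<le> m" using assms(2) unfolding coloured_def edge_cycle_def by blast
  have "bij_betw e {..<m} (facets P) \<longleftrightarrow> bij_betw e' {..<m} (facets P)"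
    by (rule bij_betw_cong) (use assms(1) in simp)
  moreover have "Suc i mod m < m" for i using m by simp
  ultimately show ?thesis using assms unfolding coloured_def edge_cycle_def by (auto simp del: mod_Suc_eq)
qed

lemma coloured_rotate1:
  assumes c: "coloured k P \<nu> m e"
  shows "coloured k P \<nu> m (\<lambda>i. e (Suc i mod m))"
proof -
  have e: "edge_cycle P m e" and m: "3 \<le> m" using c unfolding coloured_def edge_cycle_def by blast+
  have bij: "bij_betw e {..<m} (facets P)" using e unfolding edge_cycle_def by blast
  have P: "polygon P" using e unfolding edge_cycle_def by blast
  have lt: "Suc i mod m < m" for i using m by simp
  have s: "Suc i mod m = (if i = m - 1 then 0 else Suc i)" if "i < m" for i
    using that by (cases "Suc i = m") auto
  have inj: "inj_on (\<lambda>i. Suc i mod m) {..<m}"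
  proof (rule inj_onI)
    fix i j assume ij: "i \<in> {..<m}" "j \<in> {..<m}" "Suc i mod m = Suc j mod m"
    have i: "i < m" and j: "j < m" using ij by simp_all
    show "i = j" using ij(3) i j unfolding s[OF i] s[OF j] by (simp split: if_splits)
  qed
  have "(\<lambda>i. Suc i mod m) ` {..<m} = {..<m}"
    by (rule endo_inj_surj[OF _ _ inj]) (use lt in auto)
  then have "bij_betw (\<lambda>i. Suc i mod m) {..<m} {..<m}" using inj by (simp add: bij_betw_def)
  from bij_betw_trans[OF this bij] have b: "bij_betw (\<lambda>i. e (Suc i mod m)) {..<m} (facets P)" by (simp add: o_def)
  have "e (Suc i mod m) \<inter> e (Suc j mod m) \<noteq> {} \<longleftrightarrow> cyclic_neighbours m i j" if ij: "i < m" "j < m" "i \<noteq> j" for i j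
  proof -
    have ne: "Suc i mod m \<noteq> Suc j mod m"
    proof
      assume "Suc i mod m = Suc j mod m"
      then have "i = j" by (rule inj_onD[OF inj]) (simp_all add: ij)
      then show False using ij(3) by simp
    qed
    have "e (Suc i mod m) \<inter> e (Suc j mod m) \<noteq> {} \<longleftrightarrow> cyclic_neighbours m (Suc i mod m) (Suc j mod m)"
      by (rule edge_cycle_meet(3)[OF e lt lt ne])
    also have "\<dots> \<longleftrightarrow> cyclic_neighbours m i j"
      unfolding cyclic_neighbours_iff[OF m lt lt ne] cyclic_neighbours_iff[OF m ij]
      unfolding s[OF ij(1)] s[OF ij(2)]
      using ij m by (cases "i = m - 1"; cases "j = m - 1") auto
    finally show ?thesis .
  qed
  then have e': "edge_cycle P m (\<lambda>i. e (Suc i mod m))" unfolding edge_cycle_def by (intro conjI P m b allI impI)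
  show ?thesis using c e' lt unfolding coloured_def by simp
qed

lemma coloured_rotate:
  assumes c: "coloured k P \<nu> m e"
  shows "coloured k P \<nu> m (\<lambda>i. e ((i + c) mod m))"
proof (induction c)
  case 0
  show ?case by (rule coloured_cong[OF _ c]) simp
next
  case (Suc c)
  show ?case by (rule coloured_cong[OF _ coloured_rotate1[OF Suc]]) (simp add: mod_add_left_eq)
qed

lemma pull_back:
  assumes w: "edge_cycle W n w" and c: "\<And>i. i < n \<Longrightarrow> c i \<in> bundle_group k"
  obtains \<omega> where "\<And>i. i < n \<Longrightarrow> \<omega> (w i) = c i" "\<And>F. \<omega> F \<in> bundle_group k"
proof -
  have inj: "inj_on w {..<n}" using w unfolding edge_cycle_def bij_betw_def by blast
  define \<omega> where "\<omega> F = (if F \<in> w ` {..<n} then c (inv_into {..<n} w F) else 0)" for F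
  have "\<omega> (w i) = c i" if "i < n" for i
    using that inv_into_f_f[OF inj, of i] by (simp add: \<omega>_def)
  moreover have "\<omega> F \<in> bundle_group k" for F
    using inv_into_into[of F w "{..<n}"] c bundle_group_zero by (auto simp: \<omega>_def)
  ultimately show ?thesis by (rule that)
qed

text \<open>
  The edges of one part of a cut polygon appear in the whole polygon as \<open>e (\<sigma> 0), \<dots>, e (\<sigma> (n - 1))\<close>;
  the vertex between the last and the first one is cut off.
\<close>

lemma cut_side:
  assumes W: "edge_cycle W n w" and e: "inj_on e {..<m}"
    and \<sigma>: "\<And>i. i < n \<Longrightarrow> \<sigma> i < m" "inj_on \<sigma> {..<n}" and j: "\<And>i. i < n \<Longrightarrow> j (w i) = e (\<sigma> i)"
    and ab: "a < m" "b < m" "a \<noteq> b"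
  shows "(\<exists>F\<in>facets W. \<exists>G\<in>facets W. e a = j F \<and> e b = j G \<and> F \<inter> G \<noteq> {} \<and> {F, G} \<noteq> {w (n - 1), w 0}) \<longleftrightarrow>
     (\<exists>c<n. \<exists>d<n. a = \<sigma> c \<and> b = \<sigma> d \<and> (d = Suc c \<or> c = Suc d))"
proof -
  have n: "3 \<le> n" and fac: "facets W = w ` {..<n}" and inj: "inj_on w {..<n}"
    using W unfolding edge_cycle_def bij_betw_def by auto
  have eq: "w c = w d \<longleftrightarrow> c = d" if "c < n" "d < n" for c d using inj_on_eq_iff[OF inj] that by simp
  have meet: "w c \<inter> w d \<noteq> {} \<and> {w c, w d} \<noteq> {w (n - 1), w 0} \<longleftrightarrow> d = Suc c \<or> c = Suc d"
    if cd: "c < n" "d < n" "c \<noteq> d" for c d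
  proof -
    have "{w c, w d} = {w (n - 1), w 0} \<longleftrightarrow> c = n - 1 \<and> d = 0 \<or> c = 0 \<and> d = n - 1"
      using eq cd n by (simp add: doubleton_eq_iff)
    then show ?thesis
      unfolding edge_cycle_meet(3)[OF W cd] cyclic_neighbours_iff[OF n cd] using n by auto
  qed
  show ?thesis
  proof
    assume "\<exists>F\<in>facets W. \<exists>G\<in>facets W. e a = j F \<and> e b = j G \<and> F \<inter> G \<noteq> {} \<and> {F, G} \<noteq> {w (n - 1), w 0}"
    then obtain c d where cd: "c < n" "d < n" "e a = j (w c)" "e b = j (w d)"
      "w c \<inter> w d \<noteq> {} \<and> {w c, w d} \<noteq> {w (n - 1), w 0}" unfolding fac by blast
    have a: "a = \<sigma> c" and b: "b = \<sigma> d"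
      using cd(3,4) j[OF cd(1)] j[OF cd(2)] inj_on_eq_iff[OF e] ab \<sigma>(1)[OF cd(1)] \<sigma>(1)[OF cd(2)] by simp_all
    then have "c \<noteq> d" using ab(3) by blast
    then show "\<exists>c<n. \<exists>d<n. a = \<sigma> c \<and> b = \<sigma> d \<and> (d = Suc c \<or> c = Suc d)"
      using meet[OF cd(1,2)] cd(1,2,5) a b by blast
  next
    assume "\<exists>c<n. \<exists>d<n. a = \<sigma> c \<and> b = \<sigma> d \<and> (d = Suc c \<or> c = Suc d)"
    then obtain c d where cd: "c < n" "d < n" "a = \<sigma> c" "b = \<sigma> d" "d = Suc c \<or> c = Suc d" by blast
    then have "c \<noteq> d" by auto
    then have "w c \<inter> w d \<noteq> {} \<and> {w c, w d} \<noteq> {w (n - 1), w 0}" using meet[OF cd(1,2)] cd(5) by blast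
    moreover have "w c \<in> facets W" "w d \<in> facets W" unfolding fac using cd by auto
    moreover have "e a = j (w c)" "e b = j (w d)" using j cd by simp_all
    ultimately show "\<exists>F\<in>facets W. \<exists>G\<in>facets W. e a = j F \<and> e b = j G \<and> F \<inter> G \<noteq> {} \<and> {F, G} \<noteq> {w (n - 1), w 0}"
      by blast
  qed
qed

text \<open>
  Fibre sums refer to the polygons only through the adjacency of their edges, so one may cut a
  cyclic sequence of edges: \<open>W\<close> takes the edges from \<open>0\<close> to \<open>n - 1\<close> and \<open>T\<close> those from \<open>n - 1\<close> around
  to \<open>0\<close>.  They share the two edges \<open>e 0\<close> and \<open>e (n - 1)\<close>, which meet in a vertex of either part.
\<close>

lemma fibre_sum_cut:
  assumes R: "edge_cycle R m e" and W: "edge_cycle W n w" and T: "edge_cycle T l t" and m: "m + 2 = n + l"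
    and \<omega>: "\<And>i. i < n \<Longrightarrow> \<omega> (w i) = \<rho> (e i)"
    and \<tau>: "\<And>i. i < l \<Longrightarrow> \<tau> (t i) = \<rho> (e ((n - 1 + i) mod m))"
  shows "fibre_sum (W, \<omega>) (T, \<tau>) (R, \<rho>)"
proof -
  have n: "3 \<le> n" and l: "3 \<le> l" and m3: "3 \<le> m" and pR: "polygon R"
    and facW: "facets W = w ` {..<n}" and injw: "inj_on w {..<n}"
    and facT: "facets T = t ` {..<l}" and injt: "inj_on t {..<l}"
    and facR: "facets R = e ` {..<m}" and inje: "inj_on e {..<m}"
    using R W T unfolding edge_cycle_def bij_betw_def by auto
  define \<sigma> where "\<sigma> i = (n - 1 + i) mod m" for i
  have \<sigma>: "\<sigma> i = (if i = l - 1 then 0 else n - 1 + i)" if "i < l" for i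
  proof (cases "i = l - 1")
    case True
    then have "n - 1 + i = m" using m n l by simp
    then show ?thesis using True by (simp add: \<sigma>_def)
  next
    case False
    then have "n - 1 + i < m" using that m n l by simp
    then show ?thesis using False by (simp add: \<sigma>_def)
  qed
  have \<sigma>m: "\<sigma> i < m" for i using m3 by (simp add: \<sigma>_def)
  have inj\<sigma>: "inj_on \<sigma> {..<l}" by (rule inj_onI) (use n in \<open>auto simp: \<sigma> split: if_splits\<close>)
  have img\<sigma>: "\<sigma> ` {..<l} = insert 0 {n - 1..<m}"
  proof (intro equalityI subsetI)
    fix x assume "x \<in> \<sigma> ` {..<l}"
    then show "x \<in> insert 0 {n - 1..<m}" using m n l by (auto simp: \<sigma> split: if_splits)
  next
    fix x assume x: "x \<in> insert 0 {n - 1..<m}"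
    show "x \<in> \<sigma> ` {..<l}"
    proof (cases "x = 0")
      case True
      have "\<sigma> (l - 1) = x" using True l by (simp add: \<sigma>)
      then show ?thesis using l by (intro rev_image_eqI[of "l - 1"]) auto
    next
      case False
      then have "n - 1 \<le> x" "x < m" using x by auto
      then have "\<sigma> (x - (n - 1)) = x" "x - (n - 1) < l" using m n l by (auto simp: \<sigma>)
      then show ?thesis by (intro rev_image_eqI[of "x - (n - 1)"]) auto
    qed
  qed
  define j where "j F = e (inv_into {..<n} w F)" for F
  define j' where "j' F = e (\<sigma> (inv_into {..<l} t F))" for F
  have j: "j (w i) = e i" if "i < n" for i using that inv_into_f_f[OF injw, of i] by (simp add: j_def)
  have j': "j' (t i) = e (\<sigma> i)" if "i < l" for i using that inv_into_f_f[OF injt, of i] by (simp add: j'_def)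
  have nm: "i < m" if "i < n" for i using that m l by simp
  have imgj: "j ` facets W = e ` {..<n}" unfolding facW image_image using j by (intro image_cong) auto
  have imgj': "j' ` facets T = e ` insert 0 {n - 1..<m}"
    unfolding facT image_image img\<sigma>[symmetric] using j' by (intro image_cong) auto
  have ends: "w (n - 1) \<in> facets W" "w 0 \<in> facets W" "t 0 \<in> facets T" "t (l - 1) \<in> facets T"
    unfolding facW facT using n l by auto
  have jends: "j (w (n - 1)) = e (n - 1)" "j (w 0) = e 0" "j' (t 0) = e (n - 1)" "j' (t (l - 1)) = e 0"
    using j[of "n - 1"] j[of 0] j'[of 0] j'[of "l - 1"] n l by (simp_all add: \<sigma>)
  have glue: "j (w (n - 1)) = j' (t 0)" "j (w 0) = j' (t (l - 1))" by (simp_all only: jends)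
  have 1: "w (n - 1) \<noteq> w 0 \<and> w (n - 1) \<inter> w 0 \<noteq> {}"
    using edge_cycle_meet(2,3)[OF W, of "n - 1" 0] n by (simp add: cyclic_neighbours_def)
  have 2: "t 0 \<noteq> t (l - 1) \<and> t 0 \<inter> t (l - 1) \<noteq> {}"
    using edge_cycle_meet(2,3)[OF T, of 0 "l - 1"] l by (simp add: cyclic_neighbours_def)
  have 3: "\<omega> (w (n - 1)) = \<tau> (t 0) \<and> \<omega> (w 0) = \<tau> (t (l - 1))"
    using \<omega>[of "n - 1"] \<omega>[of 0] \<tau>[of 0] \<tau>[of "l - 1"] \<sigma>[of 0] \<sigma>[of "l - 1"] n l by (simp add: \<sigma>_def)
  have 4: "inj_on j (facets W)"
    unfolding facW by (rule inj_onI) (use j inj_on_eq_iff[OF inje] nm in auto)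
  have 5: "inj_on j' (facets T)"
    unfolding facT by (rule inj_onI) (use j' inj_on_eq_iff[OF inje] \<sigma>m inj_on_eq_iff[OF inj\<sigma>] in auto)
  have 6: "j ` facets W \<union> j' ` facets T = facets R"
  proof -
    have "{..<n} \<union> insert 0 {n - 1..<m} = {..<m}" using m l n by auto
    then show ?thesis unfolding imgj imgj' facR image_Un[symmetric] by simp
  qed
  have 7: "j ` facets W \<inter> j' ` facets T = {j (w (n - 1)), j (w 0)}"
  proof -
    have "e ` {..<n} \<inter> e ` insert 0 {n - 1..<m} = e ` ({..<n} \<inter> insert 0 {n - 1..<m})"
      by (rule inj_on_image_Int[OF inje, symmetric]) (use m l n in auto)
    also have "{..<n} \<inter> insert 0 {n - 1..<m} = {n - 1, 0}" using m l n by auto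
    finally show ?thesis unfolding imgj imgj' jends by simp
  qed
  have 8: "\<rho> (j F) = \<omega> F" if "F \<in> facets W" for F using that j \<omega> unfolding facW by auto
  have 9: "\<rho> (j' F) = \<tau> F" if "F \<in> facets T" for F using that j' \<tau> unfolding facT \<sigma>_def by auto
  have 10: "H \<inter> H' \<noteq> {} \<longleftrightarrow>
      (\<exists>F\<in>facets W. \<exists>G\<in>facets W. H = j F \<and> H' = j G \<and> F \<inter> G \<noteq> {} \<and> {F, G} \<noteq> {w (n - 1), w 0}) \<or>
      (\<exists>F\<in>facets T. \<exists>G\<in>facets T. H = j' F \<and> H' = j' G \<and> F \<inter> G \<noteq> {} \<and> {F, G} \<noteq> {t 0, t (l - 1)})"
    if HR: "H \<in> facets R" "H' \<in> facets R" "H \<noteq> H'" for H H'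
  proof -
    obtain a b where ab: "a < m" "H = e a" "b < m" "H' = e b" using HR(1,2) unfolding facR by blast
    have ne: "a \<noteq> b" using HR(3) ab by blast
    have s1: "(\<exists>F\<in>facets W. \<exists>G\<in>facets W. e a = j F \<and> e b = j G \<and> F \<inter> G \<noteq> {} \<and> {F, G} \<noteq> {w (n - 1), w 0}) \<longleftrightarrow>
        (\<exists>c<n. \<exists>d<n. a = id c \<and> b = id d \<and> (d = Suc c \<or> c = Suc d))"
      by (rule cut_side[OF W inje _ _ _ ab(1,3) ne]) (use nm j in auto)
    have s2: "(\<exists>F\<in>facets T. \<exists>G\<in>facets T. e a = j' F \<and> e b = j' G \<and> F \<inter> G \<noteq> {} \<and> {F, G} \<noteq> {t (l - 1), t 0}) \<longleftrightarrow>
        (\<exists>c<l. \<exists>d<l. a = \<sigma> c \<and> b = \<sigma> d \<and> (d = Suc c \<or> c = Suc d))"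
      by (rule cut_side[OF T inje \<sigma>m inj\<sigma> j' ab(1,3) ne])
    have c1: "(\<exists>c<n. \<exists>d<n. a = id c \<and> b = id d \<and> (d = Suc c \<or> c = Suc d)) \<longleftrightarrow> a < n \<and> b < n \<and> (b = Suc a \<or> a = Suc b)"
      by auto
    have c2: "(\<exists>c<l. \<exists>d<l. a = \<sigma> c \<and> b = \<sigma> d \<and> (d = Suc c \<or> c = Suc d)) \<longleftrightarrow>
        n - 1 \<le> a \<and> n - 1 \<le> b \<and> (b = Suc a \<or> a = Suc b) \<or> a = m - 1 \<and> b = 0 \<or> a = 0 \<and> b = m - 1" (is "?L \<longleftrightarrow> ?R")
    proof
      assume ?L
      then obtain c d where "c < l" "d < l" "a = \<sigma> c" "b = \<sigma> d" "d = Suc c \<or> c = Suc d" by blast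
      then show ?R using m n l by (auto simp: \<sigma> split: if_splits)
    next
      assume ?R
      then consider "n - 1 \<le> a" "n - 1 \<le> b" "b = Suc a \<or> a = Suc b" | "a = m - 1" "b = 0" | "a = 0" "b = m - 1" by blast
      then show ?L
      proof cases
        case 1
        then have "a - (n - 1) < l" "b - (n - 1) < l" "a = \<sigma> (a - (n - 1))" "b = \<sigma> (b - (n - 1))"
          "b - (n - 1) = Suc (a - (n - 1)) \<or> a - (n - 1) = Suc (b - (n - 1))"
          using ab m n l by (auto simp: \<sigma>)
        then show ?thesis by blast
      next
        case 2
        then have "a = \<sigma> (l - 2)" "b = \<sigma> (l - 1)" "l - 1 = Suc (l - 2)" "l - 2 < l" "l - 1 < l"
          using m n l by (auto simp: \<sigma>)
        then show ?thesis by blast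
      next
        case 3
        then have "b = \<sigma> (l - 2)" "a = \<sigma> (l - 1)" "l - 1 = Suc (l - 2)" "l - 2 < l" "l - 1 < l"
          using m n l by (auto simp: \<sigma>)
        then show ?thesis by blast
      qed
    qed
    have "H \<inter> H' \<noteq> {} \<longleftrightarrow> b = Suc a \<or> a = Suc b \<or> a = 0 \<and> b = m - 1 \<or> b = 0 \<and> a = m - 1"
      unfolding ab(2,4) edge_cycle_meet(3)[OF R ab(1,3) ne] by (rule cyclic_neighbours_iff[OF m3 ab(1,3) ne])
    also have "\<dots> \<longleftrightarrow> (a < n \<and> b < n \<and> (b = Suc a \<or> a = Suc b)) \<or>
        (n - 1 \<le> a \<and> n - 1 \<le> b \<and> (b = Suc a \<or> a = Suc b) \<or> a = m - 1 \<and> b = 0 \<or> a = 0 \<and> b = m - 1)"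
      by auto
    finally show ?thesis
      unfolding ab(2,4) insert_commute[of "t 0" "t (l - 1)" "{}"] s1 s2 c1 c2 .
  qed
  show ?thesis
    unfolding fibre_sum_def split
    by (rule conjI[OF pR], rule bexI[OF _ ends(1)], rule bexI[OF _ ends(2)], rule bexI[OF _ ends(3)],
        rule bexI[OF _ ends(4)], rule exI[of _ j], rule exI[of _ j'])
      (intro conjI ballI impI 1[THEN conjunct1] 1[THEN conjunct2] 2[THEN conjunct1] 2[THEN conjunct2]
        3[THEN conjunct1] 3[THEN conjunct2] 4 5 6 7 glue 8 9 10)
qed

lemma iterated_fibre_sum_snoc:
  assumes "iterated_fibre_sum Xs Y" "fibre_sum Y X Z"
  shows "iterated_fibre_sum (Xs @ [X]) Z"
proof -
  have chain: "fibre_sum_chain (Ys @ [X]) V Z" if "fibre_sum_chain Ys V Y" for Ys V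
    using that
  proof (induction Ys arbitrary: V)
    case Nil
    then have V: "V = Y" by simp
    have "\<exists>W. fibre_sum Y X W \<and> W = Z" using assms(2) by blast
    then show ?case unfolding V by (simp only: append_Nil fibre_sum_chain.simps)
  next
    case (Cons U Ys)
    from Cons.prems obtain W where "fibre_sum V U W" "fibre_sum_chain Ys W Y"
      by (simp only: fibre_sum_chain.simps) blast
    then have "\<exists>W. fibre_sum V U W \<and> fibre_sum_chain (Ys @ [X]) W Z" using Cons.IH by blast
    then show ?case by (simp only: append_Cons fibre_sum_chain.simps)
  qed
  show ?thesis
  proof (cases Xs)
    case Nil
    then show ?thesis using assms(1) by (simp add: iterated_fibre_sum_def)
  next
    case (Cons V Ys)
    then show ?thesis using assms(1) chain[of Ys V] by (simp add: iterated_fibre_sum_def)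
  qed
qed

text \<open>
  Both parts can be realized by arbitrary polygons with the right numbers of edges, which take over
  the values of \<open>\<nu>\<close>.
\<close>

lemma cut_off:
  assumes c: "coloured k P \<nu> m e" and m: "m + 2 = n + l" "3 \<le> n" "3 \<le> l"
  obtains W w \<omega> T t \<tau> where "edge_cycle W n w" "edge_cycle T l t" "fibre_sum (W, \<omega>) (T, \<tau>) (P, \<nu>)"
    "\<And>F. \<omega> F \<in> bundle_group k" "\<And>F. \<tau> F \<in> bundle_group k"
    "\<And>i. i < n \<Longrightarrow> \<omega> (w i) = \<nu> (e i)" "\<And>i. i < l \<Longrightarrow> \<tau> (t i) = \<nu> (e ((n - 1 + i) mod m))"
proof -
  have e: "edge_cycle P m e" and \<nu>: "\<And>F. \<nu> F \<in> bundle_group k" using c unfolding coloured_def by blast+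
  have P: "polygon P" using e unfolding edge_cycle_def by blast
  obtain W w where w: "edge_cycle W n w"
    using polygon_with_fewer_edges[OF P m(2)] m edge_cycle_card[OF e] by auto
  obtain T t where t: "edge_cycle T l t"
    using polygon_with_fewer_edges[OF P m(3)] m edge_cycle_card[OF e] by auto
  obtain \<omega> where \<omega>: "\<And>i. i < n \<Longrightarrow> \<omega> (w i) = \<nu> (e i)" "\<And>F. \<omega> F \<in> bundle_group k"
    using pull_back[OF w, of "\<lambda>i. \<nu> (e i)" k] \<nu> by blast
  obtain \<tau> where \<tau>: "\<And>i. i < l \<Longrightarrow> \<tau> (t i) = \<nu> (e ((n - 1 + i) mod m))" "\<And>F. \<tau> F \<in> bundle_group k"
    using pull_back[OF t, of "\<lambda>i. \<nu> (e ((n - 1 + i) mod m))" k] \<nu> by blast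
  have "fibre_sum (W, \<omega>) (T, \<tau>) (P, \<nu>)"
    by (rule fibre_sum_cut[OF e w t m(1)]) (simp_all only: \<omega>(1) \<tau>(1))
  then show ?thesis by (rule that[OF w t _ \<omega>(2) \<tau>(2) \<omega>(1) \<tau>(1)])
qed

lemma mod_shift_neq:
  fixes p a b m :: nat
  assumes "a < b" "b - a < m"
  shows "(p + a) mod m \<noteq> (p + b) mod m"
proof
  assume "(p + a) mod m = (p + b) mod m"
  then have "m dvd (p + b) - (p + a)" using assms mod_eq_dvd_iff_nat[of "p + a" "p + b" m] by simp
  then have "m dvd b - a" by simp
  then show False using assms by (auto dest: dvd_imp_le)
qed

text \<open>
  A cyclic word with three letters has three consecutive different letters.  If the middle one
  occurs only once, then the other two alternate in the rest of the word, and one can move on by one.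
  This yields an edge of a polygon whose removal preserves the set of colours and does not make
  neighbours of equal colour.
\<close>

lemma removable_letter:
  fixes d :: "nat \<Rightarrow> base_group"
  assumes m: "4 \<le> m" and per: "\<And>i. d (i mod m) = d i" and nz: "\<And>i. d i \<noteq> 0" and adj: "\<And>i. d i \<noteq> d (Suc i)"
    and three: "d x \<noteq> d y" "d y \<noteq> d z" "d x \<noteq> d z"
  obtains p j where "d p \<noteq> d (p + 2)" "d j = d (p + 1)" "j < m" "j \<noteq> (p + 1) mod m"
proof -
  have "\<exists>p. d p \<noteq> d (p + 2)"
  proof (rule ccontr)
    assume "\<not> (\<exists>p. d p \<noteq> d (p + 2))"
    then have s: "d (Suc (Suc p)) = d p" for p by (metis add_2_eq_Suc')
    have "d i = d 0 \<and> d (Suc i) = d 1 \<or> d i = d 1 \<and> d (Suc i) = d 0" for i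
      by (induction i) (auto simp: s)
    then show False using three by metis
  qed
  then obtain p where p: "d p \<noteq> d (p + 2)" by blast
  show ?thesis
  proof (cases "\<exists>j. d j = d (p + 1) \<and> j mod m \<noteq> (p + 1) mod m")
    case True
    then obtain j where "d j = d (p + 1)" "j mod m \<noteq> (p + 1) mod m" by blast
    then show ?thesis using p m by (intro that[of p "j mod m"]) (simp_all add: per)
  next
    case False
    have d1: "d p \<noteq> d (p + 1)" "d (p + 1) \<noteq> d (p + 2)" "d (p + 2) \<noteq> d (p + 3)"
      using adj[of p] adj[of "p + 1"] adj[of "p + 2"] by (simp_all add: eval_nat_numeral)
    have all: "d i = d p \<or> d i = d (p + 1) \<or> d i = d (p + 2)" for i
      using base_group_cases[OF nz[of p] nz[of "p + 1"] d1(1), of "d i"]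
        base_group_cases[OF nz[of p] nz[of "p + 1"] d1(1), of "d (p + 2)"] nz[of i] nz[of "p + 2"] d1 p by metis
    have "(p + 1) mod m \<noteq> (p + 3) mod m" by (rule mod_shift_neq) (use m in auto)
    then have "d (p + 3) \<noteq> d (p + 1)" using False by metis
    then have p3: "d (p + 1) \<noteq> d (p + 1 + 2)" by (simp add: numeral_3_eq_3)
    let ?j = "p + (m - 1)"
    have "(p + 1) mod m \<noteq> ?j mod m" by (rule mod_shift_neq) (use m in auto)
    then have j1: "d ?j \<noteq> d (p + 1)" using False by metis
    have "Suc ?j = p + m" using m by simp
    then have "d (Suc ?j) = d p" by (metis per mod_add_self2)
    then have "d ?j \<noteq> d p" using adj[of ?j] by simp
    then have j2: "d ?j = d (p + 2)" using all[of ?j] j1 by blast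
    have p2: "p + 2 = p + 1 + 1" by simp
    have ne: "(p + 2) mod m \<noteq> ?j mod m" by (rule mod_shift_neq) (use m in auto)
    have "d (?j mod m) = d (p + 1 + 1)" unfolding per using j2 unfolding p2 .
    then show ?thesis using p3 ne m unfolding p2 by (intro that[of "p + 1" "?j mod m"]) auto
  qed
qed

text \<open>
  The triangle on three consecutive edges of different colours takes away the middle edge.  In the
  rest the outer two become neighbours, and they are of different colour.  All three colours remain
  if the colour of the middle edge occurs elsewhere, so that the induction goes on until a triangle
  is left.
\<close>

lemma triangles:
  assumes k: "k \<ge> 1"
  shows "coloured k P \<nu> m e \<Longrightarrow> x < m \<Longrightarrow> y < m \<Longrightarrow> z < m \<Longrightarrow>
    fst (\<nu> (e x)) \<noteq> fst (\<nu> (e y)) \<Longrightarrow> fst (\<nu> (e y)) \<noteq> fst (\<nu> (e z)) \<Longrightarrow> fst (\<nu> (e x)) \<noteq> fst (\<nu> (e z)) \<Longrightarrow>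
    \<exists>Xs. (\<forall>X\<in>set Xs. projective_bundle_pair TYPE(line_carrier) k RP2 glued_action X) \<and> iterated_fibre_sum Xs (P, \<nu>)"
proof (induction m arbitrary: P \<nu> e x y z)
  case (Suc n)
  define m where "m = Suc n"
  note c = Suc.prems(1)[folded m_def]
  have m3: "3 \<le> m" and bij: "bij_betw e {..<m} (facets P)" using c unfolding coloured_def edge_cycle_def by blast+
  show ?case
  proof (cases "m = 3")
    case True
    then show ?thesis
      using triangle_pair[OF k c[unfolded True]] by (intro exI[of _ "[(P, \<nu>)]"]) (simp add: iterated_fibre_sum_def)
  next
    case False
    then have m4: "4 \<le> m" using m3 by simp
    define d where "d i = fst (\<nu> (e (i mod m)))" for i
    have lt: "i mod m < m" for i using m3 by simp
    have per: "d (i mod m) = d i" for i by (simp add: d_def)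
    have nz: "d i \<noteq> 0" for i using c lt unfolding coloured_def d_def by blast
    have adj: "d i \<noteq> d (Suc i)" for i
    proof -
      have "fst (\<nu> (e (i mod m))) \<noteq> fst (\<nu> (e (Suc (i mod m) mod m)))" using c lt unfolding coloured_def by blast
      then show ?thesis by (simp add: d_def mod_Suc_eq)
    qed
    have three: "d x \<noteq> d y" "d y \<noteq> d z" "d x \<noteq> d z"
      using Suc.prems(2-7) by (simp_all add: d_def m_def)
    obtain p j where pj: "d p \<noteq> d (p + 2)" "d j = d (p + 1)" "j < m" "j \<noteq> (p + 1) mod m"
      using removable_letter[OF m4 per nz adj three] by blast
    define e' where "e' i = e ((i + (p + 2)) mod m)" for i
    have c': "coloured k P \<nu> m e'" unfolding e'_def[abs_def] by (rule coloured_rotate[OF c])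
    have col: "fst (\<nu> (e' i)) = d (i + (p + 2))" for i by (simp add: e'_def d_def)
    have shift: "d (i + m) = d i" for i by (simp add: d_def)
    have c0: "fst (\<nu> (e' 0)) = d (p + 2)" and c1: "fst (\<nu> (e' (m - 1))) = d (p + 1)" and c2: "fst (\<nu> (e' (m - 2))) = d p"
    proof -
      have eq: "m - 1 + (p + 2) = p + 1 + m" "m - 2 + (p + 2) = p + m" using m4 by auto
      show "fst (\<nu> (e' 0)) = d (p + 2)" unfolding col by (simp only: add_0)
      show "fst (\<nu> (e' (m - 1))) = d (p + 1)" unfolding col eq by (rule shift)
      show "fst (\<nu> (e' (m - 2))) = d p" unfolding col eq by (rule shift)
    qed
    have bij': "bij_betw e' {..<m} (facets P)" using c' unfolding coloured_def edge_cycle_def by blast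
    have "e j \<in> facets P" using bij_betwE[OF bij] pj(3) by blast
    then have "e j \<in> e' ` {..<m}" using bij' by (simp only: bij_betw_def)
    then obtain j' where j': "j' < m" "e' j' = e j" by (metis imageE lessThan_iff)
    have "j' \<noteq> m - 1"
    proof
      assume "j' = m - 1"
      then have eq: "j' + (p + 2) = p + 1 + m" using m4 by simp
      have "e' j' = e ((p + 1) mod m)" unfolding e'_def eq by (simp only: mod_add_self2)
      then have "e j = e ((p + 1) mod m)" by (simp only: j'(2))
      then have "j = (p + 1) mod m"
        by (rule inj_onD[OF bij_betw_imp_inj_on[OF bij]]) (use pj(3) lt in \<open>simp_all only: lessThan_iff\<close>)
      then show False using pj(4) by simp
    qed
    then have j'n: "j' < m - 1" using j'(1) by simp
    have cj': "fst (\<nu> (e' j')) = d (p + 1)" using pj(2,3) j'(2) by (simp add: d_def)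
    obtain W w \<omega> T t \<tau> where w: "edge_cycle W (m - 1) w" and t: "edge_cycle T 3 t"
      and fs: "fibre_sum (W, \<omega>) (T, \<tau>) (P, \<nu>)"
      and \<omega>G: "\<And>F. \<omega> F \<in> bundle_group k" and \<tau>G: "\<And>F. \<tau> F \<in> bundle_group k"
      and \<omega>: "\<And>i. i < m - 1 \<Longrightarrow> \<omega> (w i) = \<nu> (e' i)" and \<tau>: "\<And>i. i < 3 \<Longrightarrow> \<tau> (t i) = \<nu> (e' ((m - 1 - 1 + i) mod m))"
      by (rule cut_off[OF c', of "m - 1" 3]) (use m4 in auto)
    have dis: "d p \<noteq> d (p + 1)" "d (p + 1) \<noteq> d (p + 2)" using adj[of p] adj[of "p + 1"] by simp_all
    have nonzero: "fst (\<nu> (e' i)) \<noteq> 0" for i unfolding col by (rule nz)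
    have change: "fst (\<nu> (e' i)) \<noteq> fst (\<nu> (e' (Suc i mod m)))" if "i < m" for i
      using c' that unfolding coloured_def by blast
    have cW: "coloured k W \<omega> (m - 1) w"
      unfolding coloured_def
    proof (intro conjI w allI impI \<omega>G)
      fix i assume i: "i < m - 1"
      show "fst (\<omega> (w i)) \<noteq> 0" unfolding \<omega>[OF i] by (rule nonzero)
      show "fst (\<omega> (w i)) \<noteq> fst (\<omega> (w (Suc i mod (m - 1))))"
      proof (cases "Suc i = m - 1")
        case True
        then have "i = m - 2" by simp
        then have A: "\<omega> (w i) = \<nu> (e' (m - 2))" using \<omega>[OF i] by simp
        have B: "\<omega> (w (Suc i mod (m - 1))) = \<nu> (e' 0)" using \<omega>[of 0] m4 unfolding True by simp
        show ?thesis unfolding A B c0 c2 by (rule pj(1))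
      next
        case False
        then have i': "Suc i < m - 1" using i by simp
        then have A: "Suc i mod (m - 1) = Suc i" "Suc i mod m = Suc i" by simp_all
        have "i < m" using i by simp
        from change[OF this] show ?thesis unfolding A \<omega>[OF i] \<omega>[OF i'] .
      qed
    qed
    have T0: "\<tau> (t 0) = \<nu> (e' (m - 2))" and T1: "\<tau> (t 1) = \<nu> (e' (m - 1))" and T2: "\<tau> (t 2) = \<nu> (e' 0)"
    proof -
      have "m - 1 - 1 + 0 = m - 2" "m - 1 - 1 + 1 = m - 1" "m - 1 - 1 + 2 = m" using m4 by arith+
      then have eq: "(m - 1 - 1 + 0) mod m = m - 2" "(m - 1 - 1 + 1) mod m = m - 1" "(m - 1 - 1 + 2) mod m = 0"
        using m4 by (simp_all only:) simp_all
      show "\<tau> (t 0) = \<nu> (e' (m - 2))" using \<tau>[of 0] unfolding eq by simp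
      show "\<tau> (t 1) = \<nu> (e' (m - 1))" using \<tau>[of 1] unfolding eq by simp
      show "\<tau> (t 2) = \<nu> (e' 0)" using \<tau>[of 2] unfolding eq by simp
    qed
    have cT: "fst (\<tau> (t 0)) = d p" "fst (\<tau> (t 1)) = d (p + 1)" "fst (\<tau> (t 2)) = d (p + 2)"
      by (simp_all only: T0 T1 T2 c0 c1 c2)
    have cT': "coloured k T \<tau> 3 t"
      unfolding coloured_def
    proof (intro conjI t allI impI \<tau>G)
      fix i :: nat assume "i < 3"
      then have i: "i = 0 \<or> i = 1 \<or> i = 2" by auto
      have s: "Suc 0 mod 3 = 1" "Suc 1 mod 3 = 2" "Suc 2 mod 3 = 0" by simp_all
      show "fst (\<tau> (t i)) \<noteq> 0" using i by (elim disjE) (simp_all only: cT nz simp_thms)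
      show "fst (\<tau> (t i)) \<noteq> fst (\<tau> (t (Suc i mod 3)))"
        using i by (elim disjE) (simp_all only: s cT dis pj(1)[symmetric] simp_thms)
    qed
    have n: "m - 1 = n" by (simp add: m_def)
    have "m - 2 < m - 1" using m4 by arith
    note W2 = \<omega>[OF this]
    have "0 < m - 1" using m4 by arith
    note W0 = \<omega>[OF this]
    have "\<exists>Xs. (\<forall>X\<in>set Xs. projective_bundle_pair TYPE(line_carrier) k RP2 glued_action X) \<and> iterated_fibre_sum Xs (W, \<omega>)"
    proof (rule Suc.IH[OF cW[unfolded n], of 0 j' "m - 2"])
      show "0 < n" "j' < n" "m - 2 < n" using m4 j'n n by simp_all
      show "fst (\<omega> (w 0)) \<noteq> fst (\<omega> (w j'))" unfolding W0 \<omega>[OF j'n] c0 cj' by (rule dis(2)[symmetric])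
      show "fst (\<omega> (w j')) \<noteq> fst (\<omega> (w (m - 2)))" unfolding W2 \<omega>[OF j'n] c2 cj' by (rule dis(1)[symmetric])
      show "fst (\<omega> (w 0)) \<noteq> fst (\<omega> (w (m - 2)))" unfolding W0 W2 c0 c2 by (rule pj(1)[symmetric])
    qed
    then obtain Xs where "\<forall>X\<in>set Xs. projective_bundle_pair TYPE(line_carrier) k RP2 glued_action X" "iterated_fibre_sum Xs (W, \<omega>)"
      by blast
    then show ?thesis
      using iterated_fibre_sum_snoc[OF _ fs] triangle_pair[OF k cT'] by (intro exI[of _ "Xs @ [(T, \<tau>)]"]) auto
  qed
qed simp

lemma alternating_coloured:
  assumes e: "edge_cycle P m e" and \<nu>: "\<And>F. \<nu> F \<in> bundle_group k" and m: "even m"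
    and \<alpha>\<beta>: "\<alpha> \<noteq> 0" "\<beta> \<noteq> 0" "\<alpha> \<noteq> \<beta>"
    and alt: "\<And>i. i < m \<Longrightarrow> fst (\<nu> (e i)) = (if even i then \<alpha> else \<beta>)"
  shows "coloured k P \<nu> m e"
  unfolding coloured_def
proof (intro conjI e allI impI \<nu>)
  fix i assume i: "i < m"
  show "fst (\<nu> (e i)) \<noteq> 0" using alt[OF i] \<alpha>\<beta> by simp
  have "Suc i mod m < m" using i by simp
  moreover have "even (Suc i mod m) \<longleftrightarrow> even (Suc i)" using dvd_mod_iff[of 2 m] m by blast
  ultimately show "fst (\<nu> (e i)) \<noteq> fst (\<nu> (e (Suc i mod m)))" using alt[OF i] alt[of "Suc i mod m"] \<alpha>\<beta> by auto
qed

text \<open>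
  Four consecutive edges whose colours alternate form a square of the required kind, and without
  the two inner ones the colours still alternate.
\<close>

lemma squares:
  assumes k: "k \<ge> 1" and \<alpha>\<beta>: "\<alpha> \<noteq> 0" "\<beta> \<noteq> 0" "\<alpha> \<noteq> \<beta>"
  shows "coloured k P \<nu> m e \<Longrightarrow> even m \<Longrightarrow> (\<And>i. i < m \<Longrightarrow> fst (\<nu> (e i)) = (if even i then \<alpha> else \<beta>)) \<Longrightarrow>
    \<exists>Xs. (\<forall>X\<in>set Xs. projective_bundle_pair TYPE(line_carrier) k T2 glued_action X) \<and> iterated_fibre_sum Xs (P, \<nu>)"
proof (induction m arbitrary: P \<nu> e rule: less_induct)
  case (less m)
  note c = less.prems(1) and alt = less.prems(3)
  have m3: "3 \<le> m" using c unfolding coloured_def edge_cycle_def by blast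
  show ?case
  proof (cases "m = 4")
    case True
    have "projective_bundle_pair TYPE(line_carrier) k T2 glued_action (P, \<nu>)"
      by (rule square_pair[OF k c[unfolded True]]) (simp_all add: alt True)
    then show ?thesis by (intro exI[of _ "[(P, \<nu>)]"]) (simp add: iterated_fibre_sum_def)
  next
    case False
    have m6: "6 \<le> m" using m3 False less.prems(2) by presburger
    obtain W w \<omega> T t \<tau> where w: "edge_cycle W (m - 2) w" and t: "edge_cycle T 4 t"
      and fs: "fibre_sum (W, \<omega>) (T, \<tau>) (P, \<nu>)"
      and \<omega>G: "\<And>F. \<omega> F \<in> bundle_group k" and \<tau>G: "\<And>F. \<tau> F \<in> bundle_group k"
      and \<omega>: "\<And>i. i < m - 2 \<Longrightarrow> \<omega> (w i) = \<nu> (e i)" and \<tau>: "\<And>i. i < 4 \<Longrightarrow> \<tau> (t i) = \<nu> (e ((m - 2 - 1 + i) mod m))"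
      by (rule cut_off[OF c, of "m - 2" 4]) (use m6 in auto)
    have ev: "even (m - 2)" using less.prems(2) m6 by simp
    have aW: "fst (\<omega> (w i)) = (if even i then \<alpha> else \<beta>)" if "i < m - 2" for i
      using alt[of i] that by (simp add: \<omega>)
    have cW: "coloured k W \<omega> (m - 2) w" by (rule alternating_coloured[OF w \<omega>G ev \<alpha>\<beta> aW])
    have aT: "fst (\<tau> (t i)) = (if even i then \<beta> else \<alpha>)" if "i < 4" for i
    proof -
      have "even ((m - 2 - 1 + i) mod m) \<longleftrightarrow> even (m - 2 - 1 + i)" using dvd_mod_iff[of 2 m] less.prems(2) by blast
      also have "\<dots> \<longleftrightarrow> odd i" using ev m6 by presburger
      finally have "even ((m - 2 - 1 + i) mod m) \<longleftrightarrow> odd i" .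
      moreover have "(m - 2 - 1 + i) mod m < m" using m3 by simp
      ultimately show ?thesis using alt[of "(m - 2 - 1 + i) mod m"] \<tau>[OF that] by simp
    qed
    have cT: "coloured k T \<tau> 4 t" by (rule alternating_coloured[OF t \<tau>G _ \<alpha>\<beta>(2,1) \<alpha>\<beta>(3)[symmetric] aT]) simp_all
    have pT: "projective_bundle_pair TYPE(line_carrier) k T2 glued_action (T, \<tau>)"
      by (rule square_pair[OF k cT]) (simp_all add: aT)
    have "m - 2 < m" using m6 by simp
    from less.IH[OF this cW ev aW]
    obtain Xs where "\<forall>X\<in>set Xs. projective_bundle_pair TYPE(line_carrier) k T2 glued_action X" "iterated_fibre_sum Xs (W, \<omega>)"
      by blast
    then show ?thesis
      using iterated_fibre_sum_snoc[OF _ fs] pT by (intro exI[of _ "Xs @ [(T, \<tau>)]"]) auto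
  qed
qed

text \<open>
  If only two colours occur, then they alternate and there are only squares; otherwise there are
  only triangles.
\<close>

lemma decomposition:
  assumes k: "k \<ge> 1" and c: "coloured k P \<nu> m e"
  shows "\<exists>\<kappa>s \<zeta>s. (\<forall>X\<in>set \<kappa>s. projective_bundle_pair TYPE(line_carrier) k RP2 glued_action X) \<and>
    (\<forall>X\<in>set \<zeta>s. projective_bundle_pair TYPE(line_carrier) k T2 glued_action X) \<and>
    iterated_fibre_sum (\<kappa>s @ \<zeta>s) (P, \<nu>)"
proof -
  let ?c = "\<lambda>i. fst (\<nu> (e i))"
  have m: "3 \<le> m" using c unfolding coloured_def edge_cycle_def by blast
  have nz: "?c i \<noteq> 0" and adj: "?c i \<noteq> ?c (Suc i mod m)" if "i < m" for i using c that unfolding coloured_def by blast+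
  have c01: "?c 0 \<noteq> ?c 1" using adj[of 0] m by simp
  show ?thesis
  proof (cases "\<exists>i<m. ?c i \<noteq> ?c 0 \<and> ?c i \<noteq> ?c 1")
    case True
    then obtain i where i: "i < m" "?c i \<noteq> ?c 0" "?c i \<noteq> ?c 1" by blast
    obtain Xs where "\<forall>X\<in>set Xs. projective_bundle_pair TYPE(line_carrier) k RP2 glued_action X" "iterated_fibre_sum Xs (P, \<nu>)"
      using triangles[OF k c _ _ i(1) c01 i(3)[symmetric] i(2)[symmetric]] m by auto
    then show ?thesis by (intro exI[of _ Xs] exI[of _ "[]"]) simp
  next
    case False
    then have two: "?c i = ?c 0 \<or> ?c i = ?c 1" if "i < m" for i using that by blast
    have alt: "?c i = (if even i then ?c 0 else ?c 1)" if "i < m" for i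
      using that
    proof (induction i)
      case (Suc i)
      then have "?c (Suc i) \<noteq> ?c i" using adj[of i] by simp
      then show ?case using Suc two[of "Suc i"] c01 by (auto split: if_splits)
    qed simp
    have "Suc (m - 1) mod m = 0" using m by simp
    then have "?c (m - 1) \<noteq> ?c 0" using adj[of "m - 1"] m by simp
    then have "odd (m - 1)" using alt[of "m - 1"] m by (auto split: if_splits)
    then have ev: "even m" using m by simp
    have "?c 0 \<noteq> 0" "?c 1 \<noteq> 0" using nz m by simp_all
    from squares[OF k this c01 c ev alt]
    obtain Xs where "\<forall>X\<in>set Xs. projective_bundle_pair TYPE(line_carrier) k T2 glued_action X" "iterated_fibre_sum Xs (P, \<nu>)"
      by blast
    then show ?thesis by (intro exI[of _ "[]"] exI[of _ Xs]) simp
  qed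
qed

theorem theorem1p4:
  fixes P :: "plane set" and M :: "'m topology" and a :: "base_group \<Rightarrow> 'm \<Rightarrow> 'm"
    and k :: nat and L :: "nat \<Rightarrow> ('e, 'm) vbundle"
  assumes "small_cover_over P M a"
    and "k \<ge> 1"
    and "\<And>i. i < k \<Longrightarrow> line_bundle_over M (L i)"
  shows "(\<exists>A. \<forall>i<k. lifts_action a (L i) (A i)) \<and>
    (\<forall>A. (\<forall>i<k. lifts_action a (L i) (A i)) \<longrightarrow>
      (\<exists>\<kappa>s \<zeta>s R \<rho>.
         (\<forall>X\<in>set \<kappa>s. projective_bundle_pair TYPE(line_carrier) k RP2 glued_action X) \<and>
         (\<forall>X\<in>set \<zeta>s. projective_bundle_pair TYPE(line_carrier) k T2 glued_action X) \<and>
         iterated_fibre_sum (\<kappa>s @ \<zeta>s) (R, \<rho>) \<and>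
         weak_equivariantly_homeomorphic (bundle_group k)
           (projectivization (whitney_sum M k L)) (projective_action k L A)
           (bundle_cover k R \<rho>) glued_action))"
proof (intro conjI allI impI)
  obtain \<mu> q where model: "surface_model P \<mu> M a id q" using small_cover_model[OF assms(1)] by blast
  interpret surface_model P \<mu> M a id q by (rule model)
  have "\<exists>B. lifts_action a (L i) B" if i: "i < k" for i
  proof -
    obtain s \<epsilon> where "frame (L i) s \<epsilon>" using frame_exists[OF assms(3)[OF i]] by blast
    then show ?thesis using lift_of_frame[OF assms(3)[OF i]] by blast
  qed
  then have "\<forall>i. \<exists>B. i < k \<longrightarrow> lifts_action a (L i) B" by blast
  from choice[OF this] show "\<exists>A. \<forall>i<k. lifts_action a (L i) (A i)" by blast
next
  fix A assume A: "\<forall>i<k. lifts_action a (L i) (A i)"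
  obtain \<mu> q where model: "surface_model P \<mu> M a id q" using small_cover_model[OF assms(1)] by blast
  interpret surface_model P \<mu> M a id q by (rule model)
  have "\<exists>z. frame (L i) (fst z) (snd z) \<and> equivariant_frame (A i) (fst z)" if i: "i < k" for i
  proof -
    obtain s \<epsilon> where "frame (L i) s \<epsilon>" "equivariant_frame (A i) s"
      using frame_of_lift[OF assms(3)[OF i]] A i by blast
    then show ?thesis by (intro exI[of _ "(s, \<epsilon>)"]) simp
  qed
  then have "\<forall>i. \<exists>z. i < k \<longrightarrow> frame (L i) (fst z) (snd z) \<and> equivariant_frame (A i) (fst z)" by blast
  from choice[OF this] obtain z where z: "\<And>i. i < k \<Longrightarrow> frame (L i) (fst (z i)) (snd (z i))"
    "\<And>i. i < k \<Longrightarrow> equivariant_frame (A i) (fst (z i))" by blast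
  interpret framed_sum P \<mu> M a id q k L "\<lambda>i. fst (z i)" "\<lambda>i. snd (z i)"
    by unfold_locales (use assms z in auto)
  have "encoded_by k M a L A (P, \<nu>)" by (rule encoded) (use A z in auto)
  then have weak: "weak_equivariantly_homeomorphic (bundle_group k)
      (projectivization (whitney_sum M k L)) (projective_action k L A) (bundle_cover k P \<nu>) glued_action"
    unfolding encoded_by_def split weak_equivariantly_homeomorphic_def by blast
  obtain m e where e: "edge_cycle P m e" using edge_cycle_exists[OF polygon] .
  have m: "3 \<le> m" using e unfolding edge_cycle_def by blast
  have "coloured k P \<nu> m e"
    unfolding coloured_def
  proof (intro conjI e allI impI \<nu>_in)
    fix i assume i: "i < m"
    have j: "Suc i mod m < m" "i \<noteq> Suc i mod m" using i m by (simp, cases "Suc i = m", auto)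
    have "e i \<inter> e (Suc i mod m) \<noteq> {}" using edge_cycle_meet(3)[OF e i j] by (simp add: cyclic_neighbours_def)
    then obtain x where x: "x \<in> e i" "x \<in> e (Suc i mod m)" by blast
    have "e i \<in> facets P" "e (Suc i mod m) \<in> facets P" "e i \<noteq> e (Suc i mod m)"
      using edge_cycle_meet(1,2)[OF e i j] edge_cycle_meet(1)[OF e j(1) i j(2)[symmetric]] by blast+
    from characteristic_meet[OF this x]
    show "fst (\<nu> (e i)) \<noteq> 0" "fst (\<nu> (e i)) \<noteq> fst (\<nu> (e (Suc i mod m)))" by (simp_all add: \<nu>_def)
  qed
  from decomposition[OF assms(2) this] weak
  show "\<exists>\<kappa>s \<zeta>s R \<rho>.
         (\<forall>X\<in>set \<kappa>s. projective_bundle_pair TYPE(line_carrier) k RP2 glued_action X) \<and>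
         (\<forall>X\<in>set \<zeta>s. projective_bundle_pair TYPE(line_carrier) k T2 glued_action X) \<and>
         iterated_fibre_sum (\<kappa>s @ \<zeta>s) (R, \<rho>) \<and>
         weak_equivariantly_homeomorphic (bundle_group k)
           (projectivization (whitney_sum M k L)) (projective_action k L A)
           (bundle_cover k R \<rho>) glued_action"
    by blast
qed

end
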